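(* Let $P$ and $Q$ be nonzero elements of $M(m,\widetilde{\mathcal D}_* )$ such that $[P,Q]=0$, $P\in M(m,\mathcal D_* )$, and $\sigma(P)$ is a scalar matrix satisfying $$\sum_{\nu=1}^n\gamma_\nu\frac{\partial\bar\sigma_*(P)}{\partial\xi_\nu}\not\equiv 0\quad\text{for all }\gamma=(\gamma_1,\ldots,\gamma_n)\in\mathbb N^n\setminus\{0\}$$ (where $\not\equiv 0$ means "not identically zero" as a function of $(x,\xi)$). Suppose that $\sigma_{\operatorname{ord}P-1}(P)$ or $\sigma(Q)$ is a scalar matrix. Then $[\sigma_*(P),\sigma_*(Q)]=0$ and $\bar\sigma_*(Q)\neq 0$. Moreover, if $\sigma(P)(t,x,\xi,\tau)$ does not depend on $t$, then $\sigma(Q)(t,x,\xi,\tau)$ does not depend on $t$ either.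
   Context: Setting. $M$ is a connected real analytic manifold of dimension $n+n'$, and $N_1,\ldots,N_n$ are one-codimensional submanifolds normally crossing at $N=N_1\cap\cdots\cap N_n$, with $N$ connected. A coordinate system $(t,x)=(t_1,\ldots,t_n,x_1,\ldots,x_{n'})$ is fixed in which $N_i=\{t_i=0\}$; $M$ is taken to be the domain of these coordinates, so $N=\{t=0\}$ with coordinates $x$. $\mathbb N=\{0,1,2,\ldots\}$. $\mathcal A_N$ is the space of complex-valued real analytic functions on $N$, and $\mathcal A_M$ is the space of those defined on a neighborhood of $N$ in $M$ (identified if they agree near $N$). $\mathcal D_N$ is the ring of differential operators on $N$ with coefficients in $\mathcal A_N$. $\vartheta_i=t_i\partial/\partial t_i$, $\vartheta^\alpha=\vartheta_1^{\alpha_1}\cdots\vartheta_n^{\alpha_n}$, $\partial_x^\beta=\partial^{|\beta|}/\partial x_1^{\beta_1}\cdots\partial x_{n'}^{\beta_{n'}}$. $M(m,R)$ is the ring of $m\times m$ matrices over $R$ ($m\ge1$); $R[\xi]=R[\xi_1,\ldots,\xi_n]$. $\widetilde{\mathcal D}_*$ is the ring of differential operators (finite sums) $P=\sum_{\alpha\in\mathbb N^n,\beta\in\mathbb N^{n'}}a_{\alpha,\beta}(t,x)\vartheta^\alpha\partial_x^\beta$ with $a_{\alpha,\beta}\in\mathcal A_M$; $\mathcal D_*$ is the subring of those with $a_{\alpha,\beta}(0,x)=0$ whenever $\beta\neq0$. For such a scalar $P$: $\sigma_*(P)(x,\xi,\partial_x)=\sum_{\alpha,\beta}a_{\alpha,\beta}(0,x)\xi^\alpha\partial_x^\beta\in\mathcal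 D_N[\xi]$; $\sigma_k(P)(t,x,\xi,\tau)=\sum_{|\alpha|+|\beta|=k}a_{\alpha,\beta}(t,x)\xi^\alpha\tau^\beta$; $\operatorname{ord}P$ is the maximal $k$ with $\sigma_k(P)\ne0$. For a matrix $P=(P_{ij})$: $\operatorname{ord}P$ is the maximal order of its components; $\sigma_k(P)=(\sigma_k(P_{ij}))$; $\sigma(P)=\sigma_{\operatorname{ord}P}(P)$; $\sigma_*(P)=(\sigma_*(P_{ij}))\in M(m,\mathcal D_N[\xi])$; $\bar\sigma_*(P)=\sigma(P)(0,x,\xi,\partial_x)\in M(m,\mathcal D_N[\xi])$. If $P\in M(m,\mathcal D_* )$, then $\sigma_*(P)$ and $\bar\sigma_*(P)$ lie in $M(m,\mathcal A_N[\xi])$. *)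

theory Defs
  imports "HOL-Analysis.Analysis"
begin

text \<open>
  Points of the coordinate domain are vectors \<open>p :: real ^ 'k\<close>; the coordinates with index in
  \<open>T :: 'k set\<close> are \<open>t\<^sub>1, \<dots>, t\<^sub>n\<close> and the remaining ones are \<open>x\<^sub>1, \<dots>, x\<^sub>n\<^sub>'\<close>, so \<open>p = (t, x)\<close>,
  \<open>n = card T\<close>, \<open>n' = card (- T)\<close> (and \<open>n' = 0\<close> is the case \<open>T = UNIV\<close>).  In the same way one
  multi-index \<open>\<kappa> :: 'k \<Rightarrow> nat\<close> is the pair \<open>(\<alpha>, \<beta>)\<close>, with \<open>\<alpha>\<close> the values on \<open>T\<close> and \<open>\<beta>\<close> the
  values off \<open>T\<close>, and one covector \<open>\<zeta> :: real ^ 'k\<close> is the pair \<open>(\<xi>, \<tau>)\<close>.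
  The linear order on \<open>'k\<close> only serves to write composites of the commuting operators
  \<open>\<theta>\<^sub>i\<close> and \<open>\<partial>/\<partial>x\<^sub>j\<close> in a definite order.
\<close>

type_synonym 'k pt = "real ^ 'k"
type_synonym 'k fn = "'k pt \<Rightarrow> complex"
type_synonym 'k coeffs = "('k \<Rightarrow> nat) \<Rightarrow> 'k fn"

definition mi_size :: "('k::finite \<Rightarrow> nat) \<Rightarrow> nat"
  where "mi_size \<kappa> = (\<Sum>i\<in>UNIV. \<kappa> i)"


subsection \<open>The submanifold and analytic functions\<close>

definition core :: "'k::finite set \<Rightarrow> 'k pt set \<Rightarrow> 'k pt set"
  where "core T M = {p \<in> M. \<forall>i\<in>T. p $ i = 0}"

text \<open>\<open>near T M \<Phi>\<close>: the property \<open>\<Phi>\<close> holds on a neighbourhood of \<open>N = core T M\<close> in \<open>M\<close>.  Elements of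
  \<open>\<A>\<^sub>M\<close> are handled through representatives; two of them are equal when they agree near \<open>N\<close>.\<close>

definition near :: "'k::finite set \<Rightarrow> 'k pt set \<Rightarrow> ('k pt \<Rightarrow> bool) \<Rightarrow> bool"
  where "near T M \<Phi> \<longleftrightarrow> (\<exists>W. open W \<and> core T M \<subseteq> W \<and> W \<subseteq> M \<and> (\<forall>p\<in>W. \<Phi> p))"

text \<open>Analyticity at \<open>p\<close> in the variables with index in \<open>I\<close>, on the slice through \<open>p\<close> where the other
  coordinates are kept fixed: with \<open>I = UNIV\<close> this is real analyticity at \<open>p\<close>, with \<open>I = - T\<close> and
  \<open>p \<in> N\<close> it is real analyticity at \<open>p\<close> of a function on \<open>N\<close>.\<close>

definition real_analytic_at :: "'k::finite set \<Rightarrow> 'k fn \<Rightarrow> 'k pt \<Rightarrow> bool"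
  where "real_analytic_at I f p \<longleftrightarrow>
    (\<exists>r>0. \<exists>c :: ('k \<Rightarrow> nat) \<Rightarrow> complex. \<forall>q\<in>ball p r. (\<forall>i\<in>- I. q $ i = p $ i) \<longrightarrow>
      ((\<lambda>\<kappa>. c \<kappa> * (\<Prod>i\<in>I. of_real (q $ i - p $ i) ^ \<kappa> i)) has_sum f q) {\<kappa>. \<forall>i\<in>- I. \<kappa> i = 0})"

definition analytic_M :: "'k::finite set \<Rightarrow> 'k pt set \<Rightarrow> 'k fn set"
  where "analytic_M T M = {f. near T M (real_analytic_at UNIV f)}"

definition analytic_N :: "'k::finite set \<Rightarrow> 'k pt set \<Rightarrow> 'k fn set"
  where "analytic_N T M = {f. \<forall>p\<in>core T M. real_analytic_at (- T) f p}"


subsection \<open>Differential operators\<close>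

definition partial_deriv :: "'k::finite \<Rightarrow> 'k fn \<Rightarrow> 'k fn"
  where "partial_deriv i f p = vector_derivative (\<lambda>s. f (p + s *\<^sub>R axis i 1)) (at 0)"

definition theta :: "'k::finite \<Rightarrow> 'k fn \<Rightarrow> 'k fn"
  where "theta i f p = of_real (p $ i) * partial_deriv i f p"

definition op_power ::
    "('k \<Rightarrow> 'k fn \<Rightarrow> 'k fn) \<Rightarrow> 'k::{finite,linorder} set \<Rightarrow> ('k \<Rightarrow> nat) \<Rightarrow> 'k fn \<Rightarrow> 'k fn"
  where "op_power D I \<kappa> = foldr (\<lambda>i g. (D i ^^ \<kappa> i) \<circ> g) (sorted_list_of_set I) id"

text \<open>A scalar operator \<open>P = \<Sum> a\<^sub>\<alpha>\<^sub>\<beta> \<theta>\<^sup>\<alpha> \<partial>\<^sub>x\<^sup>\<beta>\<close> is given by its coefficients, which it determines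
  uniquely near \<open>N\<close>.  An \<open>m \<times> m\<close> matrix of operators is a matrix of coefficient families.\<close>

definition D_tilde :: "'k::finite set \<Rightarrow> 'k pt set \<Rightarrow> 'k coeffs set"
  where "D_tilde T M = {a. finite {\<kappa>. a \<kappa> \<noteq> (\<lambda>_. 0)} \<and> (\<forall>\<kappa>. a \<kappa> \<in> analytic_M T M)}"

definition D_star :: "'k::finite set \<Rightarrow> 'k pt set \<Rightarrow> 'k coeffs set"
  where "D_star T M = {a \<in> D_tilde T M.
    \<forall>\<kappa>. (\<exists>i\<in>- T. \<kappa> i \<noteq> 0) \<longrightarrow> (\<forall>p\<in>core T M. a \<kappa> p = 0)}"

definition mat_over :: "'a set \<Rightarrow> ('a ^ 'm ^ 'm) set"
  where "mat_over R = {P. \<forall>i j. P $ i $ j \<in> R}"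

definition op_apply :: "'k::{finite,linorder} set \<Rightarrow> 'k coeffs \<Rightarrow> 'k fn \<Rightarrow> 'k fn"
  where "op_apply T a u p =
    (\<Sum>\<kappa> | a \<kappa> \<noteq> (\<lambda>_. 0). a \<kappa> p * op_power theta T \<kappa> (op_power partial_deriv (- T) \<kappa> u) p)"

text \<open>The \<open>(i, j)\<close> entry of the product \<open>P Q\<close> in the matrix ring, as an operator acting on \<open>u\<close>.\<close>

definition op_mult ::
    "'k::{finite,linorder} set \<Rightarrow> 'k coeffs ^ 'm ^ 'm \<Rightarrow> 'k coeffs ^ 'm ^ 'm \<Rightarrow>
      'm \<Rightarrow> 'm \<Rightarrow> 'k fn \<Rightarrow> 'k fn"
  where "op_mult T P Q i j u p = (\<Sum>l\<in>UNIV. op_apply T (P $ i $ l) (op_apply T (Q $ l $ j) u) p)"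

definition op_commute ::
    "'k::{finite,linorder} set \<Rightarrow> 'k pt set \<Rightarrow> 'k coeffs ^ 'm ^ 'm \<Rightarrow> 'k coeffs ^ 'm ^ 'm \<Rightarrow> bool"
  where "op_commute T M P Q \<longleftrightarrow>
    (\<forall>i j. \<forall>u\<in>analytic_M T M. near T M (\<lambda>p. op_mult T P Q i j u p = op_mult T Q P i j u p))"

definition op_nonzero :: "'k::finite set \<Rightarrow> 'k pt set \<Rightarrow> 'k coeffs ^ 'm ^ 'm \<Rightarrow> bool"
  where "op_nonzero T M P \<longleftrightarrow> (\<exists>i j \<kappa>. \<not> near T M (\<lambda>p. (P $ i $ j) \<kappa> p = 0))"


subsection \<open>Symbols\<close>

text \<open>The degree is an integer so that \<open>\<sigma>\<^sub>-\<^sub>1 = 0\<close>.\<close>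

definition sigma :: "int \<Rightarrow> 'k::finite coeffs \<Rightarrow> 'k pt \<Rightarrow> 'k pt \<Rightarrow> complex"
  where "sigma k a p \<zeta> =
    (\<Sum>\<kappa> | a \<kappa> \<noteq> (\<lambda>_. 0) \<and> int (mi_size \<kappa>) = k. a \<kappa> p * (\<Prod>i\<in>UNIV. of_real (\<zeta> $ i) ^ \<kappa> i))"

definition op_ord :: "'k::finite set \<Rightarrow> 'k pt set \<Rightarrow> 'k coeffs \<Rightarrow> nat"
  where "op_ord T M a = Max {k. \<not> near T M (\<lambda>p. \<forall>\<zeta>. sigma (int k) a p \<zeta> = 0)}"

text \<open>Zero entries (of order \<open>- \<infinity>\<close>) do not contribute to the order of a nonzero matrix.\<close>

definition mat_ord :: "'k::finite set \<Rightarrow> 'k pt set \<Rightarrow> 'k coeffs ^ 'm ^ 'm \<Rightarrow> nat"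
  where "mat_ord T M P = Max {op_ord T M (P $ i $ j) | i j.
    \<exists>\<kappa>. \<not> near T M (\<lambda>p. (P $ i $ j) \<kappa> p = 0)}"

definition mat_sigma ::
    "int \<Rightarrow> 'k::finite coeffs ^ 'm ^ 'm \<Rightarrow> 'k pt \<Rightarrow> 'k pt \<Rightarrow> complex ^ 'm ^ 'm"
  where "mat_sigma k P p \<zeta> = (\<chi> i j. sigma k (P $ i $ j) p \<zeta>)"

definition princ_symbol ::
    "'k::finite set \<Rightarrow> 'k pt set \<Rightarrow> 'k coeffs ^ 'm ^ 'm \<Rightarrow>
      'k pt \<Rightarrow> 'k pt \<Rightarrow> complex ^ 'm ^ 'm"
  where "princ_symbol T M P = mat_sigma (int (mat_ord T M P)) P"

definition scalar_symbol ::
    "'k::finite set \<Rightarrow> 'k pt set \<Rightarrow> ('k pt \<Rightarrow> 'k pt \<Rightarrow> complex ^ 'm ^ 'm) \<Rightarrow> bool"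
  where "scalar_symbol T M S \<longleftrightarrow> near T M (\<lambda>p. \<forall>\<zeta>. \<exists>c. S p \<zeta> = mat c)"

definition indep_of_t ::
    "'k::finite set \<Rightarrow> 'k pt set \<Rightarrow> ('k pt \<Rightarrow> 'k pt \<Rightarrow> complex ^ 'm ^ 'm) \<Rightarrow> bool"
  where "indep_of_t T M S \<longleftrightarrow>
    (\<exists>W. open W \<and> core T M \<subseteq> W \<and> W \<subseteq> M \<and>
      (\<forall>p\<in>W. \<forall>q\<in>W. (\<forall>i\<in>- T. p $ i = q $ i) \<longrightarrow> (\<forall>\<zeta>. S p \<zeta> = S q \<zeta>)))"


subsection \<open>The ring of polynomials in \<open>\<xi>\<close> over the differential operators on \<open>N\<close>\<close>

text \<open>A family \<open>b\<close> of functions on \<open>N\<close> (extended by \<open>0\<close>) stands for the element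
  \<open>\<Sum> b\<^sub>\<alpha>\<^sub>\<beta> \<xi>\<^sup>\<alpha> \<partial>\<^sub>x\<^sup>\<beta>\<close> of \<open>\<D>\<^sub>N[\<xi>]\<close>.  A point of \<open>N\<close> is \<open>(0, x)\<close>, so substituting \<open>t = 0\<close> is restriction
  to \<open>N\<close>.\<close>

definition sigma_star ::
    "'k::finite set \<Rightarrow> 'k pt set \<Rightarrow> 'k coeffs ^ 'm ^ 'm \<Rightarrow> 'k coeffs ^ 'm ^ 'm"
  where "sigma_star T M P =
    (\<chi> i j. (\<lambda>\<kappa> x. if x \<in> core T M then (P $ i $ j) \<kappa> x else 0))"

definition sigma_bar_star ::
    "'k::finite set \<Rightarrow> 'k pt set \<Rightarrow> 'k coeffs ^ 'm ^ 'm \<Rightarrow> 'k coeffs ^ 'm ^ 'm"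
  where "sigma_bar_star T M P =
    (\<chi> i j. (\<lambda>\<kappa> x. if x \<in> core T M \<and> mi_size \<kappa> = mat_ord T M P then (P $ i $ j) \<kappa> x else 0))"

text \<open>The coefficient of \<open>\<xi>\<^sup>\<alpha>\<close>, an element of \<open>\<D>\<^sub>N\<close> acting on functions on \<open>N\<close>.\<close>

definition xi_coeff ::
    "'k::{finite,linorder} set \<Rightarrow> 'k coeffs \<Rightarrow> ('k \<Rightarrow> nat) \<Rightarrow> 'k fn \<Rightarrow> 'k fn"
  where "xi_coeff T b \<alpha> u x =
    (\<Sum>\<kappa> | b \<kappa> \<noteq> (\<lambda>_. 0) \<and> (\<forall>i\<in>T. \<kappa> i = \<alpha> i). b \<kappa> x * op_power partial_deriv (- T) \<kappa> u x)"

text \<open>The coefficient of \<open>\<xi>\<^sup>\<gamma>\<close> in the \<open>(i, j)\<close> entry of the product \<open>B C\<close>; the \<open>\<xi>\<^sub>\<nu>\<close> are central.\<close>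

definition xi_mult ::
    "'k::{finite,linorder} set \<Rightarrow> 'k coeffs ^ 'm ^ 'm \<Rightarrow> 'k coeffs ^ 'm ^ 'm \<Rightarrow>
      ('k \<Rightarrow> nat) \<Rightarrow> 'm \<Rightarrow> 'm \<Rightarrow> 'k fn \<Rightarrow> 'k fn"
  where "xi_mult T B C \<gamma> i j u x =
    (\<Sum>l\<in>UNIV. \<Sum>\<alpha> | \<forall>\<nu>. \<alpha> \<nu> \<le> \<gamma> \<nu>.
      xi_coeff T (B $ i $ l) \<alpha> (xi_coeff T (C $ l $ j) (\<lambda>\<nu>. \<gamma> \<nu> - \<alpha> \<nu>) u) x)"

definition xi_commute ::
    "'k::{finite,linorder} set \<Rightarrow> 'k pt set \<Rightarrow> 'k coeffs ^ 'm ^ 'm \<Rightarrow> 'k coeffs ^ 'm ^ 'm \<Rightarrow> bool"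
  where "xi_commute T M B C \<longleftrightarrow>
    (\<forall>\<gamma> i j. (\<forall>\<nu>\<in>- T. \<gamma> \<nu> = 0) \<longrightarrow>
      (\<forall>u\<in>analytic_N T M. \<forall>x\<in>core T M. xi_mult T B C \<gamma> i j u x = xi_mult T C B \<gamma> i j u x))"

definition xi_nonzero :: "'k::finite set \<Rightarrow> 'k pt set \<Rightarrow> 'k coeffs ^ 'm ^ 'm \<Rightarrow> bool"
  where "xi_nonzero T M B \<longleftrightarrow> (\<exists>i j \<kappa>. \<exists>x\<in>core T M. (B $ i $ j) \<kappa> x \<noteq> 0)"

text \<open>The function of \<open>(x, \<xi>)\<close> given by an element of \<open>\<A>\<^sub>N[\<xi>]\<close>, that is, a family \<open>b\<close> whose terms with
  \<open>\<beta> \<noteq> 0\<close> vanish.\<close>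

definition xi_eval :: "'k::finite set \<Rightarrow> 'k coeffs \<Rightarrow> 'k pt \<Rightarrow> 'k pt \<Rightarrow> complex"
  where "xi_eval T b x \<xi> =
    (\<Sum>\<kappa> | b \<kappa> \<noteq> (\<lambda>_. 0) \<and> (\<forall>i\<in>- T. \<kappa> i = 0). b \<kappa> x * (\<Prod>i\<in>T. of_real (\<xi> $ i) ^ \<kappa> i))"

end

theory Submission
  imports Defs "HOL-Library.Function_Algebras" "HOL-Complex_Analysis.Complex_Analysis"
begin

text \<open>
  Everything is reduced to the Taylor series at a point \<open>p\<close> of \<open>N\<close>.  These form a commutative ring
  (\<open>mfps\<close>) with the derivations \<open>D\<^sub>i = \<theta>\<^sub>i\<close> for \<open>i \<in> T\<close> and \<open>D\<^sub>i = \<partial>/\<partial>x\<^sub>i\<close> otherwise (\<open>Der\<close>), and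
  \<open>tay p\<close> turns \<open>[P, Q] = 0\<close> into an identity of formal differential operators.  Apply it to
  \<open>t\<^sup>\<omega> e\<^sup>\<omega>\<^sup>x u\<close> with \<open>\<omega>\<close> a family of natural numbers.  Since \<open>D\<^sub>i (t\<^sup>\<omega> e\<^sup>\<omega>\<^sup>x f) = t\<^sup>\<omega> e\<^sup>\<omega>\<^sup>x (D\<^sub>i + \<omega>\<^sub>i) f\<close>, the
  result is that \<open>P\<close> and \<open>Q\<close> still commute after every \<open>D\<^sub>i\<close> is replaced by \<open>D\<^sub>i + \<omega>\<^sub>i\<close>
  (\<open>formal_commute_shifted\<close>).  Two consequences are drawn.

  First, let \<open>\<omega>\<close> be supported on \<open>T\<close> and put \<open>t = 0\<close>.  As \<open>\<theta>\<^sub>i f\<close> vanishes on \<open>N\<close>, what remains of \<open>P\<close> is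
  \<open>\<sigma>\<^sub>*(P)(x, \<omega>, \<partial>\<^sub>x)\<close>.  So the symbols \<open>\<sigma>\<^sub>*\<close> commute at all \<open>\<omega> \<in> \<nat>\<^sup>n\<close>, and being polynomials in \<open>\<xi>\<close> they
  commute (\<open>xi_commute_sigma_star\<close>).

  Secondly, replace \<open>\<omega>\<close> by \<open>s \<omega>\<close> and compare the two leading powers of \<open>s\<close>.  The top one carries no
  information, because \<open>a = \<sigma>(P)\<close> is scalar; the next one says that every entry \<open>b\<close> of \<open>\<sigma>(Q)\<close> satisfies
  \<open>\<Sum>\<^sub>i a\<^sub>i D\<^sub>i b = \<Sum>\<^sub>i b\<^sub>i D\<^sub>i a\<close> with \<open>a\<^sub>i = \<partial>a/\<partial>\<omega>\<^sub>i\<close>: the contribution of the subprincipal symbols cancels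
  because \<open>\<sigma>(P)\<close> is scalar and so is one of \<open>\<sigma>\<^sub>k\<^sub>-\<^sub>1(P)\<close> and \<open>\<sigma>(Q)\<close>, with \<open>k\<close> the order of \<open>P\<close>
  (\<open>poisson_bracket_zero\<close>).

  Write \<open>b = \<Sum> b\<^sub>\<gamma> t\<^sup>\<gamma>\<close> and let \<open>a\<^sub>0\<close> be the restriction of \<open>a\<close> to \<open>N\<close>, which does not involve the covectors \<open>\<tau>\<close>
  dual to \<open>x\<close> since \<open>P \<in> \<D>\<^sub>*\<close>.  Suppose that all lower coefficients of \<open>b\<close> vanish, or that \<open>a\<close> does not
  depend on \<open>t\<close>.  Then the coefficient of \<open>t\<^sup>\<gamma>\<close> in the bracket identity is
  \<open>(\<Sum>\<^sub>\<nu> \<gamma>\<^sub>\<nu> \<partial>a\<^sub>0/\<partial>\<xi>\<^sub>\<nu>) b\<^sub>\<gamma> = \<Sum>\<^sub>j \<partial>a\<^sub>0/\<partial>x\<^sub>j \<partial>b\<^sub>\<gamma>/\<partial>\<tau>\<^sub>j\<close> (\<open>bracket_coef\<close>).  The right-hand side has smaller degree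
  in \<open>\<tau>\<close> than \<open>b\<^sub>\<gamma>\<close>, so \<open>b\<^sub>\<gamma> = 0\<close> at each \<open>x\<close> where the factor on the left is not the zero polynomial
  (\<open>top_degree_vanishing\<close>).  For \<open>\<gamma> \<noteq> 0\<close> the hypothesis on \<open>P\<close> and the identity theorem on the connected
  set \<open>N\<close> make these \<open>x\<close> dense, whence \<open>b\<^sub>\<gamma> = 0\<close> on \<open>N\<close> (\<open>taylor_step\<close>).

  If the restriction of \<open>\<sigma>(Q)\<close> to \<open>N\<close> were \<open>0\<close>, induction on \<open>\<gamma>\<close> would give \<open>\<sigma>(Q) = 0\<close> near \<open>N\<close>, contrary to
  the definition of the order; this proves \<open>\<sigma>\<close>-bar\<open>\<^sub>*(Q) \<noteq> 0\<close>.  If \<open>\<sigma>(P)\<close> does not depend on \<open>t\<close>, the same step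
  applies to each \<open>\<gamma> \<noteq> 0\<close> without induction, so only the coefficient with \<open>\<gamma> = 0\<close> survives in \<open>\<sigma>(Q)\<close>.
\<close>

section \<open>Formal power series in several variables\<close>

text \<open>
  A type of its own, so that the multiplication of the ring of series is the Cauchy product and not
  the pointwise product of functions.
\<close>

typedef 'k mfps = "UNIV :: (('k \<Rightarrow> nat) \<Rightarrow> complex) set"
  morphisms coef MFPS by simp

lemma coef_MFPS [simp]: "coef (MFPS c) = c"
  by (simp add: MFPS_inverse)

lemma mfps_eqI: "(\<And>\<kappa>. coef f \<kappa> = coef g \<kappa>) \<Longrightarrow> f = g"
  by (metis coef_inverse ext)

lemma finite_mi_le: "finite {\<kappa> :: 'k::finite \<Rightarrow> nat. \<kappa> \<le> \<nu>}"
proof (rule finite_subset)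
  show "{\<kappa>. \<kappa> \<le> \<nu>} \<subseteq> PiE UNIV (\<lambda>i. {..\<nu> i})"
    by (auto simp: le_fun_def)
qed (auto intro: finite_PiE)

definition splits :: "('k \<Rightarrow> nat) \<Rightarrow> (('k \<Rightarrow> nat) \<times> ('k \<Rightarrow> nat)) set"
  where "splits \<nu> = {(\<kappa>, \<mu>). \<kappa> + \<mu> = \<nu>}"

lemma finite_splits [simp]: "finite (splits (\<nu> :: 'k::finite \<Rightarrow> nat))"
proof (rule finite_subset)
  show "splits \<nu> \<subseteq> {\<kappa>. \<kappa> \<le> \<nu>} \<times> {\<kappa>. \<kappa> \<le> \<nu>}"
    by (auto simp: splits_def le_fun_def)
qed (simp add: finite_mi_le)

instantiation mfps :: (finite) comm_ring_1
begin

definition "0 = MFPS (\<lambda>_. 0)"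
definition "1 = MFPS (\<lambda>\<kappa>. if \<kappa> = 0 then 1 else 0)"
definition "f + g = MFPS (\<lambda>\<kappa>. coef f \<kappa> + coef g \<kappa>)"
definition "f - g = MFPS (\<lambda>\<kappa>. coef f \<kappa> - coef g \<kappa>)"
definition "- f = MFPS (\<lambda>\<kappa>. - coef f \<kappa>)"
definition "f * g = MFPS (\<lambda>\<nu>. \<Sum>(\<kappa>, \<mu>)\<in>splits \<nu>. coef f \<kappa> * coef g \<mu>)"

instance
proof
  fix a b c :: "'a mfps"
  show "a * b * c = a * (b * c)"
  proof (rule mfps_eqI)
    fix \<nu>
    have "coef (a * b * c) \<nu> =
      (\<Sum>(x, y)\<in>Sigma (splits \<nu>) (\<lambda>x. splits (fst x)). coef a (fst y) * coef b (snd y) * coef c (snd x))"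
      unfolding times_mfps_def by (simp add: case_prod_beta sum_distrib_right sum.Sigma)
    also have "\<dots> =
      (\<Sum>(x, y)\<in>Sigma (splits \<nu>) (\<lambda>x. splits (snd x)). coef a (fst x) * (coef b (fst y) * coef c (snd y)))"
      by (rule sum.reindex_bij_witness[of _
          "\<lambda>(x, y). ((fst x + fst y, snd y), (fst x, fst y))"
          "\<lambda>(x, y). ((fst y, snd y + snd x), (snd y, snd x))"])
        (auto simp: splits_def add.assoc mult.assoc)
    also have "\<dots> = coef (a * (b * c)) \<nu>"
      unfolding times_mfps_def by (simp add: case_prod_beta sum_distrib_left sum.Sigma)
    finally show "coef (a * b * c) \<nu> = coef (a * (b * c)) \<nu>" .
  qed
  show "a * b = b * a"
    unfolding times_mfps_def
    by (intro arg_cong[of _ _ MFPS] ext sum.reindex_bij_witness[of _ prod.swap prod.swap])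
      (auto simp: splits_def add.commute)
  show "1 * a = a"
  proof (rule mfps_eqI)
    fix \<nu>
    have "coef (1 * a) \<nu> = (\<Sum>x\<in>splits \<nu>. if x = (0, \<nu>) then coef a \<nu> else 0)"
      unfolding times_mfps_def one_mfps_def by (auto intro!: sum.cong simp: splits_def)
    also have "\<dots> = coef a \<nu>"
      using finite_splits[of \<nu>] by (subst sum.delta) (auto simp: splits_def)
    finally show "coef (1 * a) \<nu> = coef a \<nu>" .
  qed
  show "(a + b) * c = a * c + b * c"
    unfolding times_mfps_def plus_mfps_def
    by (auto simp: algebra_simps sum.distrib case_prod_beta)
  show "(0::'a mfps) \<noteq> 1"
  proof
    assume "(0::'a mfps) = 1"
    then have "coef (0::'a mfps) 0 = coef 1 0" by simp
    then show False by (simp add: zero_mfps_def one_mfps_def)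
  qed
  have "MFPS (coef a) = a" by (rule coef_inverse)
  then show "0 + a = a"
    by (simp add: zero_mfps_def plus_mfps_def)
qed (auto simp: zero_mfps_def plus_mfps_def minus_mfps_def uminus_mfps_def algebra_simps)

end

lemma coef_simps [simp]:
  "coef 0 \<kappa> = 0" "coef 1 \<kappa> = (if \<kappa> = 0 then 1 else 0)" "coef (f + g) \<kappa> = coef f \<kappa> + coef g \<kappa>"
  "coef (f - g) \<kappa> = coef f \<kappa> - coef g \<kappa>" "coef (- f) \<kappa> = - coef f \<kappa>"
  by (simp_all add: zero_mfps_def one_mfps_def plus_mfps_def minus_mfps_def uminus_mfps_def)

lemma coef_mult: "coef (f * g) \<nu> = (\<Sum>(\<kappa>, \<mu>)\<in>splits \<nu>. coef f \<kappa> * coef g \<mu>)"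
  by (simp add: times_mfps_def)

lemma coef_sum [simp]: "coef (\<Sum>x\<in>A. f x) \<kappa> = (\<Sum>x\<in>A. coef (f x) \<kappa>)"
  by (induction A rule: infinite_finite_induct) auto

lemma coef_of_nat_mult [simp]: "coef (of_nat n * f) \<kappa> = of_nat n * coef f \<kappa>"
  by (induction n) (auto simp: algebra_simps)

definition unit_mi :: "'k \<Rightarrow> 'k \<Rightarrow> nat"
  where "unit_mi i = (\<lambda>j. if j = i then 1 else 0)"

lemma unit_mi_same [simp]: "unit_mi i i = 1"
  and unit_mi_other [simp]: "i \<noteq> j \<Longrightarrow> unit_mi i j = 0"
  by (auto simp: unit_mi_def)

lemma unit_mi_nonzero [simp]: "unit_mi i \<noteq> 0"
  by (auto simp: unit_mi_def fun_eq_iff)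

lemma le_unit_mi: "\<kappa> i \<ge> 1 \<Longrightarrow> \<kappa> - unit_mi i + unit_mi i = \<kappa>"
  by (auto simp: unit_mi_def fun_eq_iff)

definition pd :: "'k \<Rightarrow> 'k::finite mfps \<Rightarrow> 'k mfps"
  where "pd i f = MFPS (\<lambda>\<kappa>. of_nat (\<kappa> i + 1) * coef f (\<kappa> + unit_mi i))"

definition var :: "'k \<Rightarrow> 'k::finite mfps"
  where "var i = MFPS (\<lambda>\<kappa>. if \<kappa> = unit_mi i then 1 else 0)"

lemma coef_pd: "coef (pd i f) \<kappa> = of_nat (\<kappa> i + 1) * coef f (\<kappa> + unit_mi i)"
  by (simp add: pd_def)

lemma coef_var_mult: "coef (var i * f) \<kappa> = (if \<kappa> i = 0 then 0 else coef f (\<kappa> - unit_mi i))"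
proof -
  have "coef (var i * f) \<kappa> =
    (\<Sum>x\<in>splits \<kappa>. if x = (unit_mi i, \<kappa> - unit_mi i) then coef f (\<kappa> - unit_mi i) else 0)"
    unfolding coef_mult by (auto intro!: sum.cong simp: splits_def var_def)
  also have "\<dots> = (if \<kappa> i = 0 then 0 else coef f (\<kappa> - unit_mi i))"
  proof -
    have "(unit_mi i, \<kappa> - unit_mi i) \<in> splits \<kappa> \<longleftrightarrow> \<kappa> i \<noteq> 0"
      by (auto simp: splits_def fun_eq_iff unit_mi_def)
    then show ?thesis
      by (subst sum.delta) auto
  qed
  finally show ?thesis .
qed

lemma coef_var_pd [simp]: "coef (var i * pd i f) \<kappa> = of_nat (\<kappa> i) * coef f \<kappa>"
  by (auto simp: coef_var_mult coef_pd le_unit_mi)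

lemma var_mult_eq_0: "var i * f = 0 \<Longrightarrow> f = 0"
proof (rule mfps_eqI)
  fix \<kappa> assume "var i * f = 0"
  then have "coef (var i * f) (\<kappa> + unit_mi i) = 0" by simp
  then show "coef f \<kappa> = coef 0 \<kappa>" by (simp add: coef_var_mult)
qed

lemma pd_simps [simp]:
  "pd i 0 = 0" "pd i 1 = 0" "pd i (f + g) = pd i f + pd i g" "pd i (f - g) = pd i f - pd i g"
  "pd i (of_nat n * f) = of_nat n * pd i f"
  by (auto intro!: mfps_eqI simp: coef_pd distrib_left distrib_right unit_mi_nonzero right_diff_distrib)

text \<open>
  This is how the factor \<open>\<kappa>\<^sub>i\<close> produced by a derivative is used in the Leibniz rule: the terms with
  \<open>\<kappa>\<^sub>i = 0\<close> drop out and the others can be shifted by the \<open>i\<close>-th unit multi-index.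
\<close>

lemma sum_splits_unit:
  fixes F :: "('k::finite \<Rightarrow> nat) \<Rightarrow> ('k \<Rightarrow> nat) \<Rightarrow> complex"
  assumes "\<And>\<kappa> \<mu>. \<kappa> i = 0 \<Longrightarrow> F \<kappa> \<mu> = 0"
  shows "(\<Sum>(\<kappa>, \<mu>)\<in>splits (\<nu> + unit_mi i). F \<kappa> \<mu>) = (\<Sum>(\<kappa>, \<mu>)\<in>splits \<nu>. F (\<kappa> + unit_mi i) \<mu>)"
proof -
  have diff_unit: "b + (a - unit_mi i) = \<nu>" if "a + b = \<nu> + unit_mi i" "0 < a i" for a b
  proof -
    have "b + (a - unit_mi i) + unit_mi i = \<nu> + unit_mi i"
      using that le_unit_mi[of a i] by (simp add: add_ac)
    then show ?thesis by simp
  qed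
  have "(\<Sum>(\<kappa>, \<mu>)\<in>splits (\<nu> + unit_mi i). F \<kappa> \<mu>) =
    (\<Sum>(\<kappa>, \<mu>)\<in>{x \<in> splits (\<nu> + unit_mi i). fst x i \<noteq> 0}. F \<kappa> \<mu>)"
    by (rule sum.mono_neutral_right) (use assms in fastforce)+
  also have "\<dots> = (\<Sum>(\<kappa>, \<mu>)\<in>splits \<nu>. F (\<kappa> + unit_mi i) \<mu>)"
  proof (rule sum.reindex_bij_witness[of _ "\<lambda>(x, y). (x + unit_mi i, y)" "\<lambda>(x, y). (x - unit_mi i, y)"])
    fix x assume x: "x \<in> {x \<in> splits (\<nu> + unit_mi i). fst x i \<noteq> 0}"
    then have "fst x - unit_mi i + unit_mi i = fst x" by (simp add: le_unit_mi)
    then show "(case case x of (x, y) \<Rightarrow> (x - unit_mi i, y) of (x, y) \<Rightarrow> (x + unit_mi i, y)) = x"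
      "(case case x of (x, y) \<Rightarrow> (x - unit_mi i, y) of (\<kappa>, \<mu>) \<Rightarrow> F (\<kappa> + unit_mi i) \<mu>) =
       (case x of (\<kappa>, \<mu>) \<Rightarrow> F \<kappa> \<mu>)"
      by (simp_all add: case_prod_beta)
    show "(case x of (x, y) \<Rightarrow> (x - unit_mi i, y)) \<in> splits \<nu>"
      using x diff_unit[of "fst x" "snd x"] by (auto simp: splits_def add.commute)
  qed (auto simp: splits_def add_ac)
  finally show ?thesis .
qed

lemma pd_mult: "pd i (f * g) = pd i f * g + f * pd i g"
proof (rule mfps_eqI)
  fix \<nu>
  let ?S = "splits (\<nu> + unit_mi i)"
  have "coef (pd i (f * g)) \<nu> = (\<Sum>(\<kappa>, \<mu>)\<in>?S. of_nat (\<nu> i + 1) * (coef f \<kappa> * coef g \<mu>))"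
    by (simp add: coef_pd coef_mult sum_distrib_left case_prod_beta)
  also have "\<dots> = (\<Sum>(\<kappa>, \<mu>)\<in>?S. of_nat (\<kappa> i) * coef f \<kappa> * coef g \<mu> + coef f \<kappa> * (of_nat (\<mu> i) * coef g \<mu>))"
  proof (rule sum.cong)
    fix x assume "x \<in> ?S"
    then have "fst x + snd x = \<nu> + unit_mi i" by (auto simp: splits_def)
    from fun_cong[OF this, of i] have "\<nu> i + 1 = fst x i + snd x i" by simp
    then have "of_nat (\<nu> i + 1) = (of_nat (fst x i) + of_nat (snd x i) :: complex)"
      by (metis of_nat_add)
    then show "(case x of (\<kappa>, \<mu>) \<Rightarrow> of_nat (\<nu> i + 1) * (coef f \<kappa> * coef g \<mu>)) =
      (case x of (\<kappa>, \<mu>) \<Rightarrow> of_nat (\<kappa> i) * coef f \<kappa> * coef g \<mu> + coef f \<kappa> * (of_nat (\<mu> i) * coef g \<mu>))"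
      by (simp only: case_prod_beta) (simp add: algebra_simps)
  qed simp
  also have "\<dots> = (\<Sum>(\<kappa>, \<mu>)\<in>?S. of_nat (\<kappa> i) * coef f \<kappa> * coef g \<mu>)
     + (\<Sum>(\<kappa>, \<mu>)\<in>?S. coef f \<kappa> * (of_nat (\<mu> i) * coef g \<mu>))"
    by (simp add: sum.distrib case_prod_beta)
  also have "(\<Sum>(\<kappa>, \<mu>)\<in>?S. of_nat (\<kappa> i) * coef f \<kappa> * coef g \<mu>) = coef (pd i f * g) \<nu>"
    by (subst sum_splits_unit) (auto simp: coef_mult coef_pd)
  also have "(\<Sum>(\<kappa>, \<mu>)\<in>?S. coef f \<kappa> * (of_nat (\<mu> i) * coef g \<mu>)) =
    (\<Sum>(\<mu>, \<kappa>)\<in>?S. coef f \<kappa> * (of_nat (\<mu> i) * coef g \<mu>))"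
    by (rule sum.reindex_bij_witness[of _ prod.swap prod.swap]) (auto simp: splits_def add_ac)
  also have "\<dots> = coef (pd i g * f) \<nu>"
    by (subst sum_splits_unit) (auto simp: coef_mult coef_pd intro!: sum.cong)
  also have "pd i g * f = f * pd i g" by (rule mult.commute)
  finally show "coef (pd i (f * g)) \<nu> = coef (pd i f * g + f * pd i g) \<nu>"
    by simp
qed

section \<open>Taylor series of real analytic functions\<close>

definition cpow :: "('k::finite \<Rightarrow> complex) \<Rightarrow> ('k \<Rightarrow> nat) \<Rightarrow> complex"
  where "cpow z \<kappa> = (\<Prod>i\<in>UNIV. z i ^ \<kappa> i)"

definition offset :: "real ^ 'k \<Rightarrow> real ^ 'k \<Rightarrow> 'k::finite \<Rightarrow> complex"
  where "offset p q i = of_real (q $ i - p $ i)"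

abbreviation ps_sums :: "'k::finite mfps \<Rightarrow> 'k pt \<Rightarrow> 'k pt \<Rightarrow> complex \<Rightarrow> bool"
  where "ps_sums F p q y \<equiv> ((\<lambda>\<kappa>. coef F \<kappa> * cpow (offset p q) \<kappa>) has_sum y) UNIV"

text \<open>
  Only a ball around the centre matters, so \<open>has_ps f p F\<close> is a statement about the germ of \<open>f\<close> at \<open>p\<close>.
\<close>

definition has_ps :: "'k::finite fn \<Rightarrow> 'k pt \<Rightarrow> 'k mfps \<Rightarrow> bool"
  where "has_ps f p F \<longleftrightarrow>
    (\<exists>r>0. \<forall>q\<in>ball p r. ps_sums F p q (f q))"

lemma real_analytic_at_iff_has_ps: "real_analytic_at UNIV f p \<longleftrightarrow> (\<exists>F. has_ps f p F)"
proof
  assume "real_analytic_at UNIV f p"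
  then obtain r c where r: "r > 0" and c: "\<forall>q\<in>ball p r.
      ((\<lambda>\<kappa>. c \<kappa> * (\<Prod>i\<in>UNIV. of_real (q $ i - p $ i) ^ \<kappa> i)) has_sum f q) UNIV"
    unfolding real_analytic_at_def by auto
  have "has_ps f p (MFPS c)"
    unfolding has_ps_def cpow_def offset_def coef_MFPS using r c by blast
  then show "\<exists>F. has_ps f p F" ..
next
  assume "\<exists>F. has_ps f p F"
  then obtain r F where r: "r > 0" and c: "\<forall>q\<in>ball p r.
      ((\<lambda>\<kappa>. coef F \<kappa> * (\<Prod>i\<in>UNIV. of_real (q $ i - p $ i) ^ \<kappa> i)) has_sum f q) UNIV"
    unfolding has_ps_def cpow_def offset_def by blast
  then show "real_analytic_at UNIV f p"
    unfolding real_analytic_at_def by (intro exI[of _ r] conjI exI[of _ "coef F"]) auto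
qed

lemma norm_offset [simp]: "norm (offset p q i) = \<bar>q $ i - p $ i\<bar>"
  unfolding offset_def norm_of_real ..

lemma has_psE:
  assumes "has_ps f p F"
  obtains r where "r > 0" "\<And>q. dist p q < r \<Longrightarrow> ps_sums F p q (f q)"
  using assms by (auto simp: has_ps_def)

lemma has_psI:
  assumes "r > 0" "\<And>q. dist p q < r \<Longrightarrow> ps_sums F p q (f q)"
  shows "has_ps f p F"
  using assms by (auto simp: has_ps_def)

lemma has_ps_cong:
  assumes "has_ps f p F" "eventually (\<lambda>q. f q = g q) (nhds p)"
  shows "has_ps g p F"
proof -
  obtain r where r: "r > 0" "\<And>q. dist p q < r \<Longrightarrow> ps_sums F p q (f q)"
    using assms(1) by (rule has_psE) blast
  obtain d where d: "d > 0" "\<And>q. dist q p < d \<Longrightarrow> f q = g q"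
    using assms(2) by (auto simp: eventually_nhds_metric)
  show ?thesis
  proof (rule has_psI)
    show "min r d > 0" using r d by simp
  next
    fix q assume "dist p q < min r d"
    then show "ps_sums F p q (g q)"
      using r(2)[of q] d(2)[of q] by (simp add: dist_commute)
  qed
qed

lemma cpow_unit_mi_add: "cpow z (\<kappa> + unit_mi i) = z i * cpow z \<kappa>"
  unfolding cpow_def by (simp add: power_add prod.distrib)
    (simp add: unit_mi_def if_distrib[of "\<lambda>x. _ ^ x"] prod.delta cong: if_cong)

lemma cpow_0 [simp]: "cpow z 0 = 1"
  by (simp add: cpow_def)

lemma cpow_add: "cpow z (\<kappa> + \<mu>) = cpow z \<kappa> * cpow z \<mu>"
  by (simp add: cpow_def power_add prod.distrib)

lemma norm_cpow_le:
  assumes "\<And>i. norm (z i) \<le> \<rho>"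
  shows "norm (cpow z \<kappa>) \<le> \<rho> ^ mi_size \<kappa>"
proof -
  have "norm (cpow z \<kappa>) = (\<Prod>i\<in>UNIV. norm (z i) ^ \<kappa> i)"
    by (simp add: cpow_def norm_power flip: prod_norm)
  also have "\<dots> \<le> (\<Prod>i\<in>UNIV. \<rho> ^ \<kappa> i)"
    by (intro prod_mono) (auto intro: power_mono assms)
  also have "\<dots> = \<rho> ^ mi_size \<kappa>"
    by (simp add: mi_size_def power_sum)
  finally show ?thesis .
qed

text \<open>
  A ball contains a cube around its centre; convergence at the corner \<open>p + (\<rho>, \<dots>, \<rho>)\<close> is absolute
  and dominates the series at all complex arguments of modulus at most \<open>\<rho>\<close>.
\<close>

lemma has_ps_polydisc:
  fixes p :: "real ^ 'k::finite"
  assumes "has_ps f p F"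
  obtains \<rho> where "\<rho> > 0" "(\<lambda>\<kappa>. norm (coef F \<kappa>) * \<rho> ^ mi_size \<kappa>) summable_on UNIV"
    "\<And>q. (\<And>i. \<bar>q $ i - p $ i\<bar> \<le> \<rho>) \<Longrightarrow> ps_sums F p q (f q)"
proof -
  obtain r where r: "r > 0" "\<And>q. dist p q < r \<Longrightarrow> ps_sums F p q (f q)"
    using assms by (rule has_psE) blast
  define \<rho> where "\<rho> = r / (2 * of_nat CARD('k))"
  have \<rho>: "\<rho> > 0" using r by (simp add: \<rho>_def)
  have sums: "ps_sums F p q (f q)"
    if "\<And>i. \<bar>q $ i - p $ i\<bar> \<le> \<rho>" for q
  proof (rule r(2))
    have "dist p q = norm (q - p)" by (simp add: dist_norm norm_minus_commute)
    also have "\<dots> \<le> (\<Sum>i\<in>UNIV. \<bar>(q - p) $ i\<bar>)" by (rule norm_le_l1_cart)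
    also have "\<dots> \<le> (\<Sum>i\<in>(UNIV::'k set). \<rho>)" by (intro sum_mono) (use that in simp)
    also have "\<dots> = r / 2" by (simp add: \<rho>_def)
    also have "\<dots> < r" using r by simp
    finally show "dist p q < r" .
  qed
  have "ps_sums F p (p + (\<chi> i. \<rho>)) (f (p + (\<chi> i. \<rho>)))"
    using \<rho> by (intro sums) auto
  then have "(\<lambda>\<kappa>. coef F \<kappa> * cpow (offset p (p + (\<chi> i. \<rho>))) \<kappa>) summable_on UNIV"
    by (rule has_sum_imp_summable)
  then have "(\<lambda>\<kappa>. norm (coef F \<kappa> * cpow (offset p (p + (\<chi> i. \<rho>))) \<kappa>)) summable_on UNIV"
    by (simp add: summable_on_iff_abs_summable_on_complex)
  moreover have "norm (cpow (offset p (p + (\<chi> i. \<rho>))) \<kappa>) = \<rho> ^ mi_size \<kappa>" for \<kappa>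
    using \<rho> by (simp add: cpow_def offset_def mi_size_def power_sum norm_power flip: prod_norm)
  ultimately have "(\<lambda>\<kappa>. norm (coef F \<kappa>) * \<rho> ^ mi_size \<kappa>) summable_on UNIV"
    by (simp add: norm_mult)
  then show ?thesis using \<rho> sums that by blast
qed

text \<open>
  The series at complex arguments.  Differentiation and continuation of real analytic functions are
  done through this holomorphic extension.
\<close>

definition cser :: "'k::finite mfps \<Rightarrow> ('k \<Rightarrow> complex) \<Rightarrow> complex"
  where "cser F z = (\<Sum>\<^sub>\<infinity>\<kappa>. coef F \<kappa> * cpow z \<kappa>)"

lemma cser_line_uniform:
  assumes "(\<lambda>\<kappa>. norm (coef F \<kappa>) * \<rho> ^ mi_size \<kappa>) summable_on UNIV"
    and "\<And>i. norm (a i) + R * norm (b i) \<le> \<rho>" "R \<ge> 0"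
  shows "uniform_limit (cball 0 R) (\<lambda>X s. \<Sum>\<kappa>\<in>X. coef F \<kappa> * cpow (\<lambda>i. a i + s * b i) \<kappa>)
    (\<lambda>s. cser F (\<lambda>i. a i + s * b i)) (finite_subsets_at_top UNIV)"
  unfolding cser_def
proof (rule Weierstrass_m_test_general)
  fix \<kappa> s assume s: "s \<in> cball (0::complex) R"
  have "norm (a i + s * b i) \<le> \<rho>" for i
  proof -
    have "norm (a i + s * b i) \<le> norm (a i) + norm s * norm (b i)"
      by (metis norm_triangle_ineq norm_mult)
    also have "\<dots> \<le> norm (a i) + R * norm (b i)"
      using s by (intro add_mono mult_right_mono) auto
    finally show ?thesis using assms(2)[of i] by simp
  qed
  then have "norm (cpow (\<lambda>i. a i + s * b i) \<kappa>) \<le> \<rho> ^ mi_size \<kappa>"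
    by (rule norm_cpow_le)
  then show "norm (coef F \<kappa> * cpow (\<lambda>i. a i + s * b i) \<kappa>) \<le> norm (coef F \<kappa>) * \<rho> ^ mi_size \<kappa>"
    by (simp add: norm_mult mult_left_mono)
qed (fact assms(1))

lemma cser_line_holomorphic:
  assumes "(\<lambda>\<kappa>. norm (coef F \<kappa>) * \<rho> ^ mi_size \<kappa>) summable_on UNIV"
    and "\<And>i. norm (a i) + R * norm (b i) \<le> \<rho>" "R \<ge> 0"
  shows "(\<lambda>s. cser F (\<lambda>i. a i + s * b i)) holomorphic_on ball 0 R"
proof -
  have "(\<lambda>s. \<Sum>\<kappa>\<in>X. coef F \<kappa> * cpow (\<lambda>i. a i + s * b i) \<kappa>) holomorphic_on A" for X A
    unfolding cpow_def by (intro holomorphic_intros)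
  then have "eventually (\<lambda>X. continuous_on (cball 0 R) (\<lambda>s. \<Sum>\<kappa>\<in>X. coef F \<kappa> * cpow (\<lambda>i. a i + s * b i) \<kappa>) \<and>
      (\<lambda>s. \<Sum>\<kappa>\<in>X. coef F \<kappa> * cpow (\<lambda>i. a i + s * b i) \<kappa>) holomorphic_on ball 0 R) (finite_subsets_at_top UNIV)"
    by (intro always_eventually allI conjI holomorphic_on_imp_continuous_on)
  from holomorphic_uniform_limit[OF this cser_line_uniform[OF assms]]
  show ?thesis by auto
qed

text \<open>
  On the complex line through \<open>q\<close> in direction \<open>e\<^sub>i\<close> the finite partial sums converge uniformly, hence
  so do their derivatives.  This replaces estimates for the termwise differentiated series.
\<close>

lemma has_ps_partial_deriv:
  fixes f :: "'k::finite fn"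
  assumes "has_ps f p F"
  shows "has_ps (partial_deriv i f) p (pd i F)"
proof -
  obtain \<rho> where \<rho>: "\<rho> > 0" "(\<lambda>\<kappa>. norm (coef F \<kappa>) * \<rho> ^ mi_size \<kappa>) summable_on UNIV"
    "\<And>q. (\<And>i. \<bar>q $ i - p $ i\<bar> \<le> \<rho>) \<Longrightarrow> ps_sums F p q (f q)"
    using assms by (rule has_ps_polydisc) blast
  show ?thesis
  proof (rule has_psI)
    show "\<rho> / 2 > 0" using \<rho> by simp
  next
    fix q assume "dist p q < \<rho> / 2"
    then have q: "\<bar>q $ j - p $ j\<bar> \<le> \<rho> / 2" for j
      using component_le_norm_cart[of "q - p" j] by (simp add: dist_norm norm_minus_commute)
    define a where "a = offset p q"
    define b where "b = (\<lambda>j::'k. if j = i then 1 else 0 :: complex)"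
    define rest where "rest = (\<lambda>\<kappa>. \<Prod>j\<in>-{i}. a j ^ \<kappa> j)"
    have split: "cpow (\<lambda>j. a j + s * b j) \<kappa> = (a i + s) ^ \<kappa> i * rest \<kappa>" for s \<kappa>
    proof -
      have "cpow (\<lambda>j. a j + s * b j) \<kappa> = (a i + s * b i) ^ \<kappa> i * (\<Prod>j\<in>UNIV - {i}. (a j + s * b j) ^ \<kappa> j)"
        unfolding cpow_def by (rule prod.remove) auto
      also have "(\<Prod>j\<in>UNIV - {i}. (a j + s * b j) ^ \<kappa> j) = rest \<kappa>"
        unfolding rest_def by (intro prod.cong) (auto simp: b_def)
      finally show ?thesis by (simp add: b_def)
    qed
    have ab: "norm (a j) + \<rho> / 2 * norm (b j) \<le> \<rho>" for j
      using q[of j] q[of i] \<rho>(1) by (auto simp: a_def b_def)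
    let ?f = "\<lambda>X s. \<Sum>\<kappa>\<in>X. coef F \<kappa> * cpow (\<lambda>i. a i + s * b i) \<kappa>"
    let ?f' = "\<lambda>X s. \<Sum>\<kappa>\<in>X. coef F \<kappa> * (of_nat (\<kappa> i) * (a i + s) ^ (\<kappa> i - 1) * rest \<kappa>)"
    have der: "(?f X has_field_derivative ?f' X s) (at s)" for X s
      unfolding split by (auto intro!: derivative_eq_intros simp: mult_ac)
    then have "eventually (\<lambda>X. continuous_on (cball 0 (\<rho>/2)) (?f X) \<and>
        (\<forall>w\<in>ball 0 (\<rho>/2). (?f X has_field_derivative ?f' X w) (at w))) (finite_subsets_at_top UNIV)"
      by (intro always_eventually allI conjI ballI) (meson DERIV_continuous_on DERIV_isCont continuous_at_imp_continuous_on)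
    then obtain g' where g': "\<And>w. w \<in> ball 0 (\<rho>/2) \<Longrightarrow>
      ((\<lambda>s. cser F (\<lambda>i. a i + s * b i)) has_field_derivative g' w) (at w) \<and>
      ((\<lambda>X. ?f' X w) \<longlongrightarrow> g' w) (finite_subsets_at_top UNIV)"
    proof (rule has_complex_derivative_uniform_limit)
      show "uniform_limit (cball 0 (\<rho>/2)) ?f (\<lambda>s. cser F (\<lambda>i. a i + s * b i)) (finite_subsets_at_top UNIV)"
        using \<rho>(1) by (intro cser_line_uniform[OF \<rho>(2) ab]) auto
    qed (use \<rho>(1) in auto)
    have g0: "((\<lambda>s. cser F (\<lambda>i. a i + s * b i)) has_field_derivative g' 0) (at 0)"
      "((\<lambda>X. ?f' X 0) \<longlongrightarrow> g' 0) (finite_subsets_at_top UNIV)"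
      using g'[of 0] \<rho>(1) by auto
    have feq: "f (q + s *\<^sub>R axis i 1) = cser F (\<lambda>i. a i + of_real s * b i)" if "\<bar>s\<bar> < \<rho> / 2" for s :: real
    proof -
      have "ps_sums F p (q + s *\<^sub>R axis i 1) (f (q + s *\<^sub>R axis i 1))"
      proof (rule \<rho>(3))
        fix j show "\<bar>(q + s *\<^sub>R axis i 1) $ j - p $ j\<bar> \<le> \<rho>"
          using q[of j] that \<rho>(1) abs_triangle_ineq[of "q $ j - p $ j" s]
          by (cases "j = i") (simp_all add: axis_def algebra_simps)
      qed
      moreover have "offset p (q + s *\<^sub>R axis i 1) = (\<lambda>i. a i + of_real s * b i)"
        by (auto simp: fun_eq_iff offset_def a_def b_def axis_def)
      ultimately show ?thesis by (simp add: cser_def infsumI)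
    qed
    have "((\<lambda>s. cser F (\<lambda>i. a i + of_real s * b i)) has_vector_derivative g' 0) (at 0)"
      using g0(1) has_vector_derivative_real_field[of _ "g' 0" 0] by simp
    then have "((\<lambda>s. f (q + s *\<^sub>R axis i 1)) has_vector_derivative g' 0) (at 0)"
      by (rule has_vector_derivative_transform_within[where d = "\<rho> / 2"]) (use \<rho>(1) feq in auto)
    then have pd_eq: "partial_deriv i f q = g' 0"
      unfolding partial_deriv_def by (rule vector_derivative_at)
    have "((\<lambda>\<kappa>. coef F \<kappa> * (of_nat (\<kappa> i) * a i ^ (\<kappa> i - 1) * rest \<kappa>)) has_sum g' 0) UNIV"
      using g0(2) by (simp add: has_sum_def)
    then have "((\<lambda>\<kappa>. coef F \<kappa> * (of_nat (\<kappa> i) * a i ^ (\<kappa> i - 1) * rest \<kappa>)) has_sum g' 0) {\<kappa>. \<kappa> i \<noteq> 0}"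
      by (rule has_sum_cong_neutral[THEN iffD1, rotated -1]) auto
    then have "((\<lambda>\<kappa>. coef F (\<kappa> + unit_mi i) * (of_nat (\<kappa> i + 1) * a i ^ \<kappa> i * rest \<kappa>)) has_sum g' 0) UNIV"
    proof (rule has_sum_reindex_bij_witness[THEN iffD1, rotated -1,
          where i1 = "\<lambda>\<kappa>. \<kappa> + unit_mi i" and j1 = "\<lambda>\<kappa>. \<kappa> - unit_mi i"])
      fix \<kappa> :: "'k \<Rightarrow> nat" assume k: "\<kappa> \<in> {\<kappa>. \<kappa> i \<noteq> 0}"
      then show "\<kappa> - unit_mi i + unit_mi i = \<kappa>" by (simp add: le_unit_mi)
      have "rest (\<kappa> - unit_mi i) = rest \<kappa>"
        unfolding rest_def by (intro prod.cong) auto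
      then show "coef F (\<kappa> - unit_mi i + unit_mi i) * (of_nat ((\<kappa> - unit_mi i) i + 1) * a i ^ (\<kappa> - unit_mi i) i * rest (\<kappa> - unit_mi i)) =
        coef F \<kappa> * (of_nat (\<kappa> i) * a i ^ (\<kappa> i - 1) * rest \<kappa>)"
        using k by (simp add: le_unit_mi del: of_nat_Suc)
    qed auto
    moreover have "cpow (offset p q) \<kappa> = a i ^ \<kappa> i * rest \<kappa>" for \<kappa>
      using split[of 0 \<kappa>] by (simp add: a_def)
    ultimately show "ps_sums (pd i F) p q (partial_deriv i f q)"
      by (simp add: coef_pd pd_eq mult_ac)
  qed
qed

lemma has_ps_at_center:
  assumes "has_ps f p F"
  shows "f p = coef F 0"
proof -
  obtain r where r: "r > 0" "\<And>q. dist p q < r \<Longrightarrow> ps_sums F p q (f q)"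
    using assms by (rule has_psE) blast
  have "ps_sums F p p (f p)"
    using r by simp
  moreover have "coef F \<kappa> * cpow (offset p p) \<kappa> = (if \<kappa> = 0 then coef F 0 else 0)" for \<kappa>
  proof (cases "\<kappa> = 0")
    case False
    then obtain i where "\<kappa> i \<noteq> 0" by (auto simp: fun_eq_iff)
    then show ?thesis using False by (auto simp: cpow_def offset_def power_0_left intro!: prod_zero)
  qed simp
  ultimately have *: "((\<lambda>\<kappa> :: 'a \<Rightarrow> nat. if \<kappa> = 0 then coef F 0 else 0) has_sum f p) UNIV" by simp
  have "((\<lambda>\<kappa> :: 'a \<Rightarrow> nat. if \<kappa> = 0 then coef F 0 else 0) has_sum f p) {0}"
    by (rule has_sum_cong_neutral[THEN iffD1, OF _ _ _ *]) auto
  have "((\<lambda>\<kappa>. if \<kappa> = 0 then coef F 0 else 0) has_sum coef F 0) {0::'a \<Rightarrow> nat}"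
    by (rule has_sum_finiteI) auto
  with \<open>((\<lambda>\<kappa> :: 'a \<Rightarrow> nat. if \<kappa> = 0 then coef F 0 else 0) has_sum f p) {0}\<close> show ?thesis
    by (rule has_sum_unique)
qed

lemma has_ps_add: "has_ps f p F \<Longrightarrow> has_ps g p G \<Longrightarrow> has_ps (\<lambda>q. f q + g q) p (F + G)"
proof (elim has_psE)
  fix r r' assume *: "r > 0" "r' > 0" "\<And>q. dist p q < r \<Longrightarrow> ps_sums F p q (f q)"
    "\<And>q. dist p q < r' \<Longrightarrow> ps_sums G p q (g q)"
  show ?thesis
    by (rule has_psI[of "min r r'"]) (use * in \<open>auto simp: distrib_right intro!: has_sum_add\<close>)
qed

lemma has_sum_times:
  fixes f :: "'a \<Rightarrow> complex" and g :: "'b \<Rightarrow> complex"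
  assumes f: "(f has_sum x) A" and g: "(g has_sum y) B"
  shows "((\<lambda>(a, b). f a * g b) has_sum x * y) (A \<times> B)"
proof (rule has_sum_SigmaI)
  show "((\<lambda>b. case (a, b) of (a, b) \<Rightarrow> f a * g b) has_sum f a * y) B" for a
    using has_sum_cmult_right[OF g] by simp
  show "((\<lambda>a. f a * y) has_sum x * y) A"
    by (rule has_sum_cmult_left[OF f])
  have "(\<lambda>a. norm (f a)) summable_on A" "(\<lambda>b. norm (g b)) summable_on B"
    using f g by (auto simp flip: summable_on_iff_abs_summable_on_complex dest: has_sum_imp_summable)
  then have "(\<lambda>x. norm (case x of (a, b) \<Rightarrow> f a * g b)) summable_on A \<times> B"
    unfolding Infinite_Sum.abs_summable_on_Sigma_iff
    by (auto simp: infsum_cmult_right' norm_mult abs_mult infsum_nonneg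
        intro!: summable_on_cmult_right summable_on_cmult_left)
  then show "(\<lambda>(a, b). f a * g b) summable_on A \<times> B"
    by (rule abs_summable_summable)
qed

lemma has_ps_mult:
  assumes "has_ps f p F" "has_ps g p G"
  shows "has_ps (\<lambda>q. f q * g q) p (F * G)"
proof -
  obtain r where r: "r > 0" "\<And>q. dist p q < r \<Longrightarrow> ps_sums F p q (f q)"
    using assms(1) by (rule has_psE) blast
  obtain r' where r': "r' > 0" "\<And>q. dist p q < r' \<Longrightarrow> ps_sums G p q (g q)"
    using assms(2) by (rule has_psE) blast
  show ?thesis
  proof (rule has_psI)
    show "min r r' > 0" using r r' by simp
  next
    fix q assume "dist p q < min r r'"
    then have "((\<lambda>(\<kappa>, \<mu>). (coef F \<kappa> * cpow (offset p q) \<kappa>) * (coef G \<mu> * cpow (offset p q) \<mu>))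
      has_sum f q * g q) (UNIV \<times> UNIV)"
      by (intro has_sum_times) (auto intro: r r')
    then have "((\<lambda>(\<nu>, (\<kappa>, \<mu>)). coef F \<kappa> * coef G \<mu> * cpow (offset p q) \<nu>)
      has_sum f q * g q) (Sigma UNIV splits)"
      by (rule has_sum_reindex_bij_witness[THEN iffD1, rotated -1,
            where i1 = "\<lambda>(\<nu>, x). x" and j1 = "\<lambda>x. (fst x + snd x, x)"])
        (auto simp: splits_def cpow_add mult_ac)
    then show "((\<lambda>\<nu>. coef (F * G) \<nu> * cpow (offset p q) \<nu>) has_sum f q * g q) UNIV"
      by (rule has_sum_SigmaD)
        (auto simp: coef_mult sum_distrib_right case_prod_beta intro!: has_sum_finiteI)
  qed
qed

lemma has_ps_finite:
  fixes F :: "'k::finite mfps"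
  assumes "finite A" "\<And>\<kappa>. \<kappa> \<notin> A \<Longrightarrow> coef F \<kappa> = 0"
    and "\<And>q. f q = (\<Sum>\<kappa>\<in>A. coef F \<kappa> * cpow (offset p q) \<kappa>)"
  shows "has_ps f p F"
proof (rule has_psI[of 1])
  fix q
  have "((\<lambda>\<kappa>. coef F \<kappa> * cpow (offset p q) \<kappa>) has_sum f q) A"
    using assms by (intro has_sum_finiteI) auto
  then show "ps_sums F p q (f q)"
    by (rule has_sum_cong_neutral[THEN iffD1, rotated -1]) (use assms in auto)
qed simp

definition const :: "complex \<Rightarrow> 'k::finite mfps"
  where "const c = MFPS (\<lambda>\<kappa>. if \<kappa> = 0 then c else 0)"

lemma has_ps_const: "has_ps (\<lambda>_. c) p (const c)"
  by (rule has_ps_finite[of "{0}"]) (auto simp: const_def)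

lemma coef_const_mult [simp]: "coef (const c * F) \<kappa> = c * coef F \<kappa>"
proof -
  have "coef (const c * F) \<kappa> = (\<Sum>x\<in>splits \<kappa>. if x = (0, \<kappa>) then c * coef F \<kappa> else 0)"
    unfolding coef_mult by (auto intro!: sum.cong simp: splits_def const_def)
  also have "\<dots> = c * coef F \<kappa>"
    using finite_splits[of \<kappa>] by (subst sum.delta) (auto simp: splits_def)
  finally show ?thesis .
qed

lemma has_ps_zero: "has_ps (\<lambda>_. 0) p 0"
  by (rule has_ps_finite[of "{}"]) auto

lemma has_ps_one: "has_ps (\<lambda>_. 1) p 1"
  by (rule has_ps_finite[of "{0}"]) auto

lemma cpow_unit_mi [simp]: "cpow z (unit_mi i) = z i"
  using cpow_unit_mi_add[of z 0 i] by simp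

lemma has_ps_coord: "p $ i = 0 \<Longrightarrow> has_ps (\<lambda>q. of_real (q $ i)) p (var i)"
  by (rule has_ps_finite[of "{unit_mi i}"]) (auto simp: var_def offset_def)

lemma has_ps_coord': "has_ps (\<lambda>q. of_real (q $ i)) p (var i + const (of_real (p $ i)))"
proof -
  have "has_ps (\<lambda>q. of_real (q $ i - p $ i)) p (var i)"
    by (rule has_ps_finite[of "{unit_mi i}"]) (auto simp: var_def offset_def)
  from has_ps_add[OF this has_ps_const] show ?thesis
    by (rule has_ps_cong) (simp add: always_eventually)
qed

lemma has_ps_diff: "has_ps f p F \<Longrightarrow> has_ps g p G \<Longrightarrow> has_ps (\<lambda>q. f q - g q) p (F - G)"
proof -
  assume f: "has_ps f p F" and g: "has_ps g p G"
  have "has_ps (\<lambda>q. f q + (- 1) * g q) p (F + const (- 1) * G)"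
    by (intro has_ps_add has_ps_mult has_ps_const f g)
  moreover have "F + const (- 1) * G = F - G"
    by (rule mfps_eqI) simp
  ultimately show ?thesis by simp
qed

text \<open>
  Here \<open>f\<close> is only known to vanish on the slice through \<open>p\<close> in the directions \<open>I\<close>.  Up to a nonzero
  factor the coefficient at \<open>\<mu> + e\<^sub>i\<close> is the coefficient at \<open>\<mu>\<close> of the derivative, and for \<open>i \<in> I\<close> the
  derivative vanishes on the slice as well.  With \<open>I = UNIV\<close> this is uniqueness of the Taylor series;
  with \<open>I = - T\<close> it concerns functions vanishing on \<open>N\<close>.
\<close>

lemma has_ps_slice_zero:
  fixes I :: "'k::finite set"
  assumes "has_ps f p F" "eventually (\<lambda>q. (\<forall>i\<in>-I. q $ i = p $ i) \<longrightarrow> f q = 0) (nhds p)"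
    and "\<forall>i\<in>-I. \<kappa> i = 0"
  shows "coef F \<kappa> = 0"
  using assms
proof (induction "mi_size \<kappa>" arbitrary: \<kappa> f F)
  case 0
  then have "\<And>i. \<kappa> i = 0" by (simp add: mi_size_def)
  then have "\<kappa> = 0" by (simp add: fun_eq_iff)
  moreover have "f p = 0" using eventually_nhds_x_imp_x[OF "0.prems"(2)] by simp
  ultimately show ?case using has_ps_at_center[OF "0.prems"(1)] by (simp del: zero_fun_apply)
next
  case (Suc n)
  have "\<exists>i. \<kappa> i \<noteq> 0" using Suc.hyps(2) by (auto simp: mi_size_def intro: ccontr)
  then obtain i where i: "\<kappa> i \<noteq> 0" by blast
  with Suc.prems have iI: "i \<in> I" by (cases "i \<in> I") auto
  define \<mu> where "\<mu> = \<kappa> - unit_mi i"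
  have \<kappa>: "\<kappa> = \<mu> + unit_mi i" using i by (simp add: \<mu>_def le_unit_mi)
  have size: "mi_size (\<mu> + unit_mi i) = Suc (mi_size \<mu>)"
    by (simp add: mi_size_def sum.distrib) (simp add: unit_mi_def)
  have ev: "eventually (\<lambda>q. (\<forall>i\<in>-I. q $ i = p $ i) \<longrightarrow> partial_deriv i f q = 0) (nhds p)"
  proof -
    from Suc.prems(2) have "eventually (\<lambda>q. eventually (\<lambda>q'. (\<forall>i\<in>-I. q' $ i = p $ i) \<longrightarrow> f q' = 0) (nhds q)) (nhds p)"
      by (simp add: eventually_eventually)
    then show ?thesis
    proof (rule eventually_mono, intro impI)
      fix q assume q: "eventually (\<lambda>q'. (\<forall>i\<in>-I. q' $ i = p $ i) \<longrightarrow> f q' = 0) (nhds q)"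
        and qI: "\<forall>i\<in>-I. q $ i = p $ i"
      have "((\<lambda>s. q + s *\<^sub>R axis i 1) \<longlongrightarrow> q + 0 *\<^sub>R axis i 1) (nhds (0::real))"
        by (intro tendsto_intros filterlim_ident)
      then have "filterlim (\<lambda>s. q + s *\<^sub>R axis i 1) (nhds q) (nhds (0::real))"
        by simp
      from eventually_compose_filterlim[OF q this]
      have ev: "eventually (\<lambda>s. f (q + s *\<^sub>R axis i 1) = 0) (nhds (0::real))"
        by (rule eventually_mono) (use qI iI in \<open>auto simp: axis_def\<close>)
      have "partial_deriv i f q = vector_derivative (\<lambda>s. 0::complex) (at 0)"
        unfolding partial_deriv_def by (rule vector_derivative_cong_eq) (use ev in auto)
      then show "partial_deriv i f q = 0" by simp
    qed
  qed
  have "coef (pd i F) \<mu> = 0"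
    using Suc.hyps(2) size Suc.prems(3)
    by (intro Suc.hyps(1)[OF _ has_ps_partial_deriv[OF Suc.prems(1)] ev]) (auto simp: \<kappa>)
  then show ?case by (simp add: coef_pd \<kappa> del: of_nat_Suc)
qed

lemma has_ps_unique:
  assumes "has_ps f p F" "has_ps g p G" "eventually (\<lambda>q. f q = g q) (nhds p)"
  shows "F = G"
proof (rule mfps_eqI)
  fix \<kappa>
  have "coef (F - G) \<kappa> = 0"
    by (rule has_ps_slice_zero[OF has_ps_diff[OF assms(1,2)], where I = UNIV])
      (use assms(3) in \<open>auto elim: eventually_mono\<close>)
  then show "coef F \<kappa> = coef G \<kappa>" by simp
qed

text \<open>
  An arbitrary series if \<open>f\<close> is not analytic at \<open>p\<close>.
\<close>

definition tay :: "'k pt \<Rightarrow> 'k::finite fn \<Rightarrow> 'k mfps"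
  where "tay p f = (THE F. has_ps f p F)"

lemma tay_eqI: "has_ps f p F \<Longrightarrow> tay p f = F"
  unfolding tay_def by (rule the_equality) (auto intro: has_ps_unique always_eventually)

abbreviation ana :: "'k::finite fn \<Rightarrow> 'k pt \<Rightarrow> bool"
  where "ana f p \<equiv> real_analytic_at UNIV f p"

lemma ana_has_ps: "ana f p \<Longrightarrow> has_ps f p (tay p f)"
  using real_analytic_at_iff_has_ps tay_eqI by metis

lemma has_ps_ana: "has_ps f p F \<Longrightarrow> ana f p"
  using real_analytic_at_iff_has_ps by metis

lemma tay_cong:
  "ana f p \<Longrightarrow> eventually (\<lambda>q. f q = g q) (nhds p) \<Longrightarrow> tay p f = tay p g"
  by (metis ana_has_ps has_ps_cong tay_eqI)

lemma has_ps_sum: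
  "(\<And>x. x \<in> A \<Longrightarrow> has_ps (f x) p (F x)) \<Longrightarrow> has_ps (\<lambda>q. \<Sum>x\<in>A. f x q) p (\<Sum>x\<in>A. F x)"
  by (induction A rule: infinite_finite_induct) (auto intro: has_ps_zero has_ps_add)

lemma has_ps_prod:
  "(\<And>x. x \<in> A \<Longrightarrow> has_ps (f x) p (F x)) \<Longrightarrow> has_ps (\<lambda>q. \<Prod>x\<in>A. f x q) p (\<Prod>x\<in>A. F x)"
  by (induction A rule: infinite_finite_induct) (auto intro: has_ps_one has_ps_mult)

lemma has_ps_power: "has_ps f p F \<Longrightarrow> has_ps (\<lambda>q. f q ^ n) p (F ^ n)"
  by (induction n) (auto intro: has_ps_one has_ps_mult)

lemma has_ps_exp:
  fixes p :: "'k::finite pt"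
  shows "has_ps (\<lambda>q. exp (of_real (q $ i - p $ i))) p
    (MFPS (\<lambda>\<kappa>. if \<forall>j\<in>-{i}. \<kappa> j = 0 then 1 / fact (\<kappa> i) else 0))"
proof (rule has_psI[of 1])
  fix q :: "'k pt"
  let ?z = "complex_of_real (q $ i - p $ i)"
  have "((\<lambda>n. ?z ^ n /\<^sub>R fact n) has_sum exp ?z) UNIV"
    by (intro norm_summable_imp_has_sum summable_norm_exp exp_converges)
  then have "((\<lambda>n. 1 / fact n * ?z ^ n) has_sum exp ?z) UNIV"
    by (simp add: scaleR_conv_of_real field_simps)
  then have "((\<lambda>\<kappa>. 1 / fact (\<kappa> i) * ?z ^ \<kappa> i) has_sum exp ?z) {\<kappa> :: 'k \<Rightarrow> nat. \<forall>j\<in>-{i}. \<kappa> j = 0}"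
    by (rule iffD1[OF has_sum_reindex_bij_witness, rotated -1,
          where i1 = "\<lambda>\<kappa>. \<kappa> i" and j1 = "\<lambda>n j. if j = i then n else 0"])
      auto
  then show "((\<lambda>\<kappa>. coef (MFPS (\<lambda>\<kappa>. if \<forall>j\<in>-{i}. \<kappa> j = 0 then 1 / fact (\<kappa> i) else 0)) \<kappa> * cpow (offset p q) \<kappa>)
      has_sum exp ?z) UNIV"
  proof (rule has_sum_cong_neutral[THEN iffD1, rotated -1])
    fix \<kappa> :: "'k \<Rightarrow> nat" assume "\<kappa> \<in> {\<kappa>. \<forall>j\<in>-{i}. \<kappa> j = 0} \<inter> UNIV"
    then have k: "\<forall>j\<in>-{i}. \<kappa> j = 0" by simp
    have "cpow (offset p q) \<kappa> = offset p q i ^ \<kappa> i * (\<Prod>j\<in>UNIV-{i}. offset p q j ^ \<kappa> j)"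
      unfolding cpow_def by (rule prod.remove) auto
    also have "(\<Prod>j\<in>UNIV-{i}. offset p q j ^ \<kappa> j) = 1"
      by (rule prod.neutral) (use k in auto)
    finally have "cpow (offset p q) \<kappa> = ?z ^ \<kappa> i" by (simp only: mult_1_right) (simp only: offset_def)
    then show "1 / fact (\<kappa> i) * ?z ^ \<kappa> i = coef (MFPS (\<lambda>\<kappa>. if \<forall>j\<in>-{i}. \<kappa> j = 0 then 1 / fact (\<kappa> i) else 0)) \<kappa> * cpow (offset p q) \<kappa>"
      using k by simp
  qed auto
qed simp

lemma ana_exp: "ana (\<lambda>q. exp (of_real (q $ i - c))) p"
proof -
  have "has_ps (\<lambda>q. exp (of_real (p $ i - c)) * exp (of_real (q $ i - p $ i))) p
      (const (exp (of_real (p $ i - c))) * tay p (\<lambda>q. exp (of_real (q $ i - p $ i))))"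
    by (intro has_ps_mult has_ps_const ana_has_ps has_ps_ana[OF has_ps_exp])
  then have "has_ps (\<lambda>q. exp (of_real (q $ i - c))) p
      (const (exp (of_real (p $ i - c))) * tay p (\<lambda>q. exp (of_real (q $ i - p $ i))))"
    by (rule has_ps_cong) (auto intro!: always_eventually simp flip: exp_add of_real_add)
  then show ?thesis by (rule has_ps_ana)
qed

lemma ana_continuous:
  fixes f :: "'k::finite fn"
  assumes "ana f p"
  shows "isCont f p"
proof -
  obtain \<rho> where \<rho>: "\<rho> > 0" "(\<lambda>\<kappa>. norm (coef (tay p f) \<kappa>) * \<rho> ^ mi_size \<kappa>) summable_on UNIV"
    "\<And>q. (\<And>i. \<bar>q $ i - p $ i\<bar> \<le> \<rho>) \<Longrightarrow> ps_sums (tay p f) p q (f q)"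
    using ana_has_ps[OF assms] by (rule has_ps_polydisc) blast
  have "uniform_limit (cball p \<rho>) (\<lambda>X q. \<Sum>\<kappa>\<in>X. coef (tay p f) \<kappa> * cpow (offset p q) \<kappa>) f (finite_subsets_at_top UNIV)"
  proof (rule Weierstrass_m_test_general')
    fix q and \<kappa> :: "'k \<Rightarrow> nat" assume "q \<in> cball p \<rho>"
    then have q: "\<bar>q $ j - p $ j\<bar> \<le> \<rho>" for j
      using component_le_norm_cart[of "q - p" j] by (simp add: dist_norm norm_minus_commute)
    show "norm (coef (tay p f) \<kappa> * cpow (offset p q) \<kappa>) \<le> norm (coef (tay p f) \<kappa>) * \<rho> ^ mi_size \<kappa>"
      using norm_cpow_le[of "offset p q" \<rho> \<kappa>] q by (simp add: norm_mult mult_left_mono)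
  next
    fix q assume "q \<in> cball p \<rho>"
    then have q: "\<bar>q $ j - p $ j\<bar> \<le> \<rho>" for j
      using component_le_norm_cart[of "q - p" j] by (simp add: dist_norm norm_minus_commute)
    then show "ps_sums (tay p f) p q (f q)"
      by (rule \<rho>(3))
  qed (fact \<rho>(2))
  moreover have "\<forall>\<^sub>F X in finite_subsets_at_top UNIV.
      continuous_on (cball p \<rho>) (\<lambda>q. \<Sum>\<kappa>\<in>X. coef (tay p f) \<kappa> * cpow (offset p q) \<kappa>)"
    unfolding cpow_def offset_def by (intro always_eventually allI continuous_intros)
  ultimately have "continuous_on (cball p \<rho>) f"
    by (intro uniform_limit_theorem[rotated]) auto
  then have "continuous_on (ball p \<rho>) f"
    by (rule continuous_on_subset) auto
  then show ?thesis using \<rho>(1) by (auto simp: continuous_on_eq_continuous_at)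
qed

section \<open>The identity theorem on N, and polynomial functions\<close>

text \<open>
  The conditions of being true near \<open>N\<close> thus become conditions on germs at the points of \<open>N\<close>.
\<close>

lemma near_iff:
  assumes "open M"
  shows "near T M \<Phi> \<longleftrightarrow> (\<forall>p\<in>core T M. eventually \<Phi> (nhds p))"
proof
  assume "near T M \<Phi>"
  then show "\<forall>p\<in>core T M. eventually \<Phi> (nhds p)"
    unfolding near_def eventually_nhds by blast
next
  assume *: "\<forall>p\<in>core T M. eventually \<Phi> (nhds p)"
  show "near T M \<Phi>"
    unfolding near_def
  proof (intro exI conjI ballI)
    show "open (M \<inter> interior {q. \<Phi> q})" using assms by auto
    show "core T M \<subseteq> M \<inter> interior {q. \<Phi> q}"
    proof
      fix p assume p: "p \<in> core T M"
      then have "eventually \<Phi> (nhds p)" using * by blast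
      then have "p \<in> interior {q. \<Phi> q}" by (auto simp: eventually_nhds intro: interiorI)
      then show "p \<in> M \<inter> interior {q. \<Phi> q}" using p by (simp add: core_def)
    qed
    show "\<Phi> p" if "p \<in> M \<inter> interior {q. \<Phi> q}" for p
      using that interior_subset by blast
  qed auto
qed

text \<open>
  The points of \<open>N\<close> around which \<open>f\<close> vanishes on \<open>N\<close> form an open subset \<open>Z\<close> of \<open>N\<close>.  Its complement is
  open too: if \<open>y \<in> Z\<close> and \<open>z\<close> in \<open>N\<close> are close to \<open>x\<close>, the series at \<open>x\<close> extends \<open>f\<close> holomorphically
  along the segment from \<open>y\<close> to \<open>z\<close>; the extension vanishes near the end \<open>y\<close>, hence everywhere, so that
  \<open>f\<close> vanishes around \<open>x\<close>.
\<close>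

lemma identity_theorem_core:
  fixes f :: "'k::finite fn"
  assumes "open M" "connected (core T M)" and ana: "\<And>p. p \<in> core T M \<Longrightarrow> ana f p"
    and x0: "x0 \<in> core T M" "f x0 \<noteq> 0" and x: "x \<in> core T M" and "e > 0"
  shows "\<exists>y\<in>core T M. dist x y < e \<and> f y \<noteq> 0"
proof (rule ccontr)
  define N where "N = core T M"
  define Z where "Z = {x \<in> N. \<exists>e>0. \<forall>y\<in>N. dist x y < e \<longrightarrow> f y = 0}"
  assume "\<not> ?thesis"
  then have "x \<in> Z" using x \<open>e > 0\<close> by (auto simp: Z_def N_def)
  have "openin (top_of_set N) Z"
    unfolding openin_euclidean_subtopology_iff
  proof (intro conjI ballI)
    show "Z \<subseteq> N" by (auto simp: Z_def)
    fix x assume "x \<in> Z"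
    then obtain e where e: "e > 0" "\<forall>y\<in>N. dist x y < e \<longrightarrow> f y = 0" by (auto simp: Z_def)
    have "x' \<in> Z" if x': "x' \<in> N" "dist x' x < e / 2" for x'
    proof -
      have "f y = 0" if y: "y \<in> N" "dist x' y < e / 2" for y
        using e(2) y dist_triangle_half_r[of x' x e y] x'(2) by auto
      then show ?thesis using x'(1) e(1) unfolding Z_def by (auto intro!: exI[of _ "e / 2"])
    qed
    then show "\<exists>e>0. \<forall>x'\<in>N. dist x' x < e \<longrightarrow> x' \<in> Z"
      using e(1) by (auto intro!: exI[of _ "e / 2"])
  qed
  moreover have "openin (top_of_set N) (N - Z)"
    unfolding openin_euclidean_subtopology_iff
  proof (intro conjI ballI)
    show "N - Z \<subseteq> N" by auto
    fix x assume x: "x \<in> N - Z"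
    then have "ana f x" using ana by (simp add: N_def)
    then obtain \<rho> where \<rho>: "\<rho> > 0" "(\<lambda>\<kappa>. norm (coef (tay x f) \<kappa>) * \<rho> ^ mi_size \<kappa>) summable_on UNIV"
      "\<And>q. (\<And>i. \<bar>q $ i - x $ i\<bar> \<le> \<rho>) \<Longrightarrow> ps_sums (tay x f) x q (f q)"
      using has_ps_polydisc[OF ana_has_ps[OF \<open>ana f x\<close>]] by blast
    have "y \<notin> Z" if y: "y \<in> N" "dist y x < \<rho> / 4" for y
    proof
      assume "y \<in> Z"
      then obtain d1 where d1: "d1 > 0" "\<forall>z\<in>N. dist y z < d1 \<longrightarrow> f z = 0" by (auto simp: Z_def)
      have "y \<in> M" using y(1) by (simp add: N_def core_def)
      then obtain d2 where d2: "d2 > 0" "ball y d2 \<subseteq> M" using \<open>open M\<close> open_contains_ball by blast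
      have "f z = 0" if z: "z \<in> N" "dist x z < \<rho> / 4" for z
      proof -
        define g where "g s = cser (tay x f) (\<lambda>i. offset x y i + s * of_real (z $ i - y $ i))" for s
        have yi: "\<bar>y $ i - x $ i\<bar> \<le> \<rho> / 4" and zi: "\<bar>z $ i - x $ i\<bar> \<le> \<rho> / 4" for i
          using component_le_norm_cart[of "y - x" i] component_le_norm_cart[of "z - x" i] y(2) z(2)
          by (auto simp: dist_norm norm_minus_commute)
        have zyi: "\<bar>z $ i - y $ i\<bar> \<le> \<rho> / 2" for i
          using yi[of i] zi[of i] by linarith
        \<comment> \<open>The disc contains \<open>[0, 1]\<close>, and \<open>\<rho> / 4 + 3 / 2 * (\<rho> / 2) = \<rho>\<close>.\<close>
        have hol: "g holomorphic_on ball 0 (3/2)"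
          unfolding g_def
        proof (rule cser_line_holomorphic[OF \<rho>(2)])
          show "norm (offset x y i) + 3/2 * norm (complex_of_real (z $ i - y $ i)) \<le> \<rho>" for i
            unfolding norm_of_real norm_offset
            by (rule order_trans[OF add_mono[OF yi[of i] mult_left_mono[OF zyi[of i]]]]) auto
        qed simp
        have g: "f (y + s *\<^sub>R (z - y)) = g (of_real s)" if s: "0 \<le> s" "s \<le> 1" for s
        proof -
          have "\<bar>(y + s *\<^sub>R (z - y)) $ i - x $ i\<bar> \<le> \<rho>" for i
          proof -
            have "\<bar>s * (z $ i - y $ i)\<bar> \<le> 1 * (\<rho> / 2)"
              unfolding abs_mult using s zyi[of i] by (intro mult_mono) auto
            moreover have "(y + s *\<^sub>R (z - y)) $ i - x $ i = (y $ i - x $ i) + s * (z $ i - y $ i)"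
              by simp
            ultimately show ?thesis
              using yi[of i] \<rho>(1) abs_triangle_ineq[of "y $ i - x $ i" "s * (z $ i - y $ i)"] by linarith
          qed
          then have "ps_sums (tay x f) x (y + s *\<^sub>R (z - y)) (f (y + s *\<^sub>R (z - y)))"
            by (rule \<rho>(3))
          moreover have "offset x (y + s *\<^sub>R (z - y)) = (\<lambda>i. offset x y i + of_real s * of_real (z $ i - y $ i))"
            by (simp add: offset_def fun_eq_iff)
          ultimately show ?thesis by (simp add: g_def cser_def infsumI)
        qed
        define \<delta> where "\<delta> = min 1 (min d1 d2 / (norm (z - y) + 1))"
        have "\<delta> > 0" using d1(1) d2(1) by (simp add: \<delta>_def add_nonneg_pos)
        have g0: "g (of_real s) = 0" if s: "0 < s" "s < \<delta>" for s
        proof -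
          have "s * norm (z - y) < min d1 d2"
          proof -
            have "s * norm (z - y) \<le> s * (norm (z - y) + 1)" using s by (simp add: mult_left_mono)
            also have "\<dots> < min d1 d2 / (norm (z - y) + 1) * (norm (z - y) + 1)"
              using s by (intro mult_strict_right_mono) (auto simp: \<delta>_def add_nonneg_pos)
            also have "\<dots> = min d1 d2"
              using add_nonneg_pos[OF norm_ge_zero[of "z - y"] zero_less_one] by simp
            finally show ?thesis .
          qed
          then have dist: "dist y (y + s *\<^sub>R (z - y)) < min d1 d2"
            using s by (simp add: dist_norm)
          then have "y + s *\<^sub>R (z - y) \<in> M" using d2(2) by auto
          then have "y + s *\<^sub>R (z - y) \<in> N"
            using y(1) z(1) by (auto simp: N_def core_def)
          then have "f (y + s *\<^sub>R (z - y)) = 0" using d1(2) dist by auto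
          then show ?thesis using g[of s] s by (simp add: \<delta>_def)
        qed
        have "g 1 = 0"
        proof (rule analytic_continuation[OF hol])
          show "of_real ` {0<..<min \<delta> 1} \<subseteq> ball (0::complex) (3/2)" by auto
          show "(0::complex) islimpt of_real ` {0<..<min \<delta> 1}"
            unfolding islimpt_approachable
          proof (intro allI impI)
            fix e :: real assume "e > 0"
            then show "\<exists>x'\<in>complex_of_real ` {0<..<min \<delta> 1}. x' \<noteq> 0 \<and> dist x' 0 < e"
              using \<open>\<delta> > 0\<close>
              by (intro bexI[of _ "of_real (min e (min \<delta> 1) / 2)"] imageI conjI) (auto simp: norm_mult)
          qed
        qed (use g0 in auto)
        then show ?thesis using g[of 1] by simp
      qed
      then have "x \<in> Z" using x \<rho>(1) by (auto simp: Z_def intro!: exI[of _ "\<rho> / 4"])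
      then show False using x by simp
    qed
    then show "\<exists>e>0. \<forall>x'\<in>N. dist x' x < e \<longrightarrow> x' \<in> N - Z"
      using \<rho>(1) by (auto intro!: exI[of _ "\<rho> / 4"])
  qed
  moreover have "Z \<inter> (N - Z) = {}" "N \<subseteq> Z \<union> (N - Z)" by auto
  moreover have "connected N" using assms(2) by (simp add: N_def)
  ultimately have "Z = {} \<or> N - Z = {}"
    unfolding connected_openin by blast
  then have "x0 \<in> Z" using \<open>x \<in> Z\<close> x0(1) by (auto simp: N_def)
  then show False using x0 by (auto simp: Z_def N_def)
qed

text \<open>
  By the identity theorem the points of \<open>N\<close> where \<open>g\<close> does not vanish are dense.
\<close>

lemma analytic_zero_of_mult_zero:
  fixes f g :: "'k::finite fn"
  assumes "open M" "connected (core T M)"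
    and ana: "\<And>p. p \<in> core T M \<Longrightarrow> ana f p" "\<And>p. p \<in> core T M \<Longrightarrow> ana g p"
    and x0: "x0 \<in> core T M" "g x0 \<noteq> 0"
    and zero: "\<And>p. p \<in> core T M \<Longrightarrow> g p \<noteq> 0 \<Longrightarrow> f p = 0" and x: "x \<in> core T M"
  shows "f x = 0"
proof (rule ccontr)
  assume "f x \<noteq> 0"
  have "isCont f x" using ana(1)[OF x] by (rule ana_continuous)
  then obtain e where e: "e > 0" "\<And>y. dist y x < e \<Longrightarrow> f y \<noteq> 0"
    using \<open>f x \<noteq> 0\<close> continuous_at_avoid[of x f 0] by (auto simp: dist_commute)
  obtain y where "y \<in> core T M" "dist x y < e" "g y \<noteq> 0"
    using identity_theorem_core[OF assms(1,2) ana(2) x0 x e(1)] by blast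
  then show False using zero e(2)[of y] by (simp add: dist_commute)
qed

text \<open>
  Closure properties instead of coefficients: the only thing needed about these functions is that
  they restrict to univariate polynomials on complex lines.
\<close>

inductive polyfun :: "(('k \<Rightarrow> complex) \<Rightarrow> complex) \<Rightarrow> bool" where
  polyfun_const: "polyfun (\<lambda>_. c)"
| polyfun_coord: "polyfun (\<lambda>z. z i)"
| polyfun_add: "polyfun f \<Longrightarrow> polyfun g \<Longrightarrow> polyfun (\<lambda>z. f z + g z)"
| polyfun_mult: "polyfun f \<Longrightarrow> polyfun g \<Longrightarrow> polyfun (\<lambda>z. f z * g z)"

lemma polyfun_sum: "(\<And>x. x \<in> A \<Longrightarrow> polyfun (f x)) \<Longrightarrow> polyfun (\<lambda>z. \<Sum>x\<in>A. f x z)"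
  by (induction A rule: infinite_finite_induct) (auto intro: polyfun.intros)

lemma polyfun_prod: "(\<And>x. x \<in> A \<Longrightarrow> polyfun (f x)) \<Longrightarrow> polyfun (\<lambda>z. \<Prod>x\<in>A. f x z)"
  by (induction A rule: infinite_finite_induct) (auto intro: polyfun.intros)

lemma polyfun_power: "polyfun f \<Longrightarrow> polyfun (\<lambda>z. f z ^ n)"
  by (induction n) (auto intro: polyfun.intros)

lemma polyfun_cpow: "polyfun (\<lambda>z. cpow z \<kappa>)"
  unfolding cpow_def by (intro polyfun_prod polyfun_power polyfun_coord)

lemma polyfun_line:
  assumes "polyfun f"
  shows "\<exists>P. \<forall>s. f (\<lambda>i. a i + s * b i) = poly P s"
  using assms
proof induction
  case (polyfun_const c)
  show ?case by (intro exI[of _ "[:c:]"]) simp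
next
  case (polyfun_coord i)
  show ?case by (intro exI[of _ "[:a i, b i:]"]) simp
next
  case (polyfun_add f g)
  then show ?case by (metis poly_add)
next
  case (polyfun_mult f g)
  then show ?case by (metis poly_mult)
qed

text \<open>
  The coordinates are released from \<open>\<nat>\<close> one after the other; each time a univariate polynomial has
  infinitely many roots.
\<close>

lemma polyfun_zero_of_nat:
  fixes f :: "('k::finite \<Rightarrow> complex) \<Rightarrow> complex"
  assumes f: "polyfun f" and zero: "\<And>\<omega> :: 'k \<Rightarrow> nat. f (\<lambda>i. of_nat (\<omega> i)) = 0"
  shows "f z = 0"
proof -
  have "\<forall>z. (\<forall>i. i \<notin> A \<longrightarrow> z i \<in> \<nat>) \<longrightarrow> f z = 0" for A :: "'k set"
  proof (induction A rule: infinite_finite_induct)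
    case empty
    show ?case
    proof (intro allI impI)
      fix z :: "'k \<Rightarrow> complex" assume "\<forall>i. i \<notin> {} \<longrightarrow> z i \<in> \<nat>"
      then have "\<forall>i. \<exists>n. z i = of_nat n" by (auto simp: Nats_def)
      then obtain \<omega> where "\<And>i. z i = of_nat (\<omega> i)" by metis
      then have "z = (\<lambda>i. of_nat (\<omega> i))" by auto
      then show "f z = 0" using zero by simp
    qed
  next
    case (insert i A)
    show ?case
    proof (intro allI impI)
      fix z :: "'k \<Rightarrow> complex" assume z: "\<forall>j. j \<notin> insert i A \<longrightarrow> z j \<in> \<nat>"
      obtain P where P: "\<And>s. f (\<lambda>j. (z(i := 0)) j + s * of_bool (j = i)) = poly P s"
        using polyfun_line[OF f, of "z(i := 0)" "\<lambda>j. of_bool (j = i)"] by blast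
      have line: "(\<lambda>j. (z(i := 0)) j + s * of_bool (j = i)) = z(i := s)" for s
        by auto
      have "\<nat> \<subseteq> {s. poly P s = 0}"
      proof
        fix s :: complex assume "s \<in> \<nat>"
        then have "f (z(i := s)) = 0" using z insert.IH by auto
        then show "s \<in> {s. poly P s = 0}" using P[of s] unfolding line by simp
      qed
      moreover have "infinite (\<nat> :: complex set)"
        unfolding Nats_def by (rule range_inj_infinite) (rule inj_of_nat)
      ultimately have "P = 0" using poly_roots_finite finite_subset by blast
      then show "f z = 0" using P[of "z i"] unfolding line by simp
    qed
  qed auto
  from this[of UNIV] show ?thesis by simp
qed

text \<open>
  On the line through \<open>z0\<close> and \<open>z\<close> this is the absence of zero divisors among univariate polynomials.
\<close>

lemma polyfun_zero_of_mult_zero: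
  fixes f g :: "('k::finite \<Rightarrow> complex) \<Rightarrow> complex"
  assumes "polyfun f" "polyfun g" and zero: "\<And>\<omega> :: 'k \<Rightarrow> nat. f (\<lambda>i. of_nat (\<omega> i)) * g (\<lambda>i. of_nat (\<omega> i)) = 0"
    and "f z0 \<noteq> 0"
  shows "g z = 0"
proof -
  have fg: "f w * g w = 0" for w
    by (rule polyfun_zero_of_nat[where f = "\<lambda>w. f w * g w"]) (use assms in \<open>auto intro: polyfun_mult\<close>)
  obtain P where P: "\<And>s. f (\<lambda>i. z0 i + s * (z i - z0 i)) = poly P s"
    using polyfun_line[OF assms(1), of z0 "\<lambda>i. z i - z0 i"] by blast
  obtain Q where Q: "\<And>s. g (\<lambda>i. z0 i + s * (z i - z0 i)) = poly Q s"
    using polyfun_line[OF assms(2), of z0 "\<lambda>i. z i - z0 i"] by blast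
  have "poly (P * Q) s = 0" for s
    using fg[of "\<lambda>i. z0 i + s * (z i - z0 i)"] by (simp add: P Q)
  then have "P * Q = 0" using poly_all_0_iff_0[of "P * Q"] by blast
  moreover have "P \<noteq> 0" using P[of 0] assms(4) by auto
  ultimately have "Q = 0" by simp
  then show ?thesis using Q[of 1] by simp
qed

text \<open>
  A polynomial is its own Taylor series at \<open>0\<close>, and Taylor series are unique.
\<close>

lemma cpow_coeffs_zero:
  fixes c :: "('k::finite \<Rightarrow> nat) \<Rightarrow> complex"
  assumes "finite A" and zero: "\<And>\<omega> :: 'k \<Rightarrow> nat. (\<Sum>\<kappa>\<in>A. c \<kappa> * cpow (\<lambda>i. of_nat (\<omega> i)) \<kappa>) = 0"
    and "\<kappa> \<in> A"
  shows "c \<kappa> = 0"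
proof -
  have all: "(\<Sum>\<kappa>\<in>A. c \<kappa> * cpow z \<kappa>) = 0" for z
    by (rule polyfun_zero_of_nat[where f = "\<lambda>z. \<Sum>\<kappa>\<in>A. c \<kappa> * cpow z \<kappa>"])
      (use zero in \<open>auto intro!: polyfun_sum polyfun_mult polyfun_const polyfun_cpow\<close>)
  let ?F = "MFPS (\<lambda>\<kappa>. if \<kappa> \<in> A then c \<kappa> else 0)"
  have "has_ps (\<lambda>_. 0) 0 ?F"
  proof (rule has_ps_finite[OF assms(1)])
    fix q
    have "(\<Sum>\<kappa>\<in>A. coef ?F \<kappa> * cpow (offset 0 q) \<kappa>) = (\<Sum>\<kappa>\<in>A. c \<kappa> * cpow (offset 0 q) \<kappa>)"
      by (rule sum.cong) auto
    then show "0 = (\<Sum>\<kappa>\<in>A. coef ?F \<kappa> * cpow (offset 0 q) \<kappa>)" by (simp add: all)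
  qed auto
  then have "?F = 0" by (rule has_ps_unique[OF _ has_ps_zero]) (simp add: always_eventually)
  then have "coef ?F \<kappa> = coef 0 \<kappa>" by simp
  then show ?thesis using assms(3) by simp
qed

section \<open>Formal differential operators and their two leading symbols\<close>

text \<open>
  The composite that defines \<open>op_power\<close>, for operators on an arbitrary type; it is used on functions,
  on Taylor series and on their restrictions to \<open>N\<close>.
\<close>

definition opow :: "('k \<Rightarrow> 'a \<Rightarrow> 'a) \<Rightarrow> 'k::{finite,linorder} set \<Rightarrow> ('k \<Rightarrow> nat) \<Rightarrow> 'a \<Rightarrow> 'a"
  where "opow E I \<kappa> = foldr (\<lambda>i g. (E i ^^ \<kappa> i) \<circ> g) (sorted_list_of_set I) id"

lemma op_power_eq_opow: "op_power = opow"
  by (intro ext) (simp add: op_power_def opow_def)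

lemma foldr_op_rel:
  assumes "\<And>i f g. i \<in> set L \<Longrightarrow> R f g \<Longrightarrow> R (E i f) (E' i g)" "R f g"
  shows "R (foldr (\<lambda>i g. (E i ^^ \<kappa> i) \<circ> g) L id f) (foldr (\<lambda>i g. (E' i ^^ \<kappa> i) \<circ> g) L id g)"
  using assms(1)
proof (induction L)
  case Nil
  then show ?case using assms(2) by simp
next
  case (Cons i L)
  have "R ((E i ^^ n) x) ((E' i ^^ n) y)" if "R x y" for n x y
    using that by (induction n) (auto intro: Cons.prems)
  then show ?case using Cons by simp
qed

text \<open>
  All passages between different kinds of operators below (functions to series, conjugation by a
  test function, restriction to \<open>N\<close>) are instances for suitable \<open>R\<close>.
\<close>

lemma opow_rel:
  assumes "\<And>i f g. i \<in> I \<Longrightarrow> R f g \<Longrightarrow> R (E i f) (E' i g)" "R f g"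
  shows "R (opow E I \<kappa> f) (opow E' I \<kappa> g)"
  unfolding opow_def by (rule foldr_op_rel) (use assms in auto)

definition Der :: "'k set \<Rightarrow> 'k \<Rightarrow> 'k::finite mfps \<Rightarrow> 'k mfps"
  where "Der T i f = (if i \<in> T then var i * pd i f else pd i f)"

definition Dpow :: "'k set \<Rightarrow> ('k::{finite,linorder} \<Rightarrow> 'a \<Rightarrow> 'a) \<Rightarrow> ('k \<Rightarrow> nat) \<Rightarrow> 'a \<Rightarrow> 'a"
  where "Dpow T E \<kappa> f = opow E T \<kappa> (opow E (- T) \<kappa> f)"

text \<open>
  The conjugate of \<open>D\<^sub>i\<close> by \<open>t\<^sup>\<omega> e\<^sup>\<omega>\<^sup>x\<close>.
\<close>

definition shifted :: "'k set \<Rightarrow> ('k \<Rightarrow> nat) \<Rightarrow> 'k \<Rightarrow> 'k::finite mfps \<Rightarrow> 'k mfps"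
  where "shifted T \<omega> i f = Der T i f + of_nat (\<omega> i) * f"

text \<open>
  The operator \<open>\<Sum>\<^sub>\<kappa> a\<^sub>\<kappa> D\<^sup>\<kappa>\<close> with \<open>E\<close> in place of \<open>D\<close>.  The finite index set \<open>K\<close> is explicit so that
  several operators can share it.
\<close>

definition fop :: "'k set \<Rightarrow> ('k::{finite,linorder} \<Rightarrow> 'k mfps \<Rightarrow> 'k mfps) \<Rightarrow> ('k \<Rightarrow> nat) set \<Rightarrow>
    (('k \<Rightarrow> nat) \<Rightarrow> 'k mfps) \<Rightarrow> 'k mfps \<Rightarrow> 'k mfps"
  where "fop T E K a f = (\<Sum>\<kappa>\<in>K. a \<kappa> * Dpow T E \<kappa> f)"

abbreviation mat_fop :: "'k set \<Rightarrow> ('k::{finite,linorder} \<Rightarrow> 'k mfps \<Rightarrow> 'k mfps) \<Rightarrow> ('k \<Rightarrow> nat) set \<Rightarrow>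
    ('m::finite \<Rightarrow> 'm \<Rightarrow> ('k \<Rightarrow> nat) \<Rightarrow> 'k mfps) \<Rightarrow> ('m \<Rightarrow> 'm \<Rightarrow> ('k \<Rightarrow> nat) \<Rightarrow> 'k mfps) \<Rightarrow>
    'm \<Rightarrow> 'm \<Rightarrow> 'k mfps \<Rightarrow> 'k mfps"
  where "mat_fop T E K A B i j f \<equiv> \<Sum>r\<in>UNIV. fop T E K (A i r) (fop T E K (B r j) f)"

lemma Der_simps [simp]:
  "Der T i 0 = 0" "Der T i 1 = 0" "Der T i (f + g) = Der T i f + Der T i g" "Der T i (f - g) = Der T i f - Der T i g"
  "Der T i (of_nat n * f) = of_nat n * Der T i f"
  by (simp_all add: Der_def distrib_left right_diff_distrib mult.left_commute)

lemma Der_sum: "Der T i (\<Sum>x\<in>A. f x) = (\<Sum>x\<in>A. Der T i (f x))"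
  by (induction A rule: infinite_finite_induct) auto

lemma Der_mult: "Der T i (f * g) = Der T i f * g + f * Der T i g"
  by (auto simp: Der_def pd_mult algebra_simps)

abbreviation lead_poly :: "nat \<Rightarrow> 'k::finite mfps \<Rightarrow> 'k mfps \<Rightarrow> (nat \<Rightarrow> 'k mfps) \<Rightarrow> nat \<Rightarrow> 'k mfps"
  where "lead_poly n u v c s \<equiv> of_nat (s ^ (n + 1)) * u + of_nat (s ^ n) * v + (\<Sum>m<n. of_nat (s ^ m) * c m)"

text \<open>
  The expansion \<open>h(s) = s\<^sup>n u + s\<^sup>n\<^sup>-\<^sup>1 v + \<dots>\<close> of a polynomial in \<open>s\<close> with lower terms left unspecified.
  It is multiplied by \<open>s\<close> to cover \<open>n = 0\<close>, where \<open>s = 0\<close> then forces \<open>v = 0\<close>.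
\<close>

definition lead :: "nat \<Rightarrow> 'k::finite mfps \<Rightarrow> 'k mfps \<Rightarrow> (nat \<Rightarrow> 'k mfps) \<Rightarrow> bool"
  where "lead n u v h \<longleftrightarrow> (\<exists>c. \<forall>s. of_nat s * h s =
    lead_poly n u v c s)"

lemma leadI:
  "(\<And>s. of_nat s * h s = lead_poly n u v c s)
    \<Longrightarrow> lead n u v h"
  unfolding lead_def by (intro exI allI)

lemma lead_mult: "lead n u v h \<Longrightarrow> lead n (a * u) (a * v) (\<lambda>s. a * h s)"
proof -
  assume "lead n u v h"
  then obtain c where c: "\<And>s. of_nat s * h s =
    lead_poly n u v c s"
    unfolding lead_def by blast
  have "of_nat s * (a * h s) =
    of_nat (s ^ (n + 1)) * (a * u) + of_nat (s ^ n) * (a * v) + (\<Sum>m<n. of_nat (s ^ m) * (a * c m))" for s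
  proof -
    have "of_nat s * (a * h s) = a * (of_nat s * h s)" by (simp add: mult_ac)
    also have "\<dots> = a * (of_nat (s ^ (n + 1)) * u) + a * (of_nat (s ^ n) * v) + (\<Sum>m<n. a * (of_nat (s ^ m) * c m))"
      unfolding c by (simp only: distrib_left sum_distrib_left)
    finally show ?thesis by (simp only: mult.left_commute)
  qed
  then show ?thesis by (rule leadI)
qed

lemma lead_add:
  assumes "lead n u v h" "lead n u' v' h'"
  shows "lead n (u + u') (v + v') (\<lambda>s. h s + h' s)"
proof -
  obtain c where c: "\<And>s. of_nat s * h s =
    lead_poly n u v c s"
    using assms(1) unfolding lead_def by blast
  obtain c' where c': "\<And>s. of_nat s * h' s =
    lead_poly n u' v' c' s"
    using assms(2) unfolding lead_def by blast
  show ?thesis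
    by (rule leadI[where c = "\<lambda>m. c m + c' m"])
      (simp only: distrib_left c c' sum.distrib, simp only: add_ac)
qed

lemma lead_zero [intro]: "lead n 0 0 (\<lambda>_. 0)"
  unfolding lead_def by (rule exI[of _ "\<lambda>_. 0"]) simp

lemma lead_sum:
  "(\<And>x. x \<in> A \<Longrightarrow> lead n (u x) (v x) (h x)) \<Longrightarrow>
    lead n (\<Sum>x\<in>A. u x) (\<Sum>x\<in>A. v x) (\<lambda>s. \<Sum>x\<in>A. h x s)"
  by (induction A rule: infinite_finite_induct) (auto intro: lead_add)

lemma lead_raise:
  assumes "lead n u v h"
  shows "lead (Suc n) 0 u h"
proof -
  obtain c where c: "\<And>s. of_nat s * h s =
    lead_poly n u v c s"
    using assms(1) unfolding lead_def by blast
  show ?thesis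
    by (rule leadI[where c = "c(n := v)"]) (simp add: c algebra_simps)
qed

lemma lead_raise_zero: "lead n 0 0 h \<Longrightarrow> lead (n + m) 0 0 h"
  by (induction m) (auto dest: lead_raise)

text \<open>
  A polynomial vanishing at all natural numbers has vanishing coefficients.
\<close>

lemma lead_unique:
  assumes "lead n u v h" "lead n u' v' h"
  shows "v = v'"
proof -
  have "lead n (u + (- 1) * u') (v + (- 1) * v') (\<lambda>s. h s + (- 1) * h s)"
    by (intro lead_add lead_mult assms)
  then obtain c where c: "\<And>s. 0 = of_nat (s ^ (n + 1)) * (u - u') + of_nat (s ^ n) * (v - v') + (\<Sum>m<n. of_nat (s ^ m) * c m)"
    unfolding lead_def by auto
  have "coef (v - v') \<kappa> = 0" for \<kappa>
  proof (rule ccontr)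
    assume nz: "coef (v - v') \<kappa> \<noteq> 0"
    define d where "d m = (if m < n then coef (c m) \<kappa> else if m = n then coef (v - v') \<kappa> else coef (u - u') \<kappa>)" for m
    have "(\<Sum>m\<le>Suc n. d m * of_nat s ^ m) = 0" for s
    proof -
      have "(\<Sum>m\<le>Suc n. d m * of_nat s ^ m) =
        coef (of_nat (s ^ (n + 1)) * (u - u') + of_nat (s ^ n) * (v - v') + (\<Sum>m<n. of_nat (s ^ m) * c m)) \<kappa>"
        unfolding coef_simps(3) coef_of_nat_mult coef_sum
        by (simp add: d_def algebra_simps flip: lessThan_Suc_atMost)
      then show ?thesis by (simp only: c[symmetric] coef_simps(1))
    qed
    then have "range of_nat \<subseteq> {z::complex. (\<Sum>m\<le>Suc n. d m * z ^ m) = 0}" by auto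
    moreover have "finite {z::complex. (\<Sum>m\<le>Suc n. d m * z ^ m) = 0}"
      using nz by (intro Transcendental.polyfun_rootbound[where c = d and k = n, THEN conjunct1]) (auto simp: d_def)
    ultimately have "finite (range (of_nat :: nat \<Rightarrow> complex))" by (rule finite_subset)
    then show False using range_inj_infinite[OF inj_of_nat] by blast
  qed
  then show ?thesis by (intro mfps_eqI) simp
qed

text \<open>
  The operator \<open>D\<^sub>i + s w\<close> sends the pair of leading coefficients \<open>(u, v)\<close> to \<open>(w u, w v + D\<^sub>i u)\<close>.
\<close>

lemma lead_step:
  assumes "lead n u v h"
  shows "lead (Suc n) (of_nat w * u) (of_nat w * v + Der T i u) (\<lambda>s. Der T i (h s) + of_nat (s * w) * h s)"
proof -
  obtain c where c: "\<And>s. of_nat s * h s =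
    lead_poly n u v c s"
    using assms(1) unfolding lead_def by blast
  define c' where "c' m = (if m = n then Der T i v else Der T i (c m)) + (if m = 0 then 0 else of_nat w * c (m - 1))" for m
  have "of_nat s * (Der T i (h s) + of_nat (s * w) * h s) =
    of_nat (s ^ (Suc n + 1)) * (of_nat w * u) + of_nat (s ^ Suc n) * (of_nat w * v + Der T i u) +
      (\<Sum>m<Suc n. of_nat (s ^ m) * c' m)" for s
  proof -
    have "of_nat s * (Der T i (h s) + of_nat (s * w) * h s) =
      Der T i (of_nat s * h s) + of_nat (s * w) * (of_nat s * h s)"
      by (simp add: algebra_simps)
    also have "Der T i (of_nat s * h s) = of_nat (s ^ (n + 1)) * Der T i u + of_nat (s ^ n) * Der T i v
        + (\<Sum>m<n. of_nat (s ^ m) * Der T i (c m))"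
      unfolding c by (simp only: Der_simps Der_sum)
    also have "\<dots> = of_nat (s ^ (n + 1)) * Der T i u
        + (\<Sum>m<Suc n. of_nat (s ^ m) * (if m = n then Der T i v else Der T i (c m)))"
      by simp
    also have "of_nat (s * w) * (of_nat s * h s) = of_nat (s ^ (Suc n + 1)) * (of_nat w * u)
        + of_nat (s ^ Suc n) * (of_nat w * v) + (\<Sum>m<n. of_nat (s ^ Suc m) * (of_nat w * c m))"
      unfolding c by (simp add: algebra_simps sum_distrib_left)
    also have "(\<Sum>m<n. of_nat (s ^ Suc m) * (of_nat w * c m)) =
      (\<Sum>m<Suc n. of_nat (s ^ m) * (if m = 0 then 0 else of_nat w * c (m - 1)))"
      by (simp only: sum.lessThan_Suc_shift) simp
    finally show ?thesis
      by (simp only: c'_def distrib_left sum.distrib add_ac Suc_eq_plus1)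
  qed
  then show ?thesis by (rule leadI)
qed

lemma lead_funpow:
  assumes "lead n u v h"
  shows "lead (n + m) (of_nat (w ^ m) * u) (of_nat (w ^ m) * v + of_nat (m * w ^ (m - 1)) * Der T i u)
    (\<lambda>s. ((\<lambda>x. Der T i x + of_nat (s * w) * x) ^^ m) (h s))"
proof (induction m)
  case 0
  then show ?case using assms by simp
next
  case (Suc m)
  have "of_nat w * (of_nat (w ^ m) * v + of_nat (m * w ^ (m - 1)) * Der T i u) + Der T i (of_nat (w ^ m) * u) =
    of_nat (w ^ Suc m) * v + of_nat (Suc m * w ^ (Suc m - 1)) * Der T i u"
    unfolding Der_simps(5) by (cases m) (simp_all add: algebra_simps)
  then show ?case
    using lead_step[OF Suc, of w T i] by (simp add: algebra_simps)
qed

definition npw :: "('k::finite \<Rightarrow> nat) \<Rightarrow> ('k \<Rightarrow> nat) \<Rightarrow> nat"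
  where "npw \<omega> \<kappa> = (\<Prod>i\<in>UNIV. \<omega> i ^ \<kappa> i)"

text \<open>
  The derivative of the monomial \<open>\<omega>\<^sup>\<kappa>\<close> with respect to \<open>\<omega>\<^sub>i\<close>.
\<close>

definition dnpw :: "'k \<Rightarrow> ('k::finite \<Rightarrow> nat) \<Rightarrow> ('k \<Rightarrow> nat) \<Rightarrow> nat"
  where "dnpw i \<omega> \<kappa> = \<kappa> i * \<omega> i ^ (\<kappa> i - 1) * (\<Prod>j\<in>UNIV-{i}. \<omega> j ^ \<kappa> j)"

lemma lead_foldr:
  assumes "lead n u v h" "distinct L"
  shows "lead (n + (\<Sum>i\<in>set L. \<kappa> i)) (of_nat (\<Prod>i\<in>set L. \<omega> i ^ \<kappa> i) * u)
    (of_nat (\<Prod>i\<in>set L. \<omega> i ^ \<kappa> i) * v +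
      (\<Sum>i\<in>set L. of_nat (\<kappa> i * \<omega> i ^ (\<kappa> i - 1) * (\<Prod>j\<in>set L - {i}. \<omega> j ^ \<kappa> j)) * Der T i u))
    (\<lambda>s. foldr (\<lambda>i g. (shifted T (\<lambda>i. s * \<omega> i) i ^^ \<kappa> i) \<circ> g) L id (h s))"
  using assms(2)
proof (induction L)
  case Nil
  then show ?case using assms(1) by simp
next
  case (Cons i L)
  let ?p = "\<Prod>i\<in>set L. \<omega> i ^ \<kappa> i"
  let ?q = "\<lambda>l. of_nat (\<kappa> l * \<omega> l ^ (\<kappa> l - 1) * (\<Prod>j\<in>set L - {l}. \<omega> j ^ \<kappa> j)) * Der T l u"
  have i: "i \<notin> set L" using Cons.prems by simp
  have "of_nat (\<omega> i ^ \<kappa> i) * (of_nat ?p * v + (\<Sum>l\<in>set L. ?q l)) + of_nat (\<kappa> i * \<omega> i ^ (\<kappa> i - 1)) * Der T i (of_nat ?p * u)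
    = of_nat (\<Prod>j\<in>set (i # L). \<omega> j ^ \<kappa> j) * v +
      (\<Sum>l\<in>set (i # L). of_nat (\<kappa> l * \<omega> l ^ (\<kappa> l - 1) * (\<Prod>j\<in>set (i # L) - {l}. \<omega> j ^ \<kappa> j)) * Der T l u)"
  proof -
    let ?G = "\<lambda>l. of_nat (\<kappa> l * \<omega> l ^ (\<kappa> l - 1) * (\<Prod>j\<in>set (i # L) - {l}. \<omega> j ^ \<kappa> j)) * Der T l u"
    have "set (i # L) - {i} = set L" using i by auto
    then have Gi: "?G i = of_nat (\<kappa> i * \<omega> i ^ (\<kappa> i - 1)) * (of_nat ?p * Der T i u)"
      by (simp only: of_nat_mult mult.assoc)
    have prod: "(\<Prod>j\<in>set (i # L) - {l}. \<omega> j ^ \<kappa> j) = \<omega> i ^ \<kappa> i * (\<Prod>j\<in>set L - {l}. \<omega> j ^ \<kappa> j)" if "l \<in> set L" for l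
    proof -
      have "set (i # L) - {l} = insert i (set L - {l})" using i that by auto
      then show ?thesis using i by simp
    qed
    have "(\<Sum>l\<in>set L. ?G l) = (\<Sum>l\<in>set L. of_nat (\<omega> i ^ \<kappa> i) * ?q l)"
      by (rule sum.cong) (simp_all only: prod of_nat_mult mult_ac)
    moreover have "(\<Sum>l\<in>set (i # L). ?G l) = ?G i + (\<Sum>l\<in>set L. ?G l)"
      using i by (simp only: list.set(2)) (subst sum.insert, auto)
    moreover have "(\<Prod>j\<in>set (i # L). \<omega> j ^ \<kappa> j) = \<omega> i ^ \<kappa> i * ?p"
      using i by simp
    ultimately show ?thesis
      unfolding Gi Der_simps(5) by (simp only: of_nat_mult distrib_left sum_distrib_left add_ac mult_ac)
  qed
  then show ?case
    using lead_funpow[OF Cons.IH, of "\<kappa> i" "\<omega> i" T i] Cons.prems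
    by (simp add: shifted_def[abs_def] algebra_simps)
qed

lemma lead_Dpow:
  fixes \<kappa> :: "'k::{finite,linorder} \<Rightarrow> nat"
  assumes "lead n u v h"
  shows "lead (n + mi_size \<kappa>) (of_nat (npw \<omega> \<kappa>) * u)
    (of_nat (npw \<omega> \<kappa>) * v + (\<Sum>i\<in>UNIV. of_nat (dnpw i \<omega> \<kappa>) * Der T i u))
    (\<lambda>s. Dpow T (shifted T (\<lambda>i. s * \<omega> i)) \<kappa> (h s))"
proof -
  let ?L = "sorted_list_of_set T @ sorted_list_of_set (- T)"
  have L: "distinct ?L" "set ?L = UNIV" by auto
  have comp: "foldr (\<lambda>i g. (E i ^^ \<kappa> i) \<circ> g) xs g = foldr (\<lambda>i g. (E i ^^ \<kappa> i) \<circ> g) xs id \<circ> g"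
    for E :: "'k \<Rightarrow> 'k mfps \<Rightarrow> 'k mfps" and xs g
    by (induction xs) (auto simp: comp_assoc)
  have "Dpow T E \<kappa> f = foldr (\<lambda>i g. (E i ^^ \<kappa> i) \<circ> g) ?L id f" for E and f :: "'k mfps"
    unfolding Dpow_def opow_def foldr_append
    by (subst (3) comp) simp
  then show ?thesis
    using lead_foldr[OF assms L(1), of \<kappa> \<omega> T] unfolding L(2) by (simp add: mi_size_def npw_def dnpw_def)
qed

text \<open>
  The symbol \<open>\<Sum>\<^sub>\<kappa> a\<^sub>\<kappa> \<omega>\<^sup>\<kappa>\<close> at a covector \<open>\<omega>\<close> with natural coordinates, a series in the base variables;
  \<open>dsymb i\<close> is its derivative with respect to \<open>\<omega>\<^sub>i\<close>.
\<close>

definition symb :: "('k::finite \<Rightarrow> nat) set \<Rightarrow> (('k \<Rightarrow> nat) \<Rightarrow> 'k mfps) \<Rightarrow> ('k \<Rightarrow> nat) \<Rightarrow> 'k mfps"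
  where "symb K a \<omega> = (\<Sum>\<kappa>\<in>K. of_nat (npw \<omega> \<kappa>) * a \<kappa>)"

definition dsymb :: "'k \<Rightarrow> ('k::finite \<Rightarrow> nat) set \<Rightarrow> (('k \<Rightarrow> nat) \<Rightarrow> 'k mfps) \<Rightarrow> ('k \<Rightarrow> nat) \<Rightarrow> 'k mfps"
  where "dsymb i K a \<omega> = (\<Sum>\<kappa>\<in>K. of_nat (dnpw i \<omega> \<kappa>) * a \<kappa>)"

abbreviation "topdeg K k \<equiv> {\<kappa> \<in> K. mi_size \<kappa> = k}"
abbreviation "subdeg K k \<equiv> {\<kappa> \<in> K. Suc (mi_size \<kappa>) = k}"

text \<open>
  An operator of order at most \<open>k\<close> multiplies both leading coefficients by its principal symbol.  The
  second one also receives what the terms of order \<open>k - 1\<close> do to \<open>u\<close>, and one derivative \<open>D\<^sub>i\<close> falling on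
  \<open>u\<close>, weighted by the \<open>\<omega>\<^sub>i\<close>-derivative of the principal symbol.
\<close>

lemma lead_fop:
  fixes a :: "('k::{finite,linorder} \<Rightarrow> nat) \<Rightarrow> 'k mfps"
  assumes h: "lead n u v h" and fin: "finite K" and deg: "\<And>\<kappa>. \<kappa> \<in> K \<Longrightarrow> a \<kappa> \<noteq> 0 \<Longrightarrow> mi_size \<kappa> \<le> k"
  shows "lead (n + k) (symb (topdeg K k) a \<omega> * u)
    (symb (topdeg K k) a \<omega> * v + symb (subdeg K k) a \<omega> * u + (\<Sum>i\<in>UNIV. dsymb i (topdeg K k) a \<omega> * Der T i u))
    (\<lambda>s. fop T (shifted T (\<lambda>i. s * \<omega> i)) K a (h s))"
proof -
  let ?U = "\<lambda>\<kappa>. if mi_size \<kappa> = k then of_nat (npw \<omega> \<kappa>) * a \<kappa> * u else 0"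
  let ?V = "\<lambda>\<kappa>. (if mi_size \<kappa> = k then of_nat (npw \<omega> \<kappa>) * a \<kappa> * v + (\<Sum>i\<in>UNIV. of_nat (dnpw i \<omega> \<kappa>) * a \<kappa> * Der T i u) else 0)
    + (if Suc (mi_size \<kappa>) = k then of_nat (npw \<omega> \<kappa>) * a \<kappa> * u else 0)"
  have summand: "lead (n + k) (?U \<kappa>) (?V \<kappa>) (\<lambda>s. a \<kappa> * Dpow T (shifted T (\<lambda>i. s * \<omega> i)) \<kappa> (h s))" if "\<kappa> \<in> K" for \<kappa>
  proof -
    note L = lead_mult[OF lead_Dpow[OF h, of \<kappa> \<omega> T], of "a \<kappa>"]
    consider "a \<kappa> = 0" | "mi_size \<kappa> = k" | "Suc (mi_size \<kappa>) = k" | "Suc (Suc (mi_size \<kappa>)) \<le> k"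
      using deg[OF \<open>\<kappa> \<in> K\<close>] by linarith
    then show ?thesis
    proof cases
      case 1
      then show ?thesis by auto
    next
      case 2
      then show ?thesis using L by (simp add: algebra_simps sum_distrib_left)
    next
      case 3
      then show ?thesis using lead_raise[OF L] by (auto simp: algebra_simps)
    next
      case 4
      then obtain d where "k = Suc (Suc (mi_size \<kappa>)) + d" using le_Suc_ex by blast
      then show ?thesis using lead_raise_zero[OF lead_raise[OF lead_raise[OF L]], of d] by (simp add: algebra_simps)
    qed
  qed
  have "(\<Sum>\<kappa>\<in>K. ?U \<kappa>) = symb (topdeg K k) a \<omega> * u"
    unfolding symb_def sum_distrib_right by (rule sum.inter_filter[OF fin, symmetric])
  moreover have "(\<Sum>\<kappa>\<in>K. ?V \<kappa>) = symb (topdeg K k) a \<omega> * v + symb (subdeg K k) a \<omega> * u + (\<Sum>i\<in>UNIV. dsymb i (topdeg K k) a \<omega> * Der T i u)"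
  proof -
    have "(\<Sum>i\<in>UNIV. dsymb i (topdeg K k) a \<omega> * Der T i u) =
      (\<Sum>\<kappa>\<in>topdeg K k. \<Sum>i\<in>UNIV. of_nat (dnpw i \<omega> \<kappa>) * a \<kappa> * Der T i u)"
      unfolding dsymb_def sum_distrib_right by (rule sum.swap)
    then show ?thesis
      by (simp add: symb_def sum_distrib_right sum.distrib fin flip: sum.inter_filter)
  qed
  ultimately show ?thesis
    using lead_sum[of K "n + k" ?U ?V "\<lambda>\<kappa> s. a \<kappa> * Dpow T (shifted T (\<lambda>i. s * \<omega> i)) \<kappa> (h s)", OF summand]
    by (simp add: fop_def)
qed

text \<open>
  The second leading coefficients of the two products agree.  The principal symbol of \<open>A\<close> is scalar and
  commutes with the subprincipal symbol of \<open>B\<close>; by \<open>low\<close> the subprincipal symbol of \<open>A\<close> commutes with the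
  principal symbol of \<open>B\<close>; only the derivative terms remain.
\<close>

lemma poisson_bracket_zero:
  fixes A B :: "'m::finite \<Rightarrow> 'm \<Rightarrow> ('k::{finite,linorder} \<Rightarrow> nat) \<Rightarrow> 'k mfps"
  assumes fin: "finite K"
    and comm: "\<And>\<omega> i j. (mat_fop T (shifted T \<omega>) K A B i j 1) =
      mat_fop T (shifted T \<omega>) K B A i j 1"
    and degA: "\<And>i j \<kappa>. A i j \<kappa> \<noteq> 0 \<Longrightarrow> mi_size \<kappa> \<le> k" and degB: "\<And>i j \<kappa>. B i j \<kappa> \<noteq> 0 \<Longrightarrow> mi_size \<kappa> \<le> l"
    and scalar: "\<And>i j \<kappa>. mi_size \<kappa> = k \<Longrightarrow> A i j \<kappa> = (if i = j then a \<kappa> else 0)"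
    and low: "(\<exists>c. \<forall>i j \<kappa>. Suc (mi_size \<kappa>) = k \<longrightarrow> A i j \<kappa> = (if i = j then c \<kappa> else 0)) \<or>
      (\<exists>c. \<forall>i j \<kappa>. mi_size \<kappa> = l \<longrightarrow> B i j \<kappa> = (if i = j then c \<kappa> else 0))"
  shows "(\<Sum>\<nu>\<in>UNIV. dsymb \<nu> (topdeg K k) a \<omega> * Der T \<nu> (symb (topdeg K l) (B i j) \<omega>)) =
    (\<Sum>\<nu>\<in>UNIV. dsymb \<nu> (topdeg K l) (B i j) \<omega> * Der T \<nu> (symb (topdeg K k) a \<omega>))"
proof -
  have one: "lead 0 1 0 (\<lambda>_. 1)" unfolding lead_def by auto
  let ?a = "\<lambda>i j. symb (topdeg K k) (A i j) \<omega>" and ?a' = "\<lambda>i j. symb (subdeg K k) (A i j) \<omega>"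
  let ?b = "\<lambda>i j. symb (topdeg K l) (B i j) \<omega>" and ?b' = "\<lambda>i j. symb (subdeg K l) (B i j) \<omega>"
  have leadA: "lead k (?a i j) (?a' i j) (\<lambda>s. fop T (shifted T (\<lambda>i. s * \<omega> i)) K (A i j) 1)" for i j
    using lead_fop[OF one fin, of "A i j" k \<omega> T] degA by simp
  have leadB: "lead l (?b i j) (?b' i j) (\<lambda>s. fop T (shifted T (\<lambda>i. s * \<omega> i)) K (B i j) 1)" for i j
    using lead_fop[OF one fin, of "B i j" l \<omega> T] degB by simp
  have AB: "lead (l + k) (\<Sum>r\<in>UNIV. ?a i r * ?b r j)
    (\<Sum>r\<in>UNIV. ?a i r * ?b' r j + ?a' i r * ?b r j + (\<Sum>\<nu>\<in>UNIV. dsymb \<nu> (topdeg K k) (A i r) \<omega> * Der T \<nu> (?b r j)))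
    (\<lambda>s. \<Sum>r\<in>UNIV. fop T (shifted T (\<lambda>i. s * \<omega> i)) K (A i r) (fop T (shifted T (\<lambda>i. s * \<omega> i)) K (B r j) 1))"
    by (intro lead_sum lead_fop[OF leadB fin]) (rule degA)
  have BA: "lead (k + l) (\<Sum>r\<in>UNIV. ?b i r * ?a r j)
    (\<Sum>r\<in>UNIV. ?b i r * ?a' r j + ?b' i r * ?a r j + (\<Sum>\<nu>\<in>UNIV. dsymb \<nu> (topdeg K l) (B i r) \<omega> * Der T \<nu> (?a r j)))
    (\<lambda>s. \<Sum>r\<in>UNIV. fop T (shifted T (\<lambda>i. s * \<omega> i)) K (B i r) (fop T (shifted T (\<lambda>i. s * \<omega> i)) K (A r j) 1))"
    by (intro lead_sum lead_fop[OF leadA fin]) (rule degB)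
  have eq: "(\<Sum>r\<in>UNIV. ?a i r * ?b' r j + ?a' i r * ?b r j + (\<Sum>\<nu>\<in>UNIV. dsymb \<nu> (topdeg K k) (A i r) \<omega> * Der T \<nu> (?b r j)))
    = (\<Sum>r\<in>UNIV. ?b i r * ?a' r j + ?b' i r * ?a r j + (\<Sum>\<nu>\<in>UNIV. dsymb \<nu> (topdeg K l) (B i r) \<omega> * Der T \<nu> (?a r j)))"
    using AB BA unfolding comm add.commute[of k l] by (rule lead_unique)
  have symb_scalar: "symb S (X i j) \<omega> = (if i = j then symb S c \<omega> else 0)"
    if "\<And>\<kappa>. \<kappa> \<in> S \<Longrightarrow> X i j \<kappa> = (if i = j then c \<kappa> else 0)"
    for S c i j and X :: "'m \<Rightarrow> 'm \<Rightarrow> ('k \<Rightarrow> nat) \<Rightarrow> 'k mfps"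
    using that by (auto simp: symb_def)
  have dsym_scalar: "dsymb \<nu> (topdeg K k) (A i j) \<omega> = (if i = j then dsymb \<nu> (topdeg K k) a \<omega> else 0)" for i j \<nu>
    using scalar by (auto simp: dsymb_def)
  have a: "?a i j = (if i = j then symb (topdeg K k) a \<omega> else 0)" for i j
    by (rule symb_scalar) (use scalar in auto)
  have low': "(\<Sum>r\<in>UNIV. ?a' i r * ?b r j) = (\<Sum>r\<in>UNIV. ?b i r * ?a' r j)"
    using low
  proof
    assume "\<exists>c. \<forall>i j \<kappa>. Suc (mi_size \<kappa>) = k \<longrightarrow> A i j \<kappa> = (if i = j then c \<kappa> else 0)"
    then obtain c where c: "\<And>i j \<kappa>. Suc (mi_size \<kappa>) = k \<Longrightarrow> A i j \<kappa> = (if i = j then c \<kappa> else 0)" by blast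
    have "?a' i j = (if i = j then symb (subdeg K k) c \<omega> else 0)" for i j
      by (rule symb_scalar) (use c in auto)
    then show ?thesis
      by (simp add: if_distrib[of "\<lambda>x. x * _"] if_distrib[of "\<lambda>x. _ * x"] mult.commute cong: if_cong)
  next
    assume "\<exists>c. \<forall>i j \<kappa>. mi_size \<kappa> = l \<longrightarrow> B i j \<kappa> = (if i = j then c \<kappa> else 0)"
    then obtain c where c: "\<And>i j \<kappa>. mi_size \<kappa> = l \<Longrightarrow> B i j \<kappa> = (if i = j then c \<kappa> else 0)" by blast
    have "?b i j = (if i = j then symb (topdeg K l) c \<omega> else 0)" for i j
      by (rule symb_scalar) (use c in auto)
    then show ?thesis
      by (simp add: if_distrib[of "\<lambda>x. x * _"] if_distrib[of "\<lambda>x. _ * x"] mult.commute cong: if_cong)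
  qed
  have l1: "(\<Sum>r\<in>UNIV. ?a i r * ?b' r j) = symb (topdeg K k) a \<omega> * ?b' i j"
    by (simp add: a if_distrib[of "\<lambda>x. x * _"] cong: if_cong)
  have r1: "(\<Sum>r\<in>UNIV. ?b' i r * ?a r j) = symb (topdeg K k) a \<omega> * ?b' i j"
    by (simp add: a if_distrib[of "\<lambda>x. _ * x"] mult.commute cong: if_cong)
  have l3: "(\<Sum>r\<in>UNIV. \<Sum>\<nu>\<in>UNIV. dsymb \<nu> (topdeg K k) (A i r) \<omega> * Der T \<nu> (?b r j)) =
    (\<Sum>\<nu>\<in>UNIV. dsymb \<nu> (topdeg K k) a \<omega> * Der T \<nu> (?b i j))"
    by (subst sum.swap) (simp add: dsym_scalar if_distrib[of "\<lambda>x. x * _"] cong: if_cong)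
  have r3: "(\<Sum>r\<in>UNIV. \<Sum>\<nu>\<in>UNIV. dsymb \<nu> (topdeg K l) (B i r) \<omega> * Der T \<nu> (?a r j)) =
    (\<Sum>\<nu>\<in>UNIV. dsymb \<nu> (topdeg K l) (B i j) \<omega> * Der T \<nu> (symb (topdeg K k) a \<omega>))"
    by (subst sum.swap) (simp add: a if_distrib[of "\<lambda>x. _ * x"] if_distrib[of "Der T _"] cong: if_cong)
  show ?thesis
    using eq by (simp add: sum.distrib l1 r1 l3 r3 low')
qed

section \<open>From operators on functions to operators on Taylor series\<close>

lemma has_ps_theta:
  fixes p :: "'k::finite pt"
  assumes "p $ i = 0" "has_ps f p F"
  shows "has_ps (theta i f) p (var i * pd i F)"
proof -
  have "has_ps (\<lambda>q. of_real (q $ i) * partial_deriv i f q) p (var i * pd i F)"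
    by (intro has_ps_mult has_ps_coord has_ps_partial_deriv assms)
  then show ?thesis by (simp add: theta_def[abs_def])
qed

lemma has_ps_Dpow:
  fixes p :: "'k::{finite,linorder} pt"
  assumes "\<forall>i\<in>T. p $ i = 0" "has_ps f p F"
  shows "has_ps (op_power theta T \<kappa> (op_power partial_deriv (- T) \<kappa> f)) p (Dpow T (Der T) \<kappa> F)"
  unfolding Dpow_def op_power_eq_opow
  by (intro opow_rel[where R = "\<lambda>f F. has_ps f p F"])
    (use assms in \<open>auto simp: Der_def intro: has_ps_theta has_ps_partial_deriv\<close>)

lemma tay_zero [simp]: "tay p (\<lambda>_. 0) = 0"
  by (rule tay_eqI) (rule has_ps_zero)

lemma has_ps_op_apply:
  fixes p :: "'k::{finite,linorder} pt"
  assumes p: "\<forall>i\<in>T. p $ i = 0" and u: "has_ps u p U"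
    and K: "finite K" "{\<kappa>. a \<kappa> \<noteq> (\<lambda>_. 0)} \<subseteq> K" and a: "\<And>\<kappa>. ana (a \<kappa>) p"
  shows "has_ps (op_apply T a u) p (fop T (Der T) K (\<lambda>\<kappa>. tay p (a \<kappa>)) U)"
proof -
  have "has_ps (\<lambda>q. \<Sum>\<kappa>\<in>K. a \<kappa> q * op_power theta T \<kappa> (op_power partial_deriv (- T) \<kappa> u) q) p
    (fop T (Der T) K (\<lambda>\<kappa>. tay p (a \<kappa>)) U)"
    unfolding fop_def by (intro has_ps_sum has_ps_mult has_ps_Dpow ana_has_ps a p u)
  moreover have "op_apply T a u q = (\<Sum>\<kappa>\<in>K. a \<kappa> q * op_power theta T \<kappa> (op_power partial_deriv (- T) \<kappa> u) q)" for q
    unfolding op_apply_def by (rule sum.mono_neutral_left) (use K in \<open>auto simp: fun_eq_iff\<close>)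
  then have "op_apply T a u = (\<lambda>q. \<Sum>\<kappa>\<in>K. a \<kappa> q * op_power theta T \<kappa> (op_power partial_deriv (- T) \<kappa> u) q)"
    by (rule ext)
  ultimately show ?thesis by (simp only:)
qed

text \<open>
  The Taylor series at \<open>p\<close> of the coefficients of the \<open>(i, j)\<close> entry.
\<close>

definition taymat :: "'k pt \<Rightarrow> 'k::finite coeffs ^ 'm::finite ^ 'm \<Rightarrow> 'm \<Rightarrow> 'm \<Rightarrow> ('k \<Rightarrow> nat) \<Rightarrow> 'k mfps"
  where "taymat p P i j \<kappa> = tay p ((P $ i $ j) \<kappa>)"

lemma analytic_M_iff: "open M \<Longrightarrow> f \<in> analytic_M T M \<longleftrightarrow> (\<forall>p\<in>core T M. eventually (\<lambda>q. ana f q) (nhds p))"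
  by (simp add: analytic_M_def near_iff)

lemma analytic_M_ana: "open M \<Longrightarrow> f \<in> analytic_M T M \<Longrightarrow> p \<in> core T M \<Longrightarrow> ana f p"
  by (auto simp: analytic_M_iff dest: eventually_nhds_x_imp_x)

lemma D_tilde_ana:
  fixes P :: "'k::finite coeffs ^ 'm::finite ^ 'm"
  shows "open M \<Longrightarrow> P \<in> mat_over (D_tilde T M) \<Longrightarrow> p \<in> core T M \<Longrightarrow> ana ((P $ i $ j) \<kappa>) p"
  by (auto simp: mat_over_def D_tilde_def intro: analytic_M_ana)

definition supp :: "'k::finite coeffs ^ 'm::finite ^ 'm \<Rightarrow> ('k \<Rightarrow> nat) set"
  where "supp P = (\<Union>i. \<Union>j. {\<kappa>. (P $ i $ j) \<kappa> \<noteq> (\<lambda>_. 0)})"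

lemma supp_entry: "{\<kappa>. (P $ i $ j) \<kappa> \<noteq> (\<lambda>_. 0)} \<subseteq> supp P" for P :: "'k::finite coeffs ^ 'm::finite ^ 'm"
  by (auto simp: supp_def)

lemma finite_supp: "P \<in> mat_over (D_tilde T M) \<Longrightarrow> finite (supp P)"
  by (auto simp: supp_def mat_over_def D_tilde_def)

lemma formal_commute:
  fixes P Q :: "'k::{finite,linorder} coeffs ^ 'm::finite ^ 'm"
  assumes M: "open M" and P: "P \<in> mat_over (D_tilde T M)" and Q: "Q \<in> mat_over (D_tilde T M)"
    and comm: "op_commute T M P Q" and p: "p \<in> core T M"
    and K: "finite K" "supp P \<subseteq> K" "supp Q \<subseteq> K"
    and u: "u \<in> analytic_M T M" "has_ps u p U"
  shows "mat_fop T (Der T) K (taymat p P) (taymat p Q) i j U =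
    mat_fop T (Der T) K (taymat p Q) (taymat p P) i j U"
proof -
  have p0: "\<forall>i\<in>T. p $ i = 0" using p by (simp add: core_def)
  have mult: "has_ps (op_mult T X Y i j u) p
    (mat_fop T (Der T) K (taymat p X) (taymat p Y) i j U)"
    if "X \<in> mat_over (D_tilde T M)" "Y \<in> mat_over (D_tilde T M)" "supp X \<subseteq> K" "supp Y \<subseteq> K" for X Y
    unfolding op_mult_def[abs_def] taymat_def[abs_def]
    by (intro has_ps_sum has_ps_op_apply p0 u K D_tilde_ana[OF M _ p] that)
      (rule order_trans[OF supp_entry that(4)] order_trans[OF supp_entry that(3)])+
  have "eventually (\<lambda>q. op_mult T P Q i j u q = op_mult T Q P i j u q) (nhds p)"
    using comm u(1) p near_iff[OF M] unfolding op_commute_def by blast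
  then show ?thesis by (rule has_ps_unique[OF mult[OF P Q K(2,3)] mult[OF Q P K(3,2)]])
qed

definition expser :: "'k \<Rightarrow> 'k::finite mfps"
  where "expser i = MFPS (\<lambda>\<kappa>. if \<forall>j\<in>-{i}. \<kappa> j = 0 then 1 / fact (\<kappa> i) else 0)"

text \<open>
  Chosen such that \<open>D\<^sub>j\<close> multiplies it by \<open>1\<close> if \<open>i = j\<close> and kills it otherwise; \<open>expser i\<close> is the series
  of the exponential of the \<open>i\<close>-th coordinate.
\<close>

definition basevar :: "'k set \<Rightarrow> 'k \<Rightarrow> 'k::finite mfps"
  where "basevar T i = (if i \<in> T then var i else expser i)"

text \<open>
  The Taylor series of \<open>t\<^sup>\<omega> e\<^sup>\<omega>\<^sup>x\<close>, with \<open>x\<close> centred at \<open>p\<close>; the function itself is \<open>test_fun\<close>.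
\<close>

definition unit_test :: "'k set \<Rightarrow> ('k \<Rightarrow> nat) \<Rightarrow> 'k::finite mfps"
  where "unit_test T \<omega> = (\<Prod>i\<in>UNIV. basevar T i ^ \<omega> i)"

lemma Der_basevar: "Der T j (basevar T i) = (if i = j then basevar T i else 0)"
proof -
  have v: "pd j (var i) = (if i = j then 1 else 0)"
  proof (rule mfps_eqI)
    fix \<kappa> :: "'a \<Rightarrow> nat"
    have "\<kappa> + unit_mi j = unit_mi i \<longleftrightarrow> i = j \<and> \<kappa> = 0"
    proof
      assume h: "\<kappa> + unit_mi j = unit_mi i"
      from fun_cong[OF h, of j] have "i = j" by (cases "i = j") auto
      then show "i = j \<and> \<kappa> = 0" using h by simp
    qed auto
    then show "coef (pd j (var i)) \<kappa> = coef (if i = j then 1 else 0) \<kappa>"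
      by (auto simp: coef_pd var_def)
  qed
  have e: "pd j (expser i) = (if i = j then expser i else 0)"
  proof (rule mfps_eqI)
    fix \<kappa> :: "'a \<Rightarrow> nat"
    show "coef (pd j (expser i)) \<kappa> = coef (if i = j then expser i else 0) \<kappa>"
    proof (cases "i = j")
      case True
      then show ?thesis by (auto simp: coef_pd expser_def unit_mi_def simp del: of_nat_Suc)
    next
      case False
      then show ?thesis by (auto simp: coef_pd expser_def intro!: bexI[of _ j])
    qed
  qed
  show ?thesis using v e by (cases "i = j") (simp_all add: Der_def basevar_def)
qed

lemma Der_power: "Der T i (f ^ n) = of_nat n * f ^ (n - 1) * Der T i f"
proof (induction n)
  case (Suc n)
  then show ?case by (cases n) (simp_all add: Der_mult algebra_simps)
qed simp

lemma Der_unit_test: "Der T j (unit_test T \<omega>) = of_nat (\<omega> j) * unit_test T \<omega>"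
proof -
  have pow: "Der T j (basevar T i ^ n) = (if i = j then of_nat n * basevar T i ^ n else 0)" for i n
    unfolding Der_power Der_basevar by (cases n) (simp_all add: algebra_simps)
  have "Der T j (\<Prod>i\<in>A. basevar T i ^ \<omega> i) = (if j \<in> A then of_nat (\<omega> j) * (\<Prod>i\<in>A. basevar T i ^ \<omega> i) else 0)"
    if "finite A" for A
    using that by (induction A) (auto simp: Der_mult pow algebra_simps)
  from this[of UNIV] show ?thesis by (simp add: unit_test_def)
qed

text \<open>
  A series with nonzero constant term is not a zero divisor: compare coefficients in the order of
  increasing size.
\<close>

lemma mult_eq_0_unit:
  fixes e f :: "'k::finite mfps"
  assumes "coef e 0 \<noteq> 0" "e * f = 0"
  shows "f = 0"
proof (rule mfps_eqI)
  fix \<nu>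
  have "coef f \<nu> = 0"
  proof (induction "mi_size \<nu>" arbitrary: \<nu> rule: less_induct)
    case less
    have zero: "coef e \<kappa> * coef f \<mu> = 0" if "(\<kappa>, \<mu>) \<in> splits \<nu> - {(0, \<nu>)}" for \<kappa> \<mu>
    proof -
      have \<nu>: "\<nu> = \<kappa> + \<mu>" "\<kappa> \<noteq> 0" using that by (auto simp: splits_def)
      then obtain i where "\<kappa> i \<noteq> 0" by (auto simp: fun_eq_iff)
      then have "0 < (\<Sum>i\<in>UNIV. \<kappa> i)" by (intro sum_pos2[of _ i]) auto
      then have "mi_size \<mu> < mi_size \<nu>" unfolding \<nu> by (simp add: mi_size_def sum.distrib)
      then show ?thesis using less by simp
    qed
    have "(\<Sum>(\<kappa>, \<mu>)\<in>splits \<nu> - {(0, \<nu>)}. coef e \<kappa> * coef f \<mu>) = 0"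
    proof (intro sum.neutral ballI)
      fix x assume "x \<in> splits \<nu> - {(0, \<nu>)}"
      then show "(case x of (\<kappa>, \<mu>) \<Rightarrow> coef e \<kappa> * coef f \<mu>) = 0"
        using zero[of "fst x" "snd x"] by (simp only: prod.collapse case_prod_beta)
    qed
    moreover have "coef (e * f) \<nu> = coef e 0 * coef f \<nu> + (\<Sum>(\<kappa>, \<mu>)\<in>splits \<nu> - {(0, \<nu>)}. coef e \<kappa> * coef f \<mu>)"
      unfolding coef_mult by (subst sum.remove[of _ "(0, \<nu>)"]) (auto simp: splits_def[of \<nu>] finite_splits[unfolded splits_def])
    ultimately show ?case using assms by simp
  qed
  then show "coef f \<nu> = coef 0 \<nu>" by simp
qed

lemma unit_test_mult_eq_0: "unit_test T \<omega> * f = 0 \<Longrightarrow> f = 0"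
proof -
  have base: "basevar T i * g = 0 \<Longrightarrow> g = 0" for i g
  proof (cases "i \<in> T")
    case True
    then show "basevar T i * g = 0 \<Longrightarrow> g = 0" using var_mult_eq_0[of i g] by (simp add: basevar_def)
  next
    case False
    have "coef (expser i) 0 \<noteq> 0" by (simp add: expser_def)
    with False show "basevar T i * g = 0 \<Longrightarrow> g = 0"
      using mult_eq_0_unit[of "expser i" g] by (simp add: basevar_def)
  qed
  have pow: "basevar T i ^ n * g = 0 \<Longrightarrow> g = 0" for i n g
    by (induction n) (auto simp: mult.assoc dest: base)
  have "(\<Prod>i\<in>A. basevar T i ^ \<omega> i) * g = 0 \<Longrightarrow> g = 0" if "finite A" for A g
    using that by (induction A arbitrary: g) (auto simp: mult.assoc dest: pow)
  from this[of UNIV f] show "unit_test T \<omega> * f = 0 \<Longrightarrow> f = 0" by (simp add: unit_test_def)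
qed

definition test_fun :: "'k set \<Rightarrow> 'k pt \<Rightarrow> ('k \<Rightarrow> nat) \<Rightarrow> 'k::finite fn"
  where "test_fun T p \<omega> q = (\<Prod>i\<in>UNIV. (if i \<in> T then of_real (q $ i) else exp (of_real (q $ i - p $ i))) ^ \<omega> i)"

lemma has_ps_test_fun:
  fixes p :: "'k::finite pt"
  assumes "\<forall>i\<in>T. p $ i = 0"
  shows "has_ps (test_fun T p \<omega>) p (unit_test T \<omega>)"
proof -
  have "has_ps (\<lambda>q. if i \<in> T then of_real (q $ i) else exp (of_real (q $ i - p $ i))) p (basevar T i)" for i
    using assms has_ps_exp[of i p] by (cases "i \<in> T") (auto simp: basevar_def expser_def intro: has_ps_coord)
  then show ?thesis
    unfolding test_fun_def[abs_def] unit_test_def by (intro has_ps_prod has_ps_power)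
qed

lemma ana_test_fun: "ana (test_fun T p \<omega>) q"
proof -
  have "\<exists>F. has_ps (\<lambda>q. if i \<in> T then of_real (q $ i) else exp (of_real (q $ i - p $ i))) q F" for i
    using has_ps_coord'[of i q] ana_has_ps[OF ana_exp[of i "p $ i" q]] by (cases "i \<in> T") auto
  then obtain F where F: "\<And>i. has_ps (\<lambda>q. if i \<in> T then of_real (q $ i) else exp (of_real (q $ i - p $ i))) q (F i)"
    by metis
  show ?thesis
    unfolding test_fun_def[abs_def] by (rule has_ps_ana, rule has_ps_prod, rule has_ps_power, rule F)
qed

lemma Dpow_unit_test: "Dpow T (Der T) \<kappa> (unit_test T \<omega> * f) = unit_test T \<omega> * Dpow T (shifted T \<omega>) \<kappa> f"
  unfolding Dpow_def
  by (intro opow_rel[where R = "\<lambda>f g. f = unit_test T \<omega> * g"])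
    (auto simp: shifted_def Der_mult Der_unit_test algebra_simps)

lemma fop_unit_test: "fop T (Der T) K a (unit_test T \<omega> * f) = unit_test T \<omega> * fop T (shifted T \<omega>) K a f"
  unfolding fop_def Dpow_unit_test by (simp add: sum_distrib_left mult_ac)

text \<open>
  Apply the commutation relation to \<open>t\<^sup>\<omega> e\<^sup>\<omega>\<^sup>x u\<close>; conjugation pulls this factor out, and it can be
  cancelled.
\<close>

lemma formal_commute_shifted:
  fixes P Q :: "'k::{finite,linorder} coeffs ^ 'm::finite ^ 'm"
  assumes M: "open M" and P: "P \<in> mat_over (D_tilde T M)" and Q: "Q \<in> mat_over (D_tilde T M)"
    and comm: "op_commute T M P Q" and p: "p \<in> core T M"
    and K: "finite K" "supp P \<subseteq> K" "supp Q \<subseteq> K"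
    and u: "u \<in> analytic_M T M" "has_ps u p U"
  shows "mat_fop T (shifted T \<omega>) K (taymat p P) (taymat p Q) i j U =
    mat_fop T (shifted T \<omega>) K (taymat p Q) (taymat p P) i j U"
    (is "?L = ?R")
proof -
  have p0: "\<forall>i\<in>T. p $ i = 0" using p by (simp add: core_def)
  have an: "(\<lambda>q. test_fun T p \<omega> q * u q) \<in> analytic_M T M"
    unfolding analytic_M_iff[OF M]
  proof
    fix p' assume "p' \<in> core T M"
    then have "eventually (\<lambda>q. ana u q) (nhds p')" using u(1) by (simp add: analytic_M_iff[OF M])
    then show "eventually (\<lambda>q. ana (\<lambda>q. test_fun T p \<omega> q * u q) q) (nhds p')"
      by (rule eventually_mono)
        (rule has_ps_ana[OF has_ps_mult[OF ana_has_ps[OF ana_test_fun] ana_has_ps]])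
  qed
  have "unit_test T \<omega> * ?L = unit_test T \<omega> * ?R"
    using formal_commute[OF M P Q comm p K an has_ps_mult[OF has_ps_test_fun[OF p0] u(2)], of i j]
    by (simp only: fop_unit_test sum_distrib_left)
  then have "unit_test T \<omega> * (?L - ?R) = 0" by (simp add: algebra_simps)
  then have "?L - ?R = 0" by (rule unit_test_mult_eq_0)
  then show ?thesis by simp
qed

section \<open>Restriction to N\<close>

definition proj :: "'k set \<Rightarrow> 'k pt \<Rightarrow> 'k::finite pt"
  where "proj T q = (\<chi> i. if i \<in> T then 0 else q $ i)"

lemma proj_core: "p \<in> core T M \<Longrightarrow> proj T p = p"
  unfolding vec_eq_iff by (auto simp: proj_def core_def)

lemma dist_proj_le:
  assumes "p \<in> core T M"
  shows "dist p (proj T q) \<le> dist p q"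
  using assms unfolding dist_vec_def
  by (intro L2_set_mono) (auto simp: proj_def core_def dist_real_def)

lemma eventually_proj:
  assumes "p \<in> core T M" "eventually \<Phi> (nhds p)"
  shows "eventually (\<lambda>q. \<Phi> (proj T q)) (nhds p)"
proof -
  obtain d where d: "d > 0" "\<And>q. dist q p < d \<Longrightarrow> \<Phi> q"
    using assms(2) by (auto simp: eventually_nhds_metric)
  have "\<Phi> (proj T q)" if "dist q p < d" for q
    using d(2)[of "proj T q"] dist_proj_le[OF assms(1), of q] that by (simp add: dist_commute)
  then show ?thesis using d(1) by (auto simp: eventually_nhds_metric)
qed

lemma eventually_proj_core:
  assumes "open M" "p \<in> core T M"
  shows "eventually (\<lambda>q. proj T q \<in> core T M) (nhds p)"
proof -
  have "eventually (\<lambda>q. q \<in> M) (nhds p)"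
    using assms by (intro eventually_nhds_in_open) (auto simp: core_def)
  from eventually_proj[OF assms(2) this] show ?thesis
    by (rule eventually_mono) (auto simp: core_def proj_def)
qed

text \<open>
  Putting \<open>t = 0\<close>; by \<open>has_ps_proj\<close> this belongs to the restriction of a function to \<open>N\<close>, extended
  independently of \<open>t\<close>.
\<close>

definition rho :: "'k set \<Rightarrow> 'k::finite mfps \<Rightarrow> 'k mfps"
  where "rho T F = MFPS (\<lambda>\<kappa>. if \<forall>i\<in>T. \<kappa> i = 0 then coef F \<kappa> else 0)"

lemma coef_rho: "coef (rho T F) \<kappa> = (if \<forall>i\<in>T. \<kappa> i = 0 then coef F \<kappa> else 0)"
  by (simp add: rho_def)

lemma rho_simps [simp]: "rho T 0 = 0" "rho T (f + g) = rho T f + rho T g" "rho T (of_nat n * f) = of_nat n * rho T f"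
  by (auto intro!: mfps_eqI simp: coef_rho)

lemma rho_sum: "rho T (\<Sum>x\<in>A. f x) = (\<Sum>x\<in>A. rho T (f x))"
  by (induction A rule: infinite_finite_induct) auto

lemma rho_mult: "rho T (f * g) = rho T f * rho T g"
proof (rule mfps_eqI)
  fix \<nu> :: "'a \<Rightarrow> nat"
  have iff: "(\<forall>i\<in>T. \<nu> i = 0) \<longleftrightarrow> (\<forall>i\<in>T. \<kappa> i = 0) \<and> (\<forall>i\<in>T. \<mu> i = 0)" if "(\<kappa>, \<mu>) \<in> splits \<nu>" for \<kappa> \<mu>
    using that by (auto simp: splits_def)
  show "coef (rho T (f * g)) \<nu> = coef (rho T f * rho T g) \<nu>"
  proof (cases "\<forall>i\<in>T. \<nu> i = 0")
    case True
    then show ?thesis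
      unfolding coef_mult coef_rho using iff by (auto intro!: sum.cong)
  next
    case False
    have "(\<Sum>(\<kappa>, \<mu>)\<in>splits \<nu>. coef (rho T f) \<kappa> * coef (rho T g) \<mu>) = 0"
    proof (intro sum.neutral ballI)
      fix x assume "x \<in> splits \<nu>"
      then show "(case x of (\<kappa>, \<mu>) \<Rightarrow> coef (rho T f) \<kappa> * coef (rho T g) \<mu>) = 0"
        using False iff[of "fst x" "snd x"] by (auto simp: coef_rho case_prod_beta)
    qed
    then show ?thesis using False by (simp only: coef_mult coef_rho if_False)
  qed
qed

lemma rho_var_mult: "i \<in> T \<Longrightarrow> rho T (var i * f) = 0"
  by (rule mfps_eqI) (auto simp: coef_rho coef_var_mult)

lemma rho_pd: "i \<notin> T \<Longrightarrow> rho T (pd i f) = pd i (rho T f)"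
proof (rule mfps_eqI)
  fix \<kappa> :: "'a \<Rightarrow> nat" assume "i \<notin> T"
  then have "(\<forall>j\<in>T. (\<kappa> + unit_mi i) j = 0) \<longleftrightarrow> (\<forall>j\<in>T. \<kappa> j = 0)"
    by (auto simp: unit_mi_def)
  then show "coef (rho T (pd i f)) \<kappa> = coef (pd i (rho T f)) \<kappa>"
    by (simp only: coef_rho coef_pd) simp
qed

definition Xpow :: "'k set \<Rightarrow> ('k::{finite,linorder} \<Rightarrow> nat) \<Rightarrow> 'k mfps \<Rightarrow> 'k mfps"
  where "Xpow T \<kappa> = opow pd (- T) \<kappa>"

lemma Xpow_zero: "Xpow T \<kappa> 0 = 0"
  unfolding Xpow_def by (rule opow_rel[where R = "\<lambda>f g. f = 0" and g = 0 and E' = pd]) auto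

lemma Xpow_add: "Xpow T \<kappa> (f + g) = Xpow T \<kappa> f + Xpow T \<kappa> g"
proof -
  have pow: "(pd i ^^ n) (x + y) = (pd i ^^ n) x + (pd i ^^ n) y" for i n and x y :: "'a mfps"
    by (induction n) auto
  have "foldr (\<lambda>i g. (pd i ^^ \<kappa> i) \<circ> g) L id (f + g) =
    foldr (\<lambda>i g. (pd i ^^ \<kappa> i) \<circ> g) L id f + foldr (\<lambda>i g. (pd i ^^ \<kappa> i) \<circ> g) L id g" for L
    by (induction L) (simp_all add: pow)
  then show ?thesis by (simp add: Xpow_def opow_def)
qed

lemma Xpow_sum: "Xpow T \<kappa> (\<Sum>x\<in>A. f x) = (\<Sum>x\<in>A. Xpow T \<kappa> (f x))"
  by (induction A rule: infinite_finite_induct) (auto simp: Xpow_zero Xpow_add)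

lemma Xpow_of_nat: "Xpow T \<kappa> (of_nat n * f) = of_nat n * Xpow T \<kappa> f"
  unfolding Xpow_def by (rule opow_rel[where R = "\<lambda>x y. x = of_nat n * y"]) auto

definition npwT :: "'k set \<Rightarrow> ('k::finite \<Rightarrow> nat) \<Rightarrow> ('k \<Rightarrow> nat) \<Rightarrow> nat"
  where "npwT T \<omega> \<kappa> = (\<Prod>i\<in>T. \<omega> i ^ \<kappa> i)"

lemma opow_scalar: "opow (\<lambda>i y. of_nat (\<omega> i) * y) T \<kappa> f = of_nat (npwT T \<omega> \<kappa>) * (f :: 'k::{finite,linorder} mfps)"
proof -
  have pow: "((\<lambda>y. of_nat w * y) ^^ n) g = of_nat (w ^ n) * g" for w n and g :: "'k mfps"
    by (induction n) (auto simp: mult.assoc)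
  have "foldr (\<lambda>i g. ((\<lambda>y. of_nat (\<omega> i) * y) ^^ \<kappa> i) \<circ> g) L id f = of_nat (\<Prod>i\<in>set L. \<omega> i ^ \<kappa> i) * f"
    if "distinct L" for L
    using that by (induction L) (auto simp: pow mult.assoc)
  from this[of "sorted_list_of_set T"] show ?thesis
    by (simp add: opow_def npwT_def)
qed

text \<open>
  Since \<open>\<theta>\<^sub>i f\<close> vanishes for \<open>t = 0\<close>, only \<open>\<omega>\<^sub>i\<close> is left of \<open>\<theta>\<^sub>i + \<omega>\<^sub>i\<close>.
\<close>

lemma rho_Dpow_shifted:
  assumes "\<forall>i\<in>-T. \<omega> i = 0"
  shows "rho T (Dpow T (shifted T \<omega>) \<kappa> f) = of_nat (npwT T \<omega> \<kappa>) * Xpow T \<kappa> (rho T f)"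
proof -
  have "rho T (opow (shifted T \<omega>) (- T) \<kappa> f) = Xpow T \<kappa> (rho T f)"
    unfolding Xpow_def
    by (rule opow_rel[where R = "\<lambda>x y. rho T x = y"]) (use assms in \<open>auto simp: shifted_def Der_def rho_pd\<close>)
  moreover have "rho T (opow (shifted T \<omega>) T \<kappa> g) = opow (\<lambda>i y. of_nat (\<omega> i) * y) T \<kappa> (rho T g)" for g
    by (rule opow_rel[where R = "\<lambda>x y. rho T x = y"]) (auto simp: shifted_def Der_def rho_var_mult)
  ultimately show ?thesis by (simp add: Dpow_def opow_scalar)
qed

lemma rho_fop_shifted:
  assumes "\<forall>i\<in>-T. \<omega> i = 0"
  shows "rho T (fop T (shifted T \<omega>) K a f) = (\<Sum>\<kappa>\<in>K. of_nat (npwT T \<omega> \<kappa>) * (rho T (a \<kappa>) * Xpow T \<kappa> (rho T f)))"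
  unfolding fop_def rho_sum rho_mult rho_Dpow_shifted[OF assms] by (simp add: mult_ac)

lemma rho_fop_fop:
  assumes "\<forall>i\<in>-T. \<omega> i = 0"
  shows "rho T (fop T (shifted T \<omega>) K a (fop T (shifted T \<omega>) K b f)) =
    (\<Sum>\<kappa>\<in>K. \<Sum>\<mu>\<in>K. of_nat (npwT T \<omega> (\<kappa> + \<mu>)) * (rho T (a \<kappa>) * Xpow T \<kappa> (rho T (b \<mu>) * Xpow T \<mu> (rho T f))))"
  unfolding rho_fop_shifted[OF assms] Xpow_sum Xpow_of_nat
  by (simp add: sum_distrib_left npwT_def power_add prod.distrib mult_ac)

text \<open>
  The sum is a polynomial in the coordinates \<open>\<omega>\<^sub>i\<close> with \<open>i \<in> T\<close> that vanishes at all natural values, so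
  the coefficient of each monomial \<open>\<omega>\<^sup>\<gamma>\<close> vanishes.
\<close>

lemma sum_npwT_zero:
  fixes z :: "('k::finite \<Rightarrow> nat) \<times> ('k \<Rightarrow> nat) \<Rightarrow> complex"
  assumes "finite S" and zero: "\<And>\<omega>. (\<forall>i\<in>-T. \<omega> i = 0) \<Longrightarrow> (\<Sum>x\<in>S. of_nat (npwT T \<omega> (fst x + snd x)) * z x) = 0"
    and \<gamma>: "\<forall>i\<in>-T. \<gamma> i = 0"
  shows "(\<Sum>x\<in>{x\<in>S. \<forall>i\<in>T. fst x i + snd x i = \<gamma> i}. z x) = 0"
proof -
  define res where "res x = (\<lambda>i. if i \<in> T then fst x i + snd x i else 0)" for x :: "('k \<Rightarrow> nat) \<times> ('k \<Rightarrow> nat)"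
  define c where "c g = (\<Sum>x\<in>{x\<in>S. res x = g}. z x)" for g
  have "(\<Sum>g\<in>res ` S. c g * cpow (\<lambda>i. of_nat (\<omega> i)) g) = 0" for \<omega> :: "'k \<Rightarrow> nat"
  proof -
    have cp: "cpow (\<lambda>i. of_nat (\<omega> i)) (res x) = of_nat (npwT T (\<lambda>i. if i \<in> T then \<omega> i else 0) (fst x + snd x))" for x
    proof -
      have "cpow (\<lambda>i. of_nat (\<omega> i)) (res x) = (\<Prod>i\<in>T. of_nat (\<omega> i) ^ res x i)"
        unfolding cpow_def by (rule prod.mono_neutral_right) (auto simp: res_def)
      also have "\<dots> = of_nat (npwT T (\<lambda>i. if i \<in> T then \<omega> i else 0) (fst x + snd x))"
        by (simp add: npwT_def res_def)
      finally show ?thesis .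
    qed
    have "(\<Sum>g\<in>res ` S. c g * cpow (\<lambda>i. of_nat (\<omega> i)) g) =
      (\<Sum>g\<in>res ` S. \<Sum>x\<in>{x\<in>S. res x = g}. z x * cpow (\<lambda>i. of_nat (\<omega> i)) (res x))"
      unfolding c_def sum_distrib_right by (intro sum.cong) auto
    also have "\<dots> = (\<Sum>x\<in>S. z x * cpow (\<lambda>i. of_nat (\<omega> i)) (res x))"
      by (rule sum.image_gen[OF assms(1), symmetric])
    also have "\<dots> = (\<Sum>x\<in>S. of_nat (npwT T (\<lambda>i. if i \<in> T then \<omega> i else 0) (fst x + snd x)) * z x)"
      by (simp add: cp mult.commute)
    also have "\<dots> = 0" by (rule zero) auto
    finally show ?thesis .
  qed
  then have c0: "g \<in> res ` S \<Longrightarrow> c g = 0" for g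
    using cpow_coeffs_zero[of "res ` S" c g] assms(1) by blast
  have "{x\<in>S. \<forall>i\<in>T. fst x i + snd x i = \<gamma> i} = {x\<in>S. res x = \<gamma>}"
    using \<gamma> by (auto simp: res_def fun_eq_iff)
  then have "(\<Sum>x\<in>{x\<in>S. \<forall>i\<in>T. fst x i + snd x i = \<gamma> i}. z x) = c \<gamma>"
    by (simp add: c_def)
  also have "c \<gamma> = 0"
  proof (cases "\<gamma> \<in> res ` S")
    case False
    then have "{x\<in>S. res x = \<gamma>} = {}" by blast
    then show ?thesis by (simp only: c_def sum.empty)
  qed (rule c0)
  finally show ?thesis .
qed

lemma has_ps_proj:
  assumes p: "p \<in> core T M" and f: "has_ps f p F"
  shows "has_ps (\<lambda>q. f (proj T q)) p (rho T F)"
proof -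
  obtain r where r: "r > 0" "\<And>q. dist p q < r \<Longrightarrow> ps_sums F p q (f q)"
    using f by (rule has_psE) blast
  show ?thesis
  proof (rule has_psI[OF r(1)])
    fix q assume "dist p q < r"
    then have "ps_sums F p (proj T q) (f (proj T q))"
      using dist_proj_le[OF p, of q] by (intro r(2)) simp
    moreover have "coef F \<kappa> * cpow (offset p (proj T q)) \<kappa> = coef (rho T F) \<kappa> * cpow (offset p q) \<kappa>" for \<kappa>
    proof (cases "\<forall>i\<in>T. \<kappa> i = 0")
      case True
      then have "cpow (offset p (proj T q)) \<kappa> = cpow (offset p q) \<kappa>"
        unfolding cpow_def by (intro prod.cong) (auto simp: offset_def proj_def)
      then show ?thesis using True by (simp add: coef_rho)
    next
      case False
      then obtain i where "i \<in> T" "\<kappa> i \<noteq> 0" by auto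
      then have "offset p (proj T q) i ^ \<kappa> i = 0"
        using p by (simp add: offset_def proj_def core_def power_0_left)
      then have "cpow (offset p (proj T q)) \<kappa> = 0"
        unfolding cpow_def by (intro prod_zero) auto
      then show ?thesis using False by (simp only: coef_rho if_False) simp
    qed
    ultimately show "ps_sums (rho T F) p q (f (proj T q))"
      by simp
  qed
qed

text \<open>
  Extended independently of \<open>t\<close>, a function that is analytic on \<open>N\<close> has the same series, now in all
  variables.
\<close>

lemma ana_slice_proj:
  fixes q :: "'k::finite pt"
  assumes "real_analytic_at (- T) u (proj T q)"
  shows "ana (\<lambda>q. u (proj T q)) q"
proof -
  obtain r c where r: "r > 0" and c: "\<And>q'. q' \<in> ball (proj T q) r \<Longrightarrow> (\<forall>i\<in>T. q' $ i = proj T q $ i) \<Longrightarrow>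
      ((\<lambda>\<kappa>. c \<kappa> * (\<Prod>i\<in>-T. of_real (q' $ i - proj T q $ i) ^ \<kappa> i)) has_sum u q') {\<kappa>. \<forall>i\<in>T. \<kappa> i = 0}"
    using assms unfolding real_analytic_at_def by (simp del: mem_ball) blast
  have "has_ps (\<lambda>q. u (proj T q)) q (MFPS (\<lambda>\<kappa>. if \<forall>i\<in>T. \<kappa> i = 0 then c \<kappa> else 0))" (is "has_ps _ _ ?F")
  proof (rule has_psI[OF r])
    fix q' assume "dist q q' < r"
    moreover have "dist (proj T q) (proj T q') \<le> dist q q'"
      unfolding dist_vec_def by (intro L2_set_mono) (auto simp: proj_def dist_real_def)
    ultimately have "((\<lambda>\<kappa>. c \<kappa> * (\<Prod>i\<in>-T. of_real (proj T q' $ i - proj T q $ i) ^ \<kappa> i)) has_sum u (proj T q')) {\<kappa>. \<forall>i\<in>T. \<kappa> i = 0}"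
      by (intro c) (auto simp: proj_def)
    then show "((\<lambda>\<kappa>. coef ?F \<kappa> * cpow (offset q q') \<kappa>) has_sum u (proj T q')) UNIV"
    proof (rule has_sum_cong_neutral[THEN iffD1, rotated -1])
      fix \<kappa> :: "'k \<Rightarrow> nat" assume "\<kappa> \<in> {\<kappa>. \<forall>i\<in>T. \<kappa> i = 0} \<inter> UNIV"
      then have k: "\<forall>i\<in>T. \<kappa> i = 0" by simp
      have "cpow (offset q q') \<kappa> = (\<Prod>i\<in>-T. offset q q' i ^ \<kappa> i)"
        unfolding cpow_def by (rule prod.mono_neutral_right) (use k in auto)
      also have "\<dots> = (\<Prod>i\<in>-T. of_real (proj T q' $ i - proj T q $ i) ^ \<kappa> i)"
        by (intro prod.cong) (auto simp: proj_def offset_def)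
      finally show "c \<kappa> * (\<Prod>i\<in>-T. of_real (proj T q' $ i - proj T q $ i) ^ \<kappa> i) = coef ?F \<kappa> * cpow (offset q q') \<kappa>"
        using k by simp
    qed auto
  qed
  then show ?thesis by (rule has_ps_ana)
qed

lemma analytic_N_proj:
  assumes "open M" "u \<in> analytic_N T M"
  shows "(\<lambda>q. u (proj T q)) \<in> analytic_M T M"
  unfolding analytic_M_iff[OF assms(1)]
proof
  fix p assume "p \<in> core T M"
  from eventually_proj_core[OF assms(1) this] show "eventually (\<lambda>q. ana (\<lambda>q. u (proj T q)) q) (nhds p)"
    by (rule eventually_mono) (use assms(2) in \<open>auto simp: analytic_N_def intro: ana_slice_proj\<close>)
qed

lemma partial_deriv_proj:
  fixes u :: "'k::finite fn"
  assumes "i \<notin> T"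
  shows "partial_deriv i (\<lambda>q. u (proj T q)) = (\<lambda>q. partial_deriv i u (proj T q))"
proof
  fix q
  have "proj T (q + s *\<^sub>R axis i 1) = proj T q + s *\<^sub>R axis i 1" for s
    using assms by (auto simp: proj_def vec_eq_iff axis_def)
  then show "partial_deriv i (\<lambda>q. u (proj T q)) q = partial_deriv i u (proj T q)"
    by (simp add: partial_deriv_def)
qed

lemma has_ps_Xpow_proj:
  assumes "has_ps (\<lambda>q. u (proj T q)) p U"
  shows "has_ps (\<lambda>q. op_power partial_deriv (- T) \<kappa> u (proj T q)) p (Xpow T \<kappa> U)"
  unfolding Xpow_def op_power_eq_opow
  by (rule opow_rel[where R = "\<lambda>f F. has_ps (\<lambda>q. f (proj T q)) p F"])
    (use assms in \<open>auto simp flip: partial_deriv_proj intro: has_ps_partial_deriv\<close>)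

lemma has_ps_xi_coeff:
  fixes P :: "'k::{finite,linorder} coeffs ^ 'm::finite ^ 'm"
  assumes M: "open M" and P: "P \<in> mat_over (D_tilde T M)" and p: "p \<in> core T M"
    and K: "finite K" "supp P \<subseteq> K" and u: "has_ps (\<lambda>q. u (proj T q)) p U"
  shows "has_ps (\<lambda>q. xi_coeff T (sigma_star T M P $ i $ j) \<alpha> u (proj T q)) p
    (\<Sum>\<kappa>\<in>{\<kappa>\<in>K. \<forall>i\<in>T. \<kappa> i = \<alpha> i}. rho T (taymat p P i j \<kappa>) * Xpow T \<kappa> U)"
proof -
  let ?b = "sigma_star T M P $ i $ j"
  have b: "?b \<kappa> x = (if x \<in> core T M then (P $ i $ j) \<kappa> x else 0)" for \<kappa> x
    by (simp add: sigma_star_def)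
  have "xi_coeff T ?b \<alpha> u x = (\<Sum>\<kappa>\<in>{\<kappa>\<in>K. \<forall>i\<in>T. \<kappa> i = \<alpha> i}. ?b \<kappa> x * op_power partial_deriv (- T) \<kappa> u x)" for x
    unfolding xi_coeff_def
  proof (rule sum.mono_neutral_left)
    have "(P $ i $ j) \<kappa> \<noteq> (\<lambda>_. 0)" if "?b \<kappa> \<noteq> (\<lambda>_. 0)" for \<kappa>
      using that b by (auto simp: fun_eq_iff split: if_splits)
    then show "{\<kappa>. ?b \<kappa> \<noteq> (\<lambda>_. 0) \<and> (\<forall>i\<in>T. \<kappa> i = \<alpha> i)} \<subseteq> {\<kappa>\<in>K. \<forall>i\<in>T. \<kappa> i = \<alpha> i}"
      using K(2) supp_entry[of P i j] by blast
  qed (use K in auto)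
  moreover have "has_ps (\<lambda>q. ?b \<kappa> (proj T q)) p (rho T (taymat p P i j \<kappa>))" for \<kappa>
  proof (rule has_ps_cong)
    show "has_ps (\<lambda>q. (P $ i $ j) \<kappa> (proj T q)) p (rho T (taymat p P i j \<kappa>))"
      unfolding taymat_def by (intro has_ps_proj[OF p] ana_has_ps D_tilde_ana[OF M P p])
    show "eventually (\<lambda>q. (P $ i $ j) \<kappa> (proj T q) = ?b \<kappa> (proj T q)) (nhds p)"
      by (rule eventually_mono[OF eventually_proj_core[OF M p]]) (simp add: b)
  qed
  ultimately show ?thesis
    by (simp only:) (intro has_ps_sum has_ps_mult has_ps_Xpow_proj u)
qed

text \<open>
  In terms of Taylor series, the coefficient of \<open>\<xi>\<^sup>\<gamma>\<close> in the product collects the pairs \<open>(\<kappa>, \<mu>)\<close> whose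
  components in the directions \<open>T\<close> add up to \<open>\<gamma>\<close>.
\<close>

lemma xi_mult_eq:
  fixes P Q :: "'k::{finite,linorder} coeffs ^ 'm::finite ^ 'm"
  assumes M: "open M" and P: "P \<in> mat_over (D_tilde T M)" and Q: "Q \<in> mat_over (D_tilde T M)"
    and p: "p \<in> core T M" and K: "finite K" "supp P \<subseteq> K" "supp Q \<subseteq> K"
    and u: "has_ps (\<lambda>q. u (proj T q)) p U" and \<gamma>: "\<forall>i\<in>-T. \<gamma> i = 0"
  shows "xi_mult T (sigma_star T M P) (sigma_star T M Q) \<gamma> i j u p =
    (\<Sum>x\<in>{x\<in>K\<times>K. \<forall>i\<in>T. fst x i + snd x i = \<gamma> i}. coef (\<Sum>r\<in>UNIV.
      rho T (taymat p P i r (fst x)) * Xpow T (fst x) (rho T (taymat p Q r j (snd x)) * Xpow T (snd x) U)) 0)"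
proof -
  let ?z = "\<lambda>r \<kappa> \<mu>. coef (rho T (taymat p P i r \<kappa>) * Xpow T \<kappa> (rho T (taymat p Q r j \<mu>) * Xpow T \<mu> U)) 0"
  let ?S = "\<lambda>\<alpha>. {\<kappa>\<in>K. \<forall>i\<in>T. \<kappa> i = \<alpha> i}"
  have "xi_coeff T (sigma_star T M P $ i $ r) \<alpha> (xi_coeff T (sigma_star T M Q $ r $ j) \<beta> u) p =
    (\<Sum>\<kappa>\<in>?S \<alpha>. \<Sum>\<mu>\<in>?S \<beta>. ?z r \<kappa> \<mu>)" for r \<alpha> \<beta>
  proof -
    note has_ps_at_center[OF has_ps_xi_coeff[OF M P p K(1,2) has_ps_xi_coeff[OF M Q p K(1,3) u]]]
    then show ?thesis by (simp add: proj_core[OF p] Xpow_sum sum_distrib_left)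
  qed
  then have "xi_mult T (sigma_star T M P) (sigma_star T M Q) \<gamma> i j u p =
    (\<Sum>r\<in>UNIV. \<Sum>\<alpha> | \<forall>\<nu>. \<alpha> \<nu> \<le> \<gamma> \<nu>. \<Sum>\<kappa>\<in>?S \<alpha>. \<Sum>\<mu>\<in>?S (\<lambda>\<nu>. \<gamma> \<nu> - \<alpha> \<nu>). ?z r \<kappa> \<mu>)"
    by (simp add: xi_mult_def)
  also have "\<dots> = (\<Sum>r\<in>UNIV. \<Sum>x\<in>{x\<in>K\<times>K. \<forall>i\<in>T. fst x i + snd x i = \<gamma> i}. ?z r (fst x) (snd x))"
  proof (rule sum.cong)
    fix r :: 'm
    let ?A = "{\<alpha>. \<forall>\<nu>. \<alpha> \<nu> \<le> \<gamma> \<nu>}"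
    have fin: "finite ?A" using finite_mi_le[of \<gamma>] by (simp add: le_fun_def)
    have "(\<Sum>\<alpha>\<in>?A. \<Sum>\<kappa>\<in>?S \<alpha>. \<Sum>\<mu>\<in>?S (\<lambda>\<nu>. \<gamma> \<nu> - \<alpha> \<nu>). ?z r \<kappa> \<mu>) =
      (\<Sum>y\<in>(SIGMA \<alpha>:?A. ?S \<alpha> \<times> ?S (\<lambda>\<nu>. \<gamma> \<nu> - \<alpha> \<nu>)). ?z r (fst (snd y)) (snd (snd y)))"
      using fin K(1) by (simp add: sum.Sigma sum.cartesian_product case_prod_beta)
    also have "\<dots> = (\<Sum>x\<in>{x\<in>K\<times>K. \<forall>i\<in>T. fst x i + snd x i = \<gamma> i}. ?z r (fst x) (snd x))"
    proof (rule sum.reindex_bij_witness[of _ "\<lambda>x. (\<lambda>i. if i \<in> T then fst x i else 0, x)" snd])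
      fix y assume y: "y \<in> (SIGMA \<alpha>:?A. ?S \<alpha> \<times> ?S (\<lambda>\<nu>. \<gamma> \<nu> - \<alpha> \<nu>))"
      have "(if i \<in> T then fst (snd y) i else 0) = fst y i" for i
      proof (cases "i \<in> T")
        case False
        then have "fst y i \<le> 0" using y \<gamma> by (auto dest!: spec[of _ i])
        then show ?thesis using False by simp
      qed (use y in auto)
      then show "(\<lambda>i. if i \<in> T then fst (snd y) i else 0, snd y) = y" by (simp add: prod_eq_iff)
    next
      fix x assume x: "x \<in> {x\<in>K\<times>K. \<forall>i\<in>T. fst x i + snd x i = \<gamma> i}"
      then have "fst x i \<le> \<gamma> i" "snd x i = \<gamma> i - fst x i" if "i \<in> T" for i
        using that by (auto dest!: bspec[of _ _ i])
      then show "(\<lambda>i. if i \<in> T then fst x i else 0, x) \<in> (SIGMA \<alpha>:?A. ?S \<alpha> \<times> ?S (\<lambda>\<nu>. \<gamma> \<nu> - \<alpha> \<nu>))"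
        using x by auto
    qed auto
    finally show "(\<Sum>\<alpha>\<in>?A. \<Sum>\<kappa>\<in>?S \<alpha>. \<Sum>\<mu>\<in>?S (\<lambda>\<nu>. \<gamma> \<nu> - \<alpha> \<nu>). ?z r \<kappa> \<mu>) =
      (\<Sum>x\<in>{x\<in>K\<times>K. \<forall>i\<in>T. fst x i + snd x i = \<gamma> i}. ?z r (fst x) (snd x))" .
  qed simp
  also have "\<dots> = (\<Sum>x\<in>{x\<in>K\<times>K. \<forall>i\<in>T. fst x i + snd x i = \<gamma> i}. \<Sum>r\<in>UNIV. ?z r (fst x) (snd x))"
    by (rule sum.swap)
  finally show ?thesis by simp
qed

text \<open>
  For \<open>\<omega>\<close> supported on \<open>T\<close>, the shifted commutation relation restricted to \<open>N\<close> is the relation between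
  the symbols \<open>\<sigma>\<^sub>*\<close> with \<open>\<xi> = \<omega>\<close>; it remains to compare the coefficients of the powers of \<open>\<omega>\<close>.
\<close>

lemma xi_commute_sigma_star:
  fixes P Q :: "'k::{finite,linorder} coeffs ^ 'm::finite ^ 'm"
  assumes M: "open M" and P: "P \<in> mat_over (D_tilde T M)" and Q: "Q \<in> mat_over (D_tilde T M)"
    and comm: "op_commute T M P Q"
  shows "xi_commute T M (sigma_star T M P) (sigma_star T M Q)"
  unfolding xi_commute_def
proof (intro allI impI ballI)
  fix \<gamma> :: "'k \<Rightarrow> nat" and i j u p
  assume \<gamma>: "\<forall>\<nu>\<in>-T. \<gamma> \<nu> = 0" and u: "u \<in> analytic_N T M" and p: "p \<in> core T M"
  define K where "K = supp P \<union> supp Q"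
  have K: "finite K" "supp P \<subseteq> K" "supp Q \<subseteq> K"
    using finite_supp[OF P] finite_supp[OF Q] by (auto simp: K_def)
  have an: "(\<lambda>q. u (proj T q)) \<in> analytic_M T M" by (rule analytic_N_proj[OF M u])
  define U where "U = tay p (\<lambda>q. u (proj T q))"
  have U: "has_ps (\<lambda>q. u (proj T q)) p U"
    unfolding U_def by (intro ana_has_ps analytic_M_ana[OF M an p])
  \<comment> \<open>The extension of \<open>u\<close> does not depend on \<open>t\<close>, so putting \<open>t = 0\<close> does not change its series.\<close>
  have "has_ps (\<lambda>q. u (proj T (proj T q))) p (rho T U)" by (rule has_ps_proj[OF p U])
  moreover have "proj T (proj T q) = proj T q" for q by (simp add: proj_def vec_eq_iff)
  ultimately have "has_ps (\<lambda>q. u (proj T q)) p (rho T U)" by simp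
  then have rU: "rho T U = U" by (rule has_ps_unique[OF _ U]) (simp add: always_eventually)
  let ?f = "\<lambda>A B i j x. coef (\<Sum>r\<in>UNIV. rho T (taymat p A i r (fst x)) *
    Xpow T (fst x) (rho T (taymat p B r j (snd x)) * Xpow T (snd x) U)) 0"
  let ?S = "{x\<in>K\<times>K. \<forall>i\<in>T. fst x i + snd x i = \<gamma> i}"
  have "(\<Sum>x\<in>?S. ?f P Q i j x - ?f Q P i j (prod.swap x)) = 0"
  proof (rule sum_npwT_zero[OF _ _ \<gamma>])
    fix \<omega> :: "'k \<Rightarrow> nat" assume \<omega>: "\<forall>i\<in>-T. \<omega> i = 0"
    have side: "coef (rho T (mat_fop T (shifted T \<omega>) K (taymat p A) (taymat p B) i j U)) 0 =
      (\<Sum>x\<in>K\<times>K. of_nat (npwT T \<omega> (fst x + snd x)) * ?f A B i j x)" for A B :: "'k coeffs ^ 'm ^ 'm"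
    proof -
      have "rho T (mat_fop T (shifted T \<omega>) K (taymat p A) (taymat p B) i j U) =
        (\<Sum>r\<in>UNIV. \<Sum>x\<in>K\<times>K. of_nat (npwT T \<omega> (fst x + snd x)) * (rho T (taymat p A i r (fst x)) *
          Xpow T (fst x) (rho T (taymat p B r j (snd x)) * Xpow T (snd x) U)))"
        by (simp add: rho_sum rho_fop_fop[OF \<omega>] rU sum.cartesian_product case_prod_beta)
      also have "\<dots> = (\<Sum>x\<in>K\<times>K. of_nat (npwT T \<omega> (fst x + snd x)) * (\<Sum>r\<in>UNIV. rho T (taymat p A i r (fst x)) *
          Xpow T (fst x) (rho T (taymat p B r j (snd x)) * Xpow T (snd x) U)))"
        by (subst sum.swap) (simp add: sum_distrib_left)
      finally show ?thesis by (simp only: coef_sum coef_of_nat_mult)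
    qed
    have "(\<Sum>x\<in>K\<times>K. of_nat (npwT T \<omega> (fst x + snd x)) * ?f P Q i j x) =
      (\<Sum>x\<in>K\<times>K. of_nat (npwT T \<omega> (fst x + snd x)) * ?f Q P i j x)"
      unfolding side[symmetric] formal_commute_shifted[OF M P Q comm p K an U] ..
    also have "\<dots> = (\<Sum>x\<in>K\<times>K. of_nat (npwT T \<omega> (fst x + snd x)) * ?f Q P i j (prod.swap x))"
      by (rule sum.reindex_bij_witness[of _ prod.swap prod.swap]) (auto simp: add.commute)
    finally show "(\<Sum>x\<in>K\<times>K. of_nat (npwT T \<omega> (fst x + snd x)) * (?f P Q i j x - ?f Q P i j (prod.swap x))) = 0"
      by (simp only: right_diff_distrib sum_subtractf) simp
  qed (use K in auto)
  then have "(\<Sum>x\<in>?S. ?f P Q i j x) = (\<Sum>x\<in>?S. ?f Q P i j (prod.swap x))"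
    by (simp only: sum_subtractf) simp
  also have "\<dots> = (\<Sum>x\<in>?S. ?f Q P i j x)"
    by (rule sum.reindex_bij_witness[of _ prod.swap prod.swap]) (auto simp: add.commute)
  finally show "xi_mult T (sigma_star T M P) (sigma_star T M Q) \<gamma> i j u p =
    xi_mult T (sigma_star T M Q) (sigma_star T M P) \<gamma> i j u p"
    by (simp only: xi_mult_eq[OF M P Q p K U \<gamma>] xi_mult_eq[OF M Q P p K(1) K(3) K(2) U \<gamma>])
qed

section \<open>Orders and symbols\<close>

lemma sigma_eq_sum:
  assumes "finite K" "{\<kappa>. a \<kappa> \<noteq> (\<lambda>_. 0)} \<subseteq> K"
  shows "sigma (int k) a p \<zeta> = (\<Sum>\<kappa>\<in>topdeg K k. a \<kappa> p * cpow (\<lambda>i. of_real (\<zeta> $ i)) \<kappa>)"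
  unfolding sigma_def cpow_def
  by (rule sum.mono_neutral_left) (use assms in \<open>auto simp: fun_eq_iff\<close>)

text \<open>
  A homogeneous symbol, as a function of the covector, determines its coefficients.
\<close>

lemma sigma_eq_iff:
  fixes a b :: "'k::finite coeffs"
  assumes a: "finite {\<kappa>. a \<kappa> \<noteq> (\<lambda>_. 0)}" and b: "finite {\<kappa>. b \<kappa> \<noteq> (\<lambda>_. 0)}"
  shows "(\<forall>\<zeta>. sigma (int k) a p \<zeta> = sigma (int k) b q \<zeta>) \<longleftrightarrow> (\<forall>\<kappa>. mi_size \<kappa> = k \<longrightarrow> a \<kappa> p = b \<kappa> q)"
proof -
  define K where "K = {\<kappa>. a \<kappa> \<noteq> (\<lambda>_. 0)} \<union> {\<kappa>. b \<kappa> \<noteq> (\<lambda>_. 0)}"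
  have K: "finite K" "{\<kappa>. a \<kappa> \<noteq> (\<lambda>_. 0)} \<subseteq> K" "{\<kappa>. b \<kappa> \<noteq> (\<lambda>_. 0)} \<subseteq> K"
    using a b by (auto simp: K_def)
  note sums = sigma_eq_sum[OF K(1,2)] sigma_eq_sum[OF K(1,3)]
  show ?thesis
  proof
    assume *: "\<forall>\<zeta>. sigma (int k) a p \<zeta> = sigma (int k) b q \<zeta>"
    have "a \<kappa> p = b \<kappa> q" if "mi_size \<kappa> = k" for \<kappa>
    proof (cases "\<kappa> \<in> K")
      case True
      have "a \<kappa> p - b \<kappa> q = 0"
      proof (rule cpow_coeffs_zero[where A = "topdeg K k"])
        fix \<omega> :: "'k \<Rightarrow> nat"
        have "sigma (int k) a p (\<chi> i. real (\<omega> i)) = sigma (int k) b q (\<chi> i. real (\<omega> i))"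
          using * by blast
        then show "(\<Sum>\<kappa>\<in>topdeg K k. (a \<kappa> p - b \<kappa> q) * cpow (\<lambda>i. of_nat (\<omega> i)) \<kappa>) = 0"
          by (simp add: sums left_diff_distrib sum_subtractf)
      qed (use K True that in auto)
      then show ?thesis by simp
    next
      case False
      then have "a \<kappa> = (\<lambda>_. 0)" "b \<kappa> = (\<lambda>_. 0)" by (auto simp: K_def)
      then show ?thesis by simp
    qed
    then show "\<forall>\<kappa>. mi_size \<kappa> = k \<longrightarrow> a \<kappa> p = b \<kappa> q" by blast
  next
    assume "\<forall>\<kappa>. mi_size \<kappa> = k \<longrightarrow> a \<kappa> p = b \<kappa> q"
    then show "\<forall>\<zeta>. sigma (int k) a p \<zeta> = sigma (int k) b q \<zeta>"
      by (simp add: sums)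
  qed
qed

lemma sigma_zero_iff:
  assumes "finite {\<kappa>. a \<kappa> \<noteq> (\<lambda>_. 0)}"
  shows "(\<forall>\<zeta>. sigma (int k) a p \<zeta> = 0) \<longleftrightarrow> (\<forall>\<kappa>. mi_size \<kappa> = k \<longrightarrow> a \<kappa> p = 0)"
  using sigma_eq_iff[OF assms, of "\<lambda>_ _. 0" k p p] by (simp add: sigma_def[of _ "\<lambda>_ _. 0"])

lemma finite_entry: "P \<in> mat_over (D_tilde T M) \<Longrightarrow> finite {\<kappa>. (P $ i $ j) \<kappa> \<noteq> (\<lambda>_. 0)}"
  for P :: "'k::finite coeffs ^ 'm::finite ^ 'm"
  by (auto simp: mat_over_def D_tilde_def)

text \<open>
  The degrees over which \<open>op_ord\<close> takes the maximum are those of the terms that do not vanish near \<open>N\<close>.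
  In particular there are finitely many, so this maximum is attained unless the operator is zero.
\<close>

lemma op_ord_set:
  fixes a :: "'k::finite coeffs"
  assumes M: "open M" and a: "finite {\<kappa>. a \<kappa> \<noteq> (\<lambda>_. 0)}"
  shows "finite {k. \<not> near T M (\<lambda>p. \<forall>\<zeta>. sigma (int k) a p \<zeta> = 0)}" (is "finite ?S")
    and "k \<in> {k. \<not> near T M (\<lambda>p. \<forall>\<zeta>. sigma (int k) a p \<zeta> = 0)} \<longleftrightarrow>
      (\<exists>\<kappa>. mi_size \<kappa> = k \<and> \<not> near T M (\<lambda>p. a \<kappa> p = 0))"
proof -
  have iff: "k \<in> ?S \<longleftrightarrow> (\<exists>\<kappa>. mi_size \<kappa> = k \<and> \<not> near T M (\<lambda>p. a \<kappa> p = 0))" for k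
  proof -
    have "near T M (\<lambda>p. \<forall>\<zeta>. sigma (int k) a p \<zeta> = 0) \<longleftrightarrow> (\<forall>\<kappa>. mi_size \<kappa> = k \<longrightarrow> near T M (\<lambda>p. a \<kappa> p = 0))"
      (is "?l \<longleftrightarrow> ?r")
    proof
      assume ?l
      then show ?r
        unfolding sigma_zero_iff[OF a] near_iff[OF M] by (auto elim!: eventually_mono)
    next
      assume r: ?r
      show ?l
        unfolding sigma_zero_iff[OF a] near_iff[OF M]
      proof
        fix p assume p: "p \<in> core T M"
        have "eventually (\<lambda>q. \<forall>\<kappa>\<in>{\<kappa>. a \<kappa> \<noteq> (\<lambda>_. 0)}. mi_size \<kappa> = k \<longrightarrow> a \<kappa> q = 0) (nhds p)"
          using r p a by (intro eventually_ball_finite ballI) (auto simp: near_iff[OF M])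
        then show "eventually (\<lambda>q. \<forall>\<kappa>. mi_size \<kappa> = k \<longrightarrow> a \<kappa> q = 0) (nhds p)"
        proof (rule eventually_mono, intro allI impI)
          fix q and \<kappa> :: "'k \<Rightarrow> nat"
          assume "\<forall>\<kappa>\<in>{\<kappa>. a \<kappa> \<noteq> (\<lambda>_. 0)}. mi_size \<kappa> = k \<longrightarrow> a \<kappa> q = 0" "mi_size \<kappa> = k"
          then show "a \<kappa> q = 0" by (cases "a \<kappa> = (\<lambda>_. 0)") auto
        qed
      qed
    qed
    then show ?thesis by auto
  qed
  have "near T M (\<lambda>p. (0::complex) = 0)" by (simp add: near_iff[OF M])
  then have "\<exists>\<kappa>. mi_size \<kappa> = k \<and> a \<kappa> \<noteq> (\<lambda>_. 0)" if "k \<in> ?S" for k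
    using iff[of k] that by auto
  then have "?S \<subseteq> mi_size ` {\<kappa>. a \<kappa> \<noteq> (\<lambda>_. 0)}" by (auto simp: image_iff)
  then show "finite ?S" using a finite_surj by blast
  show "k \<in> ?S \<longleftrightarrow> (\<exists>\<kappa>. mi_size \<kappa> = k \<and> \<not> near T M (\<lambda>p. a \<kappa> p = 0))" by (rule iff)
qed

lemma finite_mat_ord_set:
  "finite {op_ord T M (P $ i $ j) | i j. \<exists>\<kappa>. \<not> near T M (\<lambda>p. (P $ i $ j) \<kappa> p = 0)}"
  for P :: "'k::finite coeffs ^ 'm::finite ^ 'm"
proof (rule finite_subset)
  show "{op_ord T M (P $ i $ j) | i j. \<exists>\<kappa>. \<not> near T M (\<lambda>p. (P $ i $ j) \<kappa> p = 0)} \<subseteq>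
    (\<lambda>(i, j). op_ord T M (P $ i $ j)) ` UNIV" by auto
qed simp

lemma near_zero_above_ord:
  fixes P :: "'k::finite coeffs ^ 'm::finite ^ 'm"
  assumes M: "open M" and P: "P \<in> mat_over (D_tilde T M)" and k: "mat_ord T M P < mi_size \<kappa>"
  shows "near T M (\<lambda>p. (P $ i $ j) \<kappa> p = 0)"
proof (rule ccontr)
  assume nz: "\<not> near T M (\<lambda>p. (P $ i $ j) \<kappa> p = 0)"
  note S = op_ord_set[OF M finite_entry[OF P, of i j], where T = T]
  have "mi_size \<kappa> \<le> op_ord T M (P $ i $ j)"
    unfolding op_ord_def by (rule Max_ge[OF S(1)]) (unfold S(2), use nz in blast)
  also have "op_ord T M (P $ i $ j) \<le> mat_ord T M P"
    unfolding mat_ord_def by (rule Max_ge[OF finite_mat_ord_set]) (use nz in blast)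
  finally show False using k by simp
qed

lemma ord_attained:
  fixes P :: "'k::finite coeffs ^ 'm::finite ^ 'm"
  assumes M: "open M" and P: "P \<in> mat_over (D_tilde T M)" and nz: "op_nonzero T M P"
  shows "\<exists>i j \<kappa>. mi_size \<kappa> = mat_ord T M P \<and> \<not> near T M (\<lambda>p. (P $ i $ j) \<kappa> p = 0)"
proof -
  let ?O = "{op_ord T M (P $ i $ j) | i j. \<exists>\<kappa>. \<not> near T M (\<lambda>p. (P $ i $ j) \<kappa> p = 0)}"
  have "?O \<noteq> {}" using nz by (auto simp: op_nonzero_def)
  then have "mat_ord T M P \<in> ?O"
    unfolding mat_ord_def by (rule Max_in[OF finite_mat_ord_set])
  then obtain i j \<kappa> where ij: "mat_ord T M P = op_ord T M (P $ i $ j)" and \<kappa>: "\<not> near T M (\<lambda>p. (P $ i $ j) \<kappa> p = 0)"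
    by blast
  note S = op_ord_set[OF M finite_entry[OF P, of i j], where T = T]
  have "op_ord T M (P $ i $ j) \<in> {k. \<not> near T M (\<lambda>p. \<forall>\<zeta>. sigma (int k) (P $ i $ j) p \<zeta> = 0)}"
    unfolding op_ord_def by (rule Max_in[OF S(1)]) (use S(2)[of "mi_size \<kappa>"] \<kappa> in blast)
  then show ?thesis unfolding S(2) ij by blast
qed

lemma scalar_symbol_coeffs:
  fixes P :: "'k::finite coeffs ^ 'm::finite ^ 'm"
  assumes M: "open M" and P: "P \<in> mat_over (D_tilde T M)"
    and s: "scalar_symbol T M (mat_sigma (int n) P)" and p: "p \<in> core T M"
  shows "eventually (\<lambda>q. \<forall>i j \<kappa>. mi_size \<kappa> = n \<longrightarrow> (P $ i $ j) \<kappa> q = (if i = j then (P $ i0 $ i0) \<kappa> q else 0)) (nhds p)"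
proof -
  have "eventually (\<lambda>q. \<forall>\<zeta>. \<exists>c. mat_sigma (int n) P q \<zeta> = mat c) (nhds p)"
    using s p by (simp add: scalar_symbol_def near_iff[OF M])
  then show ?thesis
  proof (rule eventually_mono)
    fix q assume q: "\<forall>\<zeta>. \<exists>c. mat_sigma (int n) P q \<zeta> = mat c"
    have entry: "\<exists>c. \<forall>i j. sigma (int n) (P $ i $ j) q \<zeta> = (if i = j then c else 0)" for \<zeta>
    proof -
      obtain c where c: "mat_sigma (int n) P q \<zeta> = mat c" using q by blast
      have "mat_sigma (int n) P q \<zeta> $ i $ j = mat c $ i $ j" for i j by (simp only: c)
      then show ?thesis by (auto simp: mat_sigma_def mat_def)
    qed
    have diag: "sigma (int n) (P $ i $ i) q \<zeta> = sigma (int n) (P $ i0 $ i0) q \<zeta>" for i \<zeta>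
      using entry[of \<zeta>] by auto
    have off: "sigma (int n) (P $ i $ j) q \<zeta> = 0" if "i \<noteq> j" for i j \<zeta>
      using entry[of \<zeta>] that by auto
    show "\<forall>i j \<kappa>. mi_size \<kappa> = n \<longrightarrow> (P $ i $ j) \<kappa> q = (if i = j then (P $ i0 $ i0) \<kappa> q else 0)"
    proof (intro allI impI)
      fix i j :: 'm and \<kappa> :: "'k \<Rightarrow> nat"
      assume "mi_size \<kappa> = n"
      then show "(P $ i $ j) \<kappa> q = (if i = j then (P $ i0 $ i0) \<kappa> q else 0)"
        using sigma_eq_iff[OF finite_entry[OF P, of i i] finite_entry[OF P, of i0 i0], of n q q] diag[of i]
          sigma_zero_iff[OF finite_entry[OF P, of i j], of n q] off[of i j] by auto
    qed
  qed
qed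

lemma taymat_cong:
  fixes P Q :: "'k::finite coeffs ^ 'm::finite ^ 'm"
  assumes "open M" "P \<in> mat_over (D_tilde T M)" "Q \<in> mat_over (D_tilde T M)" "p \<in> core T M"
    "eventually (\<lambda>q. (P $ i $ j) \<kappa> q = (Q $ i' $ j') \<mu> q) (nhds p)"
  shows "taymat p P i j \<kappa> = taymat p Q i' j' \<mu>"
  unfolding taymat_def by (rule tay_cong[OF D_tilde_ana[OF assms(1,2,4)] assms(5)])

lemma taymat_zero:
  fixes P :: "'k::finite coeffs ^ 'm::finite ^ 'm"
  assumes "open M" "P \<in> mat_over (D_tilde T M)" "p \<in> core T M" "eventually (\<lambda>q. (P $ i $ j) \<kappa> q = 0) (nhds p)"
  shows "taymat p P i j \<kappa> = 0"
  using tay_cong[OF D_tilde_ana[OF assms(1,2,3)] assms(4)] by (simp add: taymat_def)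

lemma scalar_symbol_taymat:
  fixes P :: "'k::finite coeffs ^ 'm::finite ^ 'm"
  assumes M: "open M" and P: "P \<in> mat_over (D_tilde T M)"
    and s: "scalar_symbol T M (mat_sigma (int n) P)" and p: "p \<in> core T M" and n: "mi_size \<kappa> = n"
  shows "taymat p P i j \<kappa> = (if i = j then taymat p P i0 i0 \<kappa> else 0)"
proof -
  note ev = scalar_symbol_coeffs[OF M P s p, of i0]
  show ?thesis
  proof (cases "i = j")
    case True
    have "taymat p P i j \<kappa> = taymat p P i0 i0 \<kappa>"
    proof (rule taymat_cong[OF M P P p], rule eventually_mono[OF ev])
      fix q assume "\<forall>i j \<kappa>. mi_size \<kappa> = n \<longrightarrow> (P $ i $ j) \<kappa> q = (if i = j then (P $ i0 $ i0) \<kappa> q else 0)"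
      with n have "(P $ i $ j) \<kappa> q = (if i = j then (P $ i0 $ i0) \<kappa> q else 0)" by blast
      then show "(P $ i $ j) \<kappa> q = (P $ i0 $ i0) \<kappa> q" unfolding if_P[OF True] .
    qed
    then show ?thesis using True by simp
  next
    case False
    have "taymat p P i j \<kappa> = 0"
    proof (rule taymat_zero[OF M P p], rule eventually_mono[OF ev])
      fix q assume "\<forall>i j \<kappa>. mi_size \<kappa> = n \<longrightarrow> (P $ i $ j) \<kappa> q = (if i = j then (P $ i0 $ i0) \<kappa> q else 0)"
      with n have "(P $ i $ j) \<kappa> q = (if i = j then (P $ i0 $ i0) \<kappa> q else 0)" by blast
      then show "(P $ i $ j) \<kappa> q = 0" unfolding if_not_P[OF False] .
    qed
    then show ?thesis using False by simp
  qed
qed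

text \<open>
  Functions vanishing on \<open>N\<close> have no pure \<open>x\<close>-terms in their Taylor series.
\<close>

lemma core_zero_coef:
  fixes f :: "'k::finite fn"
  assumes M: "open M" and p: "p \<in> core T M" and f: "has_ps f p F" "\<And>x. x \<in> core T M \<Longrightarrow> f x = 0"
    and \<delta>: "\<forall>i\<in>T. \<delta> i = 0"
  shows "coef F \<delta> = 0"
proof (rule has_ps_slice_zero[OF f(1), where I = "- T"])
  have "eventually (\<lambda>q. q \<in> M) (nhds p)"
    using M p by (intro eventually_nhds_in_open) (auto simp: core_def)
  then show "eventually (\<lambda>q. (\<forall>i\<in>-(-T). q $ i = p $ i) \<longrightarrow> f q = 0) (nhds p)"
    by (rule eventually_mono) (use p f(2) in \<open>auto simp: core_def\<close>)
qed (use \<delta> in auto)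

text \<open>
  The bracket of \<open>\<sigma>(P)\<close>, read off its diagonal entry \<open>i0\<close>, with any entry of \<open>\<sigma>(Q)\<close> vanishes.
\<close>

lemma bracket_identity:
  fixes P Q :: "'k::{finite,linorder} coeffs ^ 'm::finite ^ 'm"
  assumes M: "open M" and P: "P \<in> mat_over (D_tilde T M)" and Q: "Q \<in> mat_over (D_tilde T M)"
    and comm: "op_commute T M P Q"
    and scal: "scalar_symbol T M (princ_symbol T M P)"
    and low: "scalar_symbol T M (mat_sigma (int (mat_ord T M P) - 1) P) \<or> scalar_symbol T M (princ_symbol T M Q)"
    and p: "p \<in> core T M" and K: "finite K" "supp P \<subseteq> K" "supp Q \<subseteq> K"
  defines "k \<equiv> mat_ord T M P" and "l \<equiv> mat_ord T M Q"
  shows "(\<Sum>\<nu>\<in>UNIV. dsymb \<nu> (topdeg K k) (taymat p P i0 i0) \<omega> * Der T \<nu> (symb (topdeg K l) (taymat p Q i j) \<omega>)) =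
    (\<Sum>\<nu>\<in>UNIV. dsymb \<nu> (topdeg K l) (taymat p Q i j) \<omega> * Der T \<nu> (symb (topdeg K k) (taymat p P i0 i0) \<omega>))"
proof (rule poisson_bracket_zero[OF K(1)])
  have one: "(\<lambda>_. 1) \<in> analytic_M T M"
    by (simp add: analytic_M_iff[OF M] always_eventually has_ps_ana[OF has_ps_one])
  fix \<omega> i j
  show "mat_fop T (shifted T \<omega>) K (taymat p P) (taymat p Q) i j 1 =
    mat_fop T (shifted T \<omega>) K (taymat p Q) (taymat p P) i j 1"
    by (rule formal_commute_shifted[OF M P Q comm p K one has_ps_one])
next
  fix i j \<kappa>
  show "mi_size \<kappa> \<le> k" if "taymat p P i j \<kappa> \<noteq> 0"
  proof (rule ccontr)
    assume "\<not> mi_size \<kappa> \<le> k"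
    then have "near T M (\<lambda>p. (P $ i $ j) \<kappa> p = 0)" by (intro near_zero_above_ord[OF M P]) (simp add: k_def)
    then have "taymat p P i j \<kappa> = 0" using p by (intro taymat_zero[OF M P p]) (simp add: near_iff[OF M])
    then show False using that by simp
  qed
  show "mi_size \<kappa> \<le> l" if "taymat p Q i j \<kappa> \<noteq> 0"
  proof (rule ccontr)
    assume "\<not> mi_size \<kappa> \<le> l"
    then have "near T M (\<lambda>p. (Q $ i $ j) \<kappa> p = 0)" by (intro near_zero_above_ord[OF M Q]) (simp add: l_def)
    then have "taymat p Q i j \<kappa> = 0" using p by (intro taymat_zero[OF M Q p]) (simp add: near_iff[OF M])
    then show False using that by simp
  qed
  show "taymat p P i j \<kappa> = (if i = j then taymat p P i0 i0 \<kappa> else 0)" if "mi_size \<kappa> = k"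
    by (rule scalar_symbol_taymat[OF M P _ p that]) (use scal in \<open>simp add: princ_symbol_def k_def\<close>)
next
  show "(\<exists>c. \<forall>i j \<kappa>. Suc (mi_size \<kappa>) = k \<longrightarrow> taymat p P i j \<kappa> = (if i = j then c \<kappa> else 0)) \<or>
    (\<exists>c. \<forall>i j \<kappa>. mi_size \<kappa> = l \<longrightarrow> taymat p Q i j \<kappa> = (if i = j then c \<kappa> else 0))"
    using low
  proof
    assume s: "scalar_symbol T M (mat_sigma (int (mat_ord T M P) - 1) P)"
    have "taymat p P i j \<kappa> = (if i = j then taymat p P i0 i0 \<kappa> else 0)" if "Suc (mi_size \<kappa>) = k" for i j \<kappa>
    proof (rule scalar_symbol_taymat[OF M P _ p refl])
      have "int (mat_ord T M P) - 1 = int (mi_size \<kappa>)" using that by (simp add: k_def)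
      with s show "scalar_symbol T M (mat_sigma (int (mi_size \<kappa>)) P)" by simp
    qed
    then show ?thesis by (intro disjI1 exI[of _ "taymat p P i0 i0"]) blast
  next
    assume s: "scalar_symbol T M (princ_symbol T M Q)"
    have "taymat p Q i j \<kappa> = (if i = j then taymat p Q i0 i0 \<kappa> else 0)" if "mi_size \<kappa> = l" for i j \<kappa>
      by (rule scalar_symbol_taymat[OF M Q _ p that]) (use s in \<open>simp add: princ_symbol_def l_def\<close>)
    then show ?thesis by (intro disjI2 exI[of _ "taymat p Q i0 i0"]) blast
  qed
qed

text \<open>
  The hypothesis \<open>H\<close> says of each splitting \<open>\<gamma> = \<kappa> + \<mu>\<close> with \<open>\<kappa> \<noteq> 0\<close> that \<open>a\<close> has no terms in \<open>t\<^sup>\<kappa>\<close> or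
  \<open>b\<close> has none in \<open>t\<^sup>\<mu>\<close>, so only products of a \<open>t\<close>-free term of \<open>a\<close> and a term of \<open>b\<close> in \<open>t\<^sup>\<gamma>\<close> are left.  Among
  these, \<open>\<theta>\<^sub>\<nu> a\<close> contributes nothing, \<open>\<theta>\<^sub>\<nu> b\<close> gives the factor \<open>\<gamma>\<^sub>\<nu>\<close>, and the derivatives of \<open>a\<close> along the
  covectors dual to \<open>x\<close> vanish on \<open>N\<close> by the assumption on \<open>a\<close>.
\<close>

lemma bracket_coef:
  fixes a b :: "('k::finite \<Rightarrow> nat) \<Rightarrow> 'k mfps"
  assumes id: "(\<Sum>\<nu>\<in>UNIV. dsymb \<nu> K a \<omega> * Der T \<nu> (symb L b \<omega>)) = (\<Sum>\<nu>\<in>UNIV. dsymb \<nu> L b \<omega> * Der T \<nu> (symb K a \<omega>))"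
    and \<gamma>: "\<forall>i\<in>-T. \<gamma> i = 0"
    and a: "\<And>\<kappa>. \<kappa> \<in> K \<Longrightarrow> \<exists>i\<in>-T. \<kappa> i \<noteq> 0 \<Longrightarrow> coef (a \<kappa>) 0 = 0"
    and H: "\<And>\<kappa> \<mu>. \<kappa> + \<mu> = \<gamma> \<Longrightarrow> \<kappa> \<noteq> 0 \<Longrightarrow>
      (\<forall>x\<in>K. \<forall>\<delta>. (\<forall>i\<in>T. \<delta> i = \<kappa> i) \<longrightarrow> coef (a x) \<delta> = 0) \<or> (\<forall>x\<in>L. \<forall>\<delta>. (\<forall>i\<in>T. \<delta> i = \<mu> i) \<longrightarrow> coef (b x) \<delta> = 0)"
  shows "(\<Sum>\<nu>\<in>T. of_nat (\<gamma> \<nu>) * coef (dsymb \<nu> K a \<omega>) 0) * coef (symb L b \<omega>) \<gamma> =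
    (\<Sum>\<nu>\<in>-T. coef (dsymb \<nu> L b \<omega>) \<gamma> * coef (symb K a \<omega>) (unit_mi \<nu>))"
proof -
  have coef_sym: "coef (symb S c \<omega>) \<delta> = (\<Sum>x\<in>S. of_nat (npw \<omega> x) * coef (c x) \<delta>)" for S c \<delta>
    by (simp add: symb_def)
  have coef_dsym: "coef (dsymb \<nu> S c \<omega>) \<delta> = (\<Sum>x\<in>S. of_nat (dnpw \<nu> \<omega> x) * coef (c x) \<delta>)" for \<nu> S c \<delta>
    by (simp add: dsymb_def)
  have coef_Der: "coef (Der T \<nu> F) \<delta> = (if \<nu> \<in> T then of_nat (\<delta> \<nu>) * coef F \<delta> else of_nat (\<delta> \<nu> + 1) * coef F (\<delta> + unit_mi \<nu>))"
    for \<nu> \<delta> and F :: "'k mfps"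
    by (simp add: Der_def coef_pd)
  have shift: "\<forall>i\<in>T. (\<delta> + unit_mi \<nu>) i = \<delta> i" if "\<nu> \<notin> T" for \<nu> and \<delta> :: "'k \<Rightarrow> nat"
    using that by (auto simp: unit_mi_def)
  have zero: "coef (Der T \<nu> (symb S c \<omega>)) \<kappa> = 0" "coef (dsymb \<nu> S c \<omega>) \<kappa> = 0"
    if "\<forall>x\<in>S. \<forall>\<delta>. (\<forall>i\<in>T. \<delta> i = \<kappa> i) \<longrightarrow> coef (c x) \<delta> = 0" for S c \<kappa> \<nu>
    using that shift[of \<nu> \<kappa>] by (auto simp: coef_Der coef_sym coef_dsym intro!: sum.neutral)
  have mult: "coef (F * G) \<gamma> = coef F 0 * coef G \<gamma>"
    if "\<And>\<kappa> \<mu>. \<kappa> + \<mu> = \<gamma> \<Longrightarrow> \<kappa> \<noteq> 0 \<Longrightarrow> coef F \<kappa> * coef G \<mu> = 0" for F G :: "'k mfps"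
  proof -
    have "coef (F * G) \<gamma> = (\<Sum>x\<in>splits \<gamma>. if x = (0, \<gamma>) then coef F 0 * coef G \<gamma> else 0)"
      unfolding coef_mult
    proof (rule sum.cong[OF refl])
      fix x assume "x \<in> splits \<gamma>"
      then have x: "fst x + snd x = \<gamma>" by (auto simp: splits_def)
      show "(case x of (\<kappa>, \<mu>) \<Rightarrow> coef F \<kappa> * coef G \<mu>) = (if x = (0, \<gamma>) then coef F 0 * coef G \<gamma> else 0)"
      proof (cases "fst x = 0")
        case True
        then have "x = (0, \<gamma>)" using x by (simp add: prod_eq_iff)
        then show ?thesis by simp
      next
        case False
        then show ?thesis using that[OF x False] by (simp only: case_prod_beta) auto
      qed
    qed
    also have "\<dots> = coef F 0 * coef G \<gamma>"
      using finite_splits[of \<gamma>] by (subst sum.delta) (auto simp: splits_def)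
    finally show ?thesis .
  qed
  have left: "coef (dsymb \<nu> K a \<omega> * Der T \<nu> (symb L b \<omega>)) \<gamma> =
    (if \<nu> \<in> T then of_nat (\<gamma> \<nu>) * coef (dsymb \<nu> K a \<omega>) 0 * coef (symb L b \<omega>) \<gamma> else 0)" for \<nu>
  proof -
    have "coef (dsymb \<nu> K a \<omega> * Der T \<nu> (symb L b \<omega>)) \<gamma> = coef (dsymb \<nu> K a \<omega>) 0 * coef (Der T \<nu> (symb L b \<omega>)) \<gamma>"
    proof (rule mult)
      fix \<kappa> \<mu> assume "\<kappa> + \<mu> = \<gamma>" "\<kappa> \<noteq> 0"
      from H[OF this] show "coef (dsymb \<nu> K a \<omega>) \<kappa> * coef (Der T \<nu> (symb L b \<omega>)) \<mu> = 0"
        using zero by auto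
    qed
    moreover have "coef (dsymb \<nu> K a \<omega>) 0 = 0" if "\<nu> \<notin> T"
      unfolding coef_dsym
    proof (intro sum.neutral ballI)
      fix x assume "x \<in> K"
      then show "of_nat (dnpw \<nu> \<omega> x) * coef (a x) 0 = 0"
        using a[of x] that by (cases "x \<nu> = 0") (auto simp: dnpw_def)
    qed
    ultimately show ?thesis by (simp add: coef_Der)
  qed
  have right: "coef (dsymb \<nu> L b \<omega> * Der T \<nu> (symb K a \<omega>)) \<gamma> =
    (if \<nu> \<in> T then 0 else coef (dsymb \<nu> L b \<omega>) \<gamma> * coef (symb K a \<omega>) (unit_mi \<nu>))" for \<nu>
  proof -
    have "coef (Der T \<nu> (symb K a \<omega>) * dsymb \<nu> L b \<omega>) \<gamma> = coef (Der T \<nu> (symb K a \<omega>)) 0 * coef (dsymb \<nu> L b \<omega>) \<gamma>"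
    proof (rule mult)
      fix \<kappa> \<mu> assume "\<kappa> + \<mu> = \<gamma>" "\<kappa> \<noteq> 0"
      from H[OF this] show "coef (Der T \<nu> (symb K a \<omega>)) \<kappa> * coef (dsymb \<nu> L b \<omega>) \<mu> = 0"
        using zero by auto
    qed
    then show ?thesis by (simp add: coef_Der mult.commute)
  qed
  have "(\<Sum>\<nu>\<in>UNIV. coef (dsymb \<nu> K a \<omega> * Der T \<nu> (symb L b \<omega>)) \<gamma>) =
    (\<Sum>\<nu>\<in>UNIV. coef (dsymb \<nu> L b \<omega> * Der T \<nu> (symb K a \<omega>)) \<gamma>)"
    using arg_cong[OF id, of "\<lambda>F. coef F \<gamma>"] by simp
  moreover have "(\<Sum>\<nu>\<in>UNIV. if \<nu> \<in> T then f \<nu> else 0) = (\<Sum>\<nu>\<in>T. f \<nu>)" for f :: "'k \<Rightarrow> complex"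
    by (simp flip: sum.inter_filter)
  moreover have "(\<Sum>\<nu>\<in>UNIV. if \<nu> \<in> T then 0 else f \<nu>) = (\<Sum>\<nu>\<in>-T. f \<nu>)" for f :: "'k \<Rightarrow> complex"
    by (rule sum.mono_neutral_cong_right) auto
  ultimately show ?thesis by (simp only: left right sum_distrib_right)
qed

section \<open>The bracket identity in one power of t\<close>

text \<open>
  The derivative of \<open>z\<^sup>\<kappa>\<close> with respect to \<open>z\<^sub>i\<close>.
\<close>

definition dcpow :: "'k \<Rightarrow> ('k::finite \<Rightarrow> complex) \<Rightarrow> ('k \<Rightarrow> nat) \<Rightarrow> complex"
  where "dcpow i z \<kappa> = of_nat (\<kappa> i) * z i ^ (\<kappa> i - 1) * (\<Prod>j\<in>UNIV-{i}. z j ^ \<kappa> j)"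

lemma of_nat_npw: "of_nat (npw \<omega> \<kappa>) = cpow (\<lambda>i. of_nat (\<omega> i)) \<kappa>"
  by (simp add: npw_def cpow_def)

lemma of_nat_dnpw: "of_nat (dnpw i \<omega> \<kappa>) = dcpow i (\<lambda>i. of_nat (\<omega> i)) \<kappa>"
  by (simp add: dnpw_def dcpow_def)

lemma polyfun_dcpow: "polyfun (\<lambda>z. dcpow i z \<kappa>)"
  unfolding dcpow_def by (intro polyfun_mult polyfun_const polyfun_prod polyfun_power polyfun_coord)

lemma power_ratio_tendsto:
  assumes "m \<le> d"
  shows "(\<lambda>s. of_nat s ^ m / of_nat s ^ d :: complex) \<longlonglongrightarrow> (if m = d then 1 else 0)"
proof (cases "m = d")
  case True
  have "eventually (\<lambda>s. of_nat s ^ m / of_nat s ^ d = (1::complex)) sequentially"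
    using eventually_gt_at_top[of 0] by (rule eventually_mono) (use True in auto)
  then show ?thesis unfolding if_P[OF True] by (rule tendsto_eventually)
next
  case False
  with assms have d: "0 < d - m" by auto
  have "(\<lambda>s. (1 / of_nat s) ^ (d - m) :: complex) \<longlonglongrightarrow> 0 ^ (d - m)"
    by (intro tendsto_power lim_1_over_n)
  then have lim: "(\<lambda>s. (1 / of_nat s) ^ (d - m) :: complex) \<longlonglongrightarrow> 0" using d by (simp add: power_0_left)
  have "eventually (\<lambda>s. (1 / of_nat s) ^ (d - m) = (of_nat s ^ m / of_nat s ^ d :: complex)) sequentially"
    using eventually_gt_at_top[of 0]
  proof (rule eventually_mono)
    fix s :: nat assume "0 < s"
    moreover have "(of_nat s :: complex) ^ d = of_nat s ^ m * of_nat s ^ (d - m)"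
      using assms by (simp flip: power_add)
    ultimately show "(1 / of_nat s) ^ (d - m) = (of_nat s ^ m / of_nat s ^ d :: complex)"
      by (simp add: power_divide)
  qed
  from Lim_transform_eventually[OF lim this] show ?thesis using False by simp
qed

text \<open>
  Scaling the covectors dual to \<open>x\<close> by \<open>s\<close> detects the degree in these variables.
\<close>

lemma npw_scale:
  "npw (\<lambda>i. if i \<in> T then \<omega> i else s * \<omega> i) x = s ^ (\<Sum>i\<in>-T. x i) * npw \<omega> x"
proof -
  have "npw (\<lambda>i. if i \<in> T then \<omega> i else s * \<omega> i) x = (\<Prod>i\<in>UNIV. (if i \<in> -T then s ^ x i else 1) * \<omega> i ^ x i)"
    unfolding npw_def by (rule prod.cong) (auto simp: power_mult_distrib)
  also have "\<dots> = (\<Prod>i\<in>UNIV. if i \<in> -T then s ^ x i else 1) * npw \<omega> x"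
    by (simp add: prod.distrib npw_def)
  also have "(\<Prod>i\<in>UNIV. if i \<in> -T then s ^ x i else 1) = (\<Prod>i\<in>-T. s ^ x i)"
    by (rule prod.mono_neutral_cong_right) auto
  finally show ?thesis by (simp add: power_sum)
qed

lemma dnpw_scale_off:
  assumes "\<nu> \<notin> T"
  shows "dnpw \<nu> (\<lambda>i. if i \<in> T then \<omega> i else s * \<omega> i) x = s ^ ((\<Sum>i\<in>-T. x i) - 1) * dnpw \<nu> \<omega> x"
proof (cases "x \<nu> = 0")
  case False
  have "(\<Prod>i\<in>UNIV-{\<nu>}. (if i \<in> T then \<omega> i else s * \<omega> i) ^ x i) =
    (\<Prod>i\<in>UNIV-{\<nu>}. (if i \<in> -T then s ^ x i else 1) * \<omega> i ^ x i)"
    by (rule prod.cong) (auto simp: power_mult_distrib)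
  also have "\<dots> = (\<Prod>i\<in>UNIV-{\<nu>}. if i \<in> -T then s ^ x i else 1) * (\<Prod>i\<in>UNIV-{\<nu>}. \<omega> i ^ x i)"
    by (rule prod.distrib)
  also have "(\<Prod>i\<in>UNIV-{\<nu>}. if i \<in> -T then s ^ x i else 1) = (\<Prod>i\<in>-T-{\<nu>}. s ^ x i)"
    by (rule prod.mono_neutral_cong_right) auto
  also have "\<dots> = s ^ (\<Sum>i\<in>-T-{\<nu>}. x i)" by (simp add: power_sum)
  finally have pr: "(\<Prod>i\<in>UNIV-{\<nu>}. (if i \<in> T then \<omega> i else s * \<omega> i) ^ x i) =
    s ^ (\<Sum>i\<in>-T-{\<nu>}. x i) * (\<Prod>i\<in>UNIV-{\<nu>}. \<omega> i ^ x i)" .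
  have "(\<Sum>i\<in>-T. x i) - 1 = (x \<nu> - 1) + (\<Sum>i\<in>-T-{\<nu>}. x i)"
    using False assms by (subst sum.remove[of "-T" \<nu>]) auto
  then show ?thesis
    using assms by (simp add: dnpw_def pr power_add power_mult_distrib mult_ac)
qed (simp add: dnpw_def)

lemma dnpw_scale_on:
  assumes "\<nu> \<in> T" "\<forall>i\<in>-T. x i = 0"
  shows "dnpw \<nu> (\<lambda>i. if i \<in> T then \<omega> i else s * \<omega> i) x = dnpw \<nu> \<omega> x"
proof -
  have "(\<Prod>i\<in>UNIV-{\<nu>}. (if i \<in> T then \<omega> i else s * \<omega> i) ^ x i) = (\<Prod>i\<in>UNIV-{\<nu>}. \<omega> i ^ x i)"
    by (rule prod.cong) (use assms in auto)
  then show ?thesis using assms by (simp add: dnpw_def)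
qed

text \<open>
  Let \<open>d\<close> be the highest degree in the covectors \<open>\<tau>\<close> (those outside \<open>T\<close>) that occurs in \<open>b\<close>.  Replace \<open>\<tau>\<close>
  by \<open>s \<tau>\<close>, divide by \<open>s\<^sup>d\<close> and let \<open>s\<close> tend to infinity.  The right-hand side tends to \<open>0\<close>, because each of
  its terms contains a derivative with respect to some \<open>\<tau>\<^sub>\<nu>\<close> while the coefficients coming from \<open>a\<close> do not
  involve \<open>\<tau>\<close>.  Hence \<open>G S = 0\<close>, where \<open>S\<close> is the part of degree \<open>d\<close> and \<open>G\<close>, the factor on the left, is a
  nonzero polynomial.  So \<open>S = 0\<close>, contrary to the choice of \<open>d\<close>.
\<close>

lemma top_degree_vanishing:
  fixes al bl :: "('k::finite \<Rightarrow> nat) \<Rightarrow> complex" and aj :: "'k \<Rightarrow> ('k \<Rightarrow> nat) \<Rightarrow> complex"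
  assumes fin: "finite K" "finite L"
    and id: "\<And>\<omega>. (\<Sum>\<nu>\<in>T. of_nat (\<gamma> \<nu>) * (\<Sum>x\<in>K. of_nat (dnpw \<nu> \<omega> x) * al x)) * (\<Sum>x\<in>L. of_nat (npw \<omega> x) * bl x) =
      (\<Sum>\<nu>\<in>-T. (\<Sum>x\<in>L. of_nat (dnpw \<nu> \<omega> x) * bl x) * (\<Sum>x\<in>K. of_nat (npw \<omega> x) * aj \<nu> x))"
    and al: "\<And>x. x \<in> K \<Longrightarrow> \<exists>i\<in>-T. x i \<noteq> 0 \<Longrightarrow> al x = 0"
    and aj: "\<And>x \<nu>. x \<in> K \<Longrightarrow> \<exists>i\<in>-T. x i \<noteq> 0 \<Longrightarrow> \<nu> \<notin> T \<Longrightarrow> aj \<nu> x = 0"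
    and nz: "(\<Sum>\<nu>\<in>T. of_nat (\<gamma> \<nu>) * (\<Sum>x\<in>K. al x * dcpow \<nu> w x)) \<noteq> 0"
    and x: "x \<in> L"
  shows "bl x = 0"
proof (rule ccontr)
  assume "bl x \<noteq> 0"
  define xs where "xs x = (\<Sum>i\<in>-T. x i)" for x :: "'k \<Rightarrow> nat"
  define d where "d = Max (xs ` {x\<in>L. bl x \<noteq> 0})"
  have ne: "{x\<in>L. bl x \<noteq> 0} \<noteq> {}" using x \<open>bl x \<noteq> 0\<close> by auto
  have le_d: "xs y \<le> d" if "y \<in> L" "bl y \<noteq> 0" for y
    unfolding d_def by (rule Max_ge) (use fin that in auto)
  have "d \<in> xs ` {x\<in>L. bl x \<noteq> 0}"
    unfolding d_def by (rule Max_in) (use fin ne in auto)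
  then obtain x1 where x1: "x1 \<in> L" "bl x1 \<noteq> 0" "xs x1 = d" by auto
  define G where "G z = (\<Sum>\<nu>\<in>T. of_nat (\<gamma> \<nu>) * (\<Sum>x\<in>K. al x * dcpow \<nu> z x))" for z
  define S where "S z = (\<Sum>x\<in>{x\<in>L. xs x = d}. bl x * cpow z x)" for z
  have prod0: "G (\<lambda>i. of_nat (\<omega> i)) * S (\<lambda>i. of_nat (\<omega> i)) = 0" for \<omega>
  proof -
    define g where "g = (\<Sum>\<nu>\<in>T. of_nat (\<gamma> \<nu>) * (\<Sum>x\<in>K. of_nat (dnpw \<nu> \<omega> x) * al x))"
    define c where "c \<nu> = (\<Sum>x\<in>K. of_nat (npw \<omega> x) * aj \<nu> x)" for \<nu>
    have scaled: "g * (\<Sum>x\<in>L. of_nat s ^ xs x * (of_nat (npw \<omega> x) * bl x)) =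
      (\<Sum>\<nu>\<in>-T. (\<Sum>x\<in>L. of_nat s ^ (xs x - 1) * (of_nat (dnpw \<nu> \<omega> x) * bl x)) * c \<nu>)" for s
    proof -
      let ?w = "\<lambda>i. if i \<in> T then \<omega> i else s * \<omega> i"
      have e1: "(\<Sum>\<nu>\<in>T. of_nat (\<gamma> \<nu>) * (\<Sum>x\<in>K. of_nat (dnpw \<nu> ?w x) * al x)) = g"
      proof -
        have eqs: "of_nat (dnpw \<nu> ?w x) * al x = of_nat (dnpw \<nu> \<omega> x) * al x" if "\<nu> \<in> T" "x \<in> K" for \<nu> x
          using dnpw_scale_on[of \<nu> T x \<omega> s] al[of x] that by (cases "\<forall>i\<in>-T. x i = 0") auto
        show ?thesis unfolding g_def by (rule sum.cong[OF refl]) (simp only: eqs cong: sum.cong)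
      qed
      have e2: "(\<Sum>x\<in>K. of_nat (npw ?w x) * aj \<nu> x) = c \<nu>" if "\<nu> \<notin> T" for \<nu>
        unfolding c_def
      proof (intro sum.cong refl)
        fix x assume "x \<in> K"
        then show "of_nat (npw ?w x) * aj \<nu> x = of_nat (npw \<omega> x) * aj \<nu> x"
          using npw_scale[of T \<omega> s x] aj[of x \<nu>] that by (cases "\<forall>i\<in>-T. x i = 0") auto
      qed
      have e3: "(\<Sum>x\<in>L. of_nat (npw ?w x) * bl x) = (\<Sum>x\<in>L. of_nat s ^ xs x * (of_nat (npw \<omega> x) * bl x))"
        by (simp add: npw_scale xs_def mult.assoc)
      have e4: "(\<Sum>x\<in>L. of_nat (dnpw \<nu> ?w x) * bl x) =
          (\<Sum>x\<in>L. of_nat s ^ (xs x - 1) * (of_nat (dnpw \<nu> \<omega> x) * bl x))" if "\<nu> \<notin> T" for \<nu>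
        using that by (simp add: dnpw_scale_off xs_def mult.assoc)
      have "(\<Sum>\<nu>\<in>-T. (\<Sum>x\<in>L. of_nat (dnpw \<nu> ?w x) * bl x) * (\<Sum>x\<in>K. of_nat (npw ?w x) * aj \<nu> x)) =
        (\<Sum>\<nu>\<in>-T. (\<Sum>x\<in>L. of_nat s ^ (xs x - 1) * (of_nat (dnpw \<nu> \<omega> x) * bl x)) * c \<nu>)"
        by (rule sum.cong[OF refl]) (simp only: e2 e4 Compl_iff not_False_eq_True)
      with id[of ?w] show ?thesis unfolding e1 e3 by (rule trans)
    qed
    have "(\<lambda>s. g * (\<Sum>x\<in>L. of_nat s ^ xs x / of_nat s ^ d * (of_nat (npw \<omega> x) * bl x))) \<longlonglongrightarrow>
      g * (\<Sum>x\<in>L. (if xs x = d then 1 else 0) * (of_nat (npw \<omega> x) * bl x))"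
    proof (rule tendsto_mult[OF tendsto_const], rule tendsto_sum)
      fix x assume x: "x \<in> L"
      show "(\<lambda>s. of_nat s ^ xs x / of_nat s ^ d * (of_nat (npw \<omega> x) * bl x)) \<longlonglongrightarrow>
        (if xs x = d then 1 else 0) * (of_nat (npw \<omega> x) * bl x)"
      proof (cases "bl x = 0")
        case False
        then show ?thesis by (rule tendsto_mult[OF power_ratio_tendsto[OF le_d[OF x]] tendsto_const])
      qed simp
    qed
    also have "(\<lambda>s. g * (\<Sum>x\<in>L. of_nat s ^ xs x / of_nat s ^ d * (of_nat (npw \<omega> x) * bl x))) =
      (\<lambda>s. \<Sum>\<nu>\<in>-T. (\<Sum>x\<in>L. of_nat s ^ (xs x - 1) / of_nat s ^ d * (of_nat (dnpw \<nu> \<omega> x) * bl x)) * c \<nu>)"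
    proof
      fix s
      have "g * (\<Sum>x\<in>L. of_nat s ^ xs x / of_nat s ^ d * (of_nat (npw \<omega> x) * bl x)) =
        (g * (\<Sum>x\<in>L. of_nat s ^ xs x * (of_nat (npw \<omega> x) * bl x))) / of_nat s ^ d"
        by (simp add: sum_distrib_left sum_divide_distrib)
      also have "\<dots> = (\<Sum>\<nu>\<in>-T. (\<Sum>x\<in>L. of_nat s ^ (xs x - 1) / of_nat s ^ d * (of_nat (dnpw \<nu> \<omega> x) * bl x)) * c \<nu>)"
        unfolding scaled by (simp add: sum_distrib_right sum_divide_distrib)
      finally show "g * (\<Sum>x\<in>L. of_nat s ^ xs x / of_nat s ^ d * (of_nat (npw \<omega> x) * bl x)) =
        (\<Sum>\<nu>\<in>-T. (\<Sum>x\<in>L. of_nat s ^ (xs x - 1) / of_nat s ^ d * (of_nat (dnpw \<nu> \<omega> x) * bl x)) * c \<nu>)" .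
    qed
    finally have lim1: "(\<lambda>s. \<Sum>\<nu>\<in>-T. (\<Sum>x\<in>L. of_nat s ^ (xs x - 1) / of_nat s ^ d * (of_nat (dnpw \<nu> \<omega> x) * bl x)) * c \<nu>)
      \<longlonglongrightarrow> g * (\<Sum>x\<in>L. (if xs x = d then 1 else 0) * (of_nat (npw \<omega> x) * bl x))" .
    have "(\<lambda>s. \<Sum>\<nu>\<in>-T. (\<Sum>x\<in>L. of_nat s ^ (xs x - 1) / of_nat s ^ d * (of_nat (dnpw \<nu> \<omega> x) * bl x)) * c \<nu>)
      \<longlonglongrightarrow> (\<Sum>\<nu>\<in>-T. (\<Sum>x\<in>L. 0) * c \<nu>)"
    proof (rule tendsto_sum, rule tendsto_mult[OF _ tendsto_const], rule tendsto_sum)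
      fix \<nu> x assume \<nu>: "\<nu> \<in> -T" and x: "x \<in> L"
      show "(\<lambda>s. of_nat s ^ (xs x - 1) / of_nat s ^ d * (of_nat (dnpw \<nu> \<omega> x) * bl x)) \<longlonglongrightarrow> 0"
      proof (cases "bl x = 0 \<or> x \<nu> = 0")
        case True
        then have "of_nat (dnpw \<nu> \<omega> x) * bl x = 0" by (auto simp: dnpw_def)
        then show ?thesis by (simp only: mult_zero_right tendsto_const)
      next
        case False
        have "x \<nu> \<le> xs x" unfolding xs_def by (rule member_le_sum) (use \<nu> in auto)
        then have "xs x - 1 < d" using False le_d[OF x] by linarith
        then have "(\<lambda>s. of_nat s ^ (xs x - 1) / of_nat s ^ d :: complex) \<longlonglongrightarrow> 0"
          using power_ratio_tendsto[of "xs x - 1" d] by simp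
        then show ?thesis by (rule tendsto_mult_left_zero)
      qed
    qed
    from LIMSEQ_unique[OF lim1 this]
    have "g * (\<Sum>x\<in>L. (if xs x = d then 1 else 0) * (of_nat (npw \<omega> x) * bl x)) = 0" by simp
    moreover have "(\<Sum>x\<in>L. (if xs x = d then 1 else 0) * (of_nat (npw \<omega> x) * bl x)) = S (\<lambda>i. of_nat (\<omega> i))"
      unfolding S_def of_nat_npw[symmetric]
      by (rule sum.mono_neutral_cong_right) (use fin in \<open>auto simp: mult.commute\<close>)
    moreover have "g = G (\<lambda>i. of_nat (\<omega> i))"
      by (simp add: g_def G_def of_nat_dnpw mult.commute)
    ultimately show ?thesis by simp
  qed
  have "S z = 0" for z
  proof (rule polyfun_zero_of_mult_zero[of G S w])
    show "polyfun G" unfolding G_def by (intro polyfun_sum polyfun_mult polyfun_const polyfun_dcpow)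
    show "polyfun S" unfolding S_def by (intro polyfun_sum polyfun_mult polyfun_const polyfun_cpow)
    show "G w \<noteq> 0" using nz by (simp add: G_def)
  qed (rule prod0)
  then have "(\<Sum>x\<in>{x\<in>L. xs x = d}. bl x * cpow (\<lambda>i. of_nat (\<omega> i)) x) = 0" for \<omega>
    by (simp add: S_def)
  from cpow_coeffs_zero[OF _ this, of x1] show False using x1 fin by auto
qed

text \<open>
  The value at \<open>p\<close> of a higher derivative is a nonzero multiple of a Taylor coefficient.  This turns
  a Taylor coefficient, seen as a function of the centre, into an analytic function.
\<close>

lemma coef_opow_pd:
  fixes F :: "'k::{finite,linorder} mfps"
  shows "\<exists>c. (\<forall>\<delta>. c \<delta> \<noteq> 0) \<and> (\<forall>\<delta>. coef (opow pd I \<kappa> F) \<delta> = c \<delta> * coef F (\<delta> + (\<lambda>i. if i \<in> I then \<kappa> i else 0)))"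
proof -
  have pow: "\<exists>c. (\<forall>\<delta>. c \<delta> \<noteq> 0) \<and> (\<forall>\<delta>. coef ((pd i ^^ n) G) \<delta> = c \<delta> * coef G (\<delta> + (\<lambda>j. if j = i then n else 0)))"
    for i n and G :: "'k mfps"
  proof (induction n)
    case 0
    have "\<delta> + (\<lambda>j. if j = i then 0 else 0) = \<delta>" for \<delta> :: "'k \<Rightarrow> nat" by (simp add: fun_eq_iff)
    then show ?case by (intro exI[of _ "\<lambda>_. 1"]) simp
  next
    case (Suc n)
    then obtain c where c: "\<And>\<delta>. c \<delta> \<noteq> 0" "\<And>\<delta>. coef ((pd i ^^ n) G) \<delta> = c \<delta> * coef G (\<delta> + (\<lambda>j. if j = i then n else 0))"
      by blast
    have e: "\<delta> + unit_mi i + (\<lambda>j. if j = i then n else 0) = \<delta> + (\<lambda>j. if j = i then Suc n else 0)" for \<delta>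
      by (auto simp: fun_eq_iff unit_mi_def)
    have "coef ((pd i ^^ Suc n) G) \<delta> =
        of_nat (\<delta> i + 1) * c (\<delta> + unit_mi i) * coef G (\<delta> + (\<lambda>j. if j = i then Suc n else 0))" for \<delta>
      unfolding funpow.simps comp_apply coef_pd c e by (rule mult.assoc[symmetric])
    moreover have "of_nat (\<delta> i + 1) * c (\<delta> + unit_mi i) \<noteq> 0" for \<delta>
      using c(1) by (simp del: of_nat_Suc)
    ultimately show ?case
      by (intro exI[of _ "\<lambda>\<delta>. of_nat (\<delta> i + 1) * c (\<delta> + unit_mi i)"]) blast
  qed
  have "\<exists>c. (\<forall>\<delta>. c \<delta> \<noteq> 0) \<and> (\<forall>\<delta>. coef (foldr (\<lambda>i g. (pd i ^^ \<kappa> i) \<circ> g) L id F) \<delta> =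
      c \<delta> * coef F (\<delta> + (\<lambda>i. if i \<in> set L then \<kappa> i else 0)))" if "distinct L" for L
    using that
  proof (induction L)
    case Nil
    have "\<delta> + (\<lambda>i. if i \<in> set [] then \<kappa> i else 0) = \<delta>" for \<delta> :: "'k \<Rightarrow> nat" by (simp add: fun_eq_iff)
    then show ?case by (intro exI[of _ "\<lambda>_. 1"]) simp
  next
    case (Cons i L)
    then have "distinct L" by simp
    from Cons.IH[OF this] obtain c where c: "\<And>\<delta>. c \<delta> \<noteq> 0" "\<And>\<delta>. coef (foldr (\<lambda>i g. (pd i ^^ \<kappa> i) \<circ> g) L id F) \<delta> =
      c \<delta> * coef F (\<delta> + (\<lambda>i. if i \<in> set L then \<kappa> i else 0))" by blast
    obtain c' where c': "\<And>\<delta>. c' \<delta> \<noteq> 0" "\<And>\<delta>. coef ((pd i ^^ \<kappa> i) (foldr (\<lambda>i g. (pd i ^^ \<kappa> i) \<circ> g) L id F)) \<delta> =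
      c' \<delta> * coef (foldr (\<lambda>i g. (pd i ^^ \<kappa> i) \<circ> g) L id F) (\<delta> + (\<lambda>j. if j = i then \<kappa> i else 0))"
      using pow[of "\<kappa> i" i] by blast
    have e: "\<delta> + (\<lambda>j. if j = i then \<kappa> i else 0) + (\<lambda>i. if i \<in> set L then \<kappa> i else 0) =
      \<delta> + (\<lambda>j. if j \<in> set (i # L) then \<kappa> j else 0)" for \<delta>
      using Cons.prems by (auto simp: fun_eq_iff)
    have "coef (foldr (\<lambda>i g. (pd i ^^ \<kappa> i) \<circ> g) (i # L) id F) \<delta> =
        c' \<delta> * c (\<delta> + (\<lambda>j. if j = i then \<kappa> i else 0)) *
        coef F (\<delta> + (\<lambda>j. if j \<in> set (i # L) then \<kappa> j else 0))" for \<delta>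
      unfolding foldr.simps comp_apply c'(2) c(2) e by (rule mult.assoc[symmetric])
    moreover have "c' \<delta> * c (\<delta> + (\<lambda>j. if j = i then \<kappa> i else 0)) \<noteq> 0" for \<delta>
      using c(1) c'(1) by simp
    ultimately show ?case
      by (intro exI[of _ "\<lambda>\<delta>. c' \<delta> * c (\<delta> + (\<lambda>j. if j = i then \<kappa> i else 0))"]) blast
  qed
  from this[of "sorted_list_of_set I"] show ?thesis by (simp add: opow_def)
qed

lemma xi_eval_derivative:
  fixes P :: "'k::finite coeffs ^ 'm::finite ^ 'm"
  assumes P: "P \<in> mat_over (D_star T M)" and x: "x \<in> core T M" and \<nu>: "\<nu> \<in> T"
    and K: "finite K" "supp P \<subseteq> K"
  shows "partial_deriv \<nu> (xi_eval T (sigma_bar_star T M P $ i $ j) x) \<xi> =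
    (\<Sum>\<kappa>\<in>topdeg K (mat_ord T M P). (P $ i $ j) \<kappa> x * dcpow \<nu> (\<lambda>i. of_real (\<xi> $ i)) \<kappa>)"
proof -
  let ?b = "sigma_bar_star T M P $ i $ j" and ?k = "mat_ord T M P"
  have b: "?b \<kappa> x = (if mi_size \<kappa> = ?k then (P $ i $ j) \<kappa> x else 0)" for \<kappa>
    using x by (simp add: sigma_bar_star_def)
  have supp: "\<kappa> \<in> K \<and> mi_size \<kappa> = ?k" if "?b \<kappa> \<noteq> (\<lambda>_. 0)" for \<kappa>
  proof -
    have "mi_size \<kappa> = ?k" "(P $ i $ j) \<kappa> \<noteq> (\<lambda>_. 0)"
      using that by (auto simp: sigma_bar_star_def fun_eq_iff split: if_splits)
    then show ?thesis using K(2) supp_entry[of P i j] by blast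
  qed
  have star: "(P $ i $ j) \<kappa> x = 0" if "\<exists>i\<in>-T. \<kappa> i \<noteq> 0" for \<kappa>
    using P x that by (auto simp: mat_over_def D_star_def)
  have eval: "xi_eval T ?b x \<zeta> = (\<Sum>\<kappa>\<in>topdeg K ?k. (P $ i $ j) \<kappa> x * cpow (\<lambda>i. of_real (\<zeta> $ i)) \<kappa>)" for \<zeta>
    unfolding xi_eval_def
  proof (rule sum.mono_neutral_cong_left)
    show "finite (topdeg K ?k)" using K by simp
    show "{\<kappa>. ?b \<kappa> \<noteq> (\<lambda>_. 0) \<and> (\<forall>i\<in>-T. \<kappa> i = 0)} \<subseteq> topdeg K ?k" using supp by auto
    show "\<forall>\<kappa>\<in>topdeg K ?k - {\<kappa>. ?b \<kappa> \<noteq> (\<lambda>_. 0) \<and> (\<forall>i\<in>-T. \<kappa> i = 0)}.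
      (P $ i $ j) \<kappa> x * cpow (\<lambda>i. of_real (\<zeta> $ i)) \<kappa> = 0"
    proof
      fix \<kappa> assume \<kappa>: "\<kappa> \<in> topdeg K ?k - {\<kappa>. ?b \<kappa> \<noteq> (\<lambda>_. 0) \<and> (\<forall>i\<in>-T. \<kappa> i = 0)}"
      have "(P $ i $ j) \<kappa> x = 0"
      proof (cases "?b \<kappa> = (\<lambda>_. 0)")
        case True
        then show ?thesis using b[of \<kappa>] \<kappa> by simp
      next
        case False
        then show ?thesis using \<kappa> star[of \<kappa>] by auto
      qed
      then show "(P $ i $ j) \<kappa> x * cpow (\<lambda>i. of_real (\<zeta> $ i)) \<kappa> = 0" by simp
    qed
    fix \<kappa> assume \<kappa>: "\<kappa> \<in> {\<kappa>. ?b \<kappa> \<noteq> (\<lambda>_. 0) \<and> (\<forall>i\<in>-T. \<kappa> i = 0)}"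
    have "(\<Prod>i\<in>T. of_real (\<zeta> $ i) ^ \<kappa> i) = cpow (\<lambda>i. of_real (\<zeta> $ i)) \<kappa>"
      unfolding cpow_def by (rule prod.mono_neutral_left) (use \<kappa> in auto)
    moreover have "?b \<kappa> x = (P $ i $ j) \<kappa> x" using b[of \<kappa>] supp[of \<kappa>] \<kappa> by simp
    ultimately show "?b \<kappa> x * (\<Prod>i\<in>T. of_real (\<zeta> $ i) ^ \<kappa> i) = (P $ i $ j) \<kappa> x * cpow (\<lambda>i. of_real (\<zeta> $ i)) \<kappa>"
      by simp
  qed
  define R where "R \<kappa> = (\<Prod>j\<in>UNIV-{\<nu>}. complex_of_real (\<xi> $ j) ^ \<kappa> j)" for \<kappa>
  have line: "cpow (\<lambda>i. of_real ((\<xi> + s *\<^sub>R axis \<nu> 1) $ i)) \<kappa> = (of_real (\<xi> $ \<nu>) + of_real s) ^ \<kappa> \<nu> * R \<kappa>" for s \<kappa>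
  proof -
    have "cpow (\<lambda>i. of_real ((\<xi> + s *\<^sub>R axis \<nu> 1) $ i)) \<kappa> =
      of_real ((\<xi> + s *\<^sub>R axis \<nu> 1) $ \<nu>) ^ \<kappa> \<nu> * (\<Prod>j\<in>UNIV-{\<nu>}. of_real ((\<xi> + s *\<^sub>R axis \<nu> 1) $ j) ^ \<kappa> j)"
      unfolding cpow_def by (rule prod.remove) auto
    also have "(\<Prod>j\<in>UNIV-{\<nu>}. of_real ((\<xi> + s *\<^sub>R axis \<nu> 1) $ j) ^ \<kappa> j) = R \<kappa>"
      unfolding R_def by (rule prod.cong) (auto simp: axis_def)
    finally show ?thesis by simp
  qed
  have "((\<lambda>s. \<Sum>\<kappa>\<in>topdeg K ?k. (P $ i $ j) \<kappa> x * ((of_real (\<xi> $ \<nu>) + s) ^ \<kappa> \<nu> * R \<kappa>)) has_field_derivative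
    (\<Sum>\<kappa>\<in>topdeg K ?k. (P $ i $ j) \<kappa> x * (of_nat (\<kappa> \<nu>) * of_real (\<xi> $ \<nu>) ^ (\<kappa> \<nu> - 1) * R \<kappa>))) (at (of_real 0))"
    by (auto intro!: derivative_eq_intros simp: mult_ac)
  then have "((\<lambda>s. xi_eval T ?b x (\<xi> + s *\<^sub>R axis \<nu> 1)) has_vector_derivative
    (\<Sum>\<kappa>\<in>topdeg K ?k. (P $ i $ j) \<kappa> x * (of_nat (\<kappa> \<nu>) * of_real (\<xi> $ \<nu>) ^ (\<kappa> \<nu> - 1) * R \<kappa>))) (at 0)"
    unfolding eval line by (rule has_vector_derivative_real_field)
  then show ?thesis
    unfolding partial_deriv_def by (simp add: vector_derivative_at dcpow_def R_def mult_ac)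
qed

section \<open>Propagation along the Taylor expansion in t\<close>

lemma has_ps_same:
  assumes "has_ps f p F" "has_ps g p F"
  shows "eventually (\<lambda>q. f q = g q) (nhds p)"
proof -
  obtain r where r: "r > 0" "\<And>q. dist p q < r \<Longrightarrow> ps_sums F p q (f q)"
    using assms(1) by (rule has_psE) blast
  obtain r' where r': "r' > 0" "\<And>q. dist p q < r' \<Longrightarrow> ps_sums F p q (g q)"
    using assms(2) by (rule has_psE) blast
  have "f q = g q" if "dist q p < min r r'" for q
    using has_sum_unique[OF r(2) r'(2), of q] that by (simp add: dist_commute)
  then show ?thesis
    using r(1) r'(1) unfolding eventually_nhds_metric by (intro exI[of _ "min r r'"]) auto
qed

text \<open>
  As \<open>\<sigma>(P)\<close> is scalar, a nonvanishing entry of the given matrix lies on the diagonal, and all diagonal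
  entries are equal.
\<close>

lemma exists_nonvanishing_derivative:
  fixes P :: "'k::{finite,linorder} coeffs ^ 'm::finite ^ 'm"
  assumes M: "open M" and P: "P \<in> mat_over (D_star T M)" and Pt: "P \<in> mat_over (D_tilde T M)"
    and scal: "scalar_symbol T M (princ_symbol T M P)" and K: "finite K" "supp P \<subseteq> K"
    and nz: "\<exists>x\<in>core T M. \<exists>\<xi> :: 'k pt. (\<chi> i j. \<Sum>\<nu>\<in>T. of_nat (\<gamma> \<nu>) *
          partial_deriv \<nu> (xi_eval T (sigma_bar_star T M P $ i $ j) x) \<xi>) \<noteq> (0 :: complex ^ 'm ^ 'm)"
  shows "\<exists>x\<in>core T M. \<exists>z. (\<Sum>\<nu>\<in>T. of_nat (\<gamma> \<nu>) *
    (\<Sum>\<kappa>\<in>topdeg K (mat_ord T M P). (P $ i0 $ i0) \<kappa> x * dcpow \<nu> z \<kappa>)) \<noteq> 0"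
proof -
  let ?k = "mat_ord T M P"
  obtain x and \<xi> :: "'k pt" where x: "x \<in> core T M" and
    ne: "(\<chi> i j. \<Sum>\<nu>\<in>T. of_nat (\<gamma> \<nu>) * partial_deriv \<nu> (xi_eval T (sigma_bar_star T M P $ i $ j) x) \<xi>) \<noteq> (0 :: complex ^ 'm ^ 'm)"
    using nz by blast
  have "\<exists>i j. (\<Sum>\<nu>\<in>T. of_nat (\<gamma> \<nu>) * partial_deriv \<nu> (xi_eval T (sigma_bar_star T M P $ i $ j) x) \<xi>) \<noteq> 0"
  proof (rule ccontr)
    assume "\<not> ?thesis"
    then have "(\<chi> i j. \<Sum>\<nu>\<in>T. of_nat (\<gamma> \<nu>) * partial_deriv \<nu> (xi_eval T (sigma_bar_star T M P $ i $ j) x) \<xi>) = (0 :: complex ^ 'm ^ 'm)"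
      by (simp add: vec_eq_iff)
    then show False using ne by blast
  qed
  then obtain i j where ij: "(\<Sum>\<nu>\<in>T. of_nat (\<gamma> \<nu>) * partial_deriv \<nu> (xi_eval T (sigma_bar_star T M P $ i $ j) x) \<xi>) \<noteq> 0"
    by blast
  let ?z = "\<lambda>i. complex_of_real (\<xi> $ i)"
  have "(\<Sum>\<nu>\<in>T. of_nat (\<gamma> \<nu>) * partial_deriv \<nu> (xi_eval T (sigma_bar_star T M P $ i $ j) x) \<xi>) =
    (\<Sum>\<nu>\<in>T. of_nat (\<gamma> \<nu>) * (\<Sum>\<kappa>\<in>topdeg K ?k. (P $ i $ j) \<kappa> x * dcpow \<nu> ?z \<kappa>))"
    by (rule sum.cong) (simp_all add: xi_eval_derivative[OF P x _ K])
  with ij have ij': "(\<Sum>\<nu>\<in>T. of_nat (\<gamma> \<nu>) * (\<Sum>\<kappa>\<in>topdeg K ?k. (P $ i $ j) \<kappa> x * dcpow \<nu> ?z \<kappa>)) \<noteq> 0" by simp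
  have "eventually (\<lambda>q. \<forall>i j \<kappa>. mi_size \<kappa> = ?k \<longrightarrow> (P $ i $ j) \<kappa> q = (if i = j then (P $ i0 $ i0) \<kappa> q else 0)) (nhds x)"
    by (rule scalar_symbol_coeffs[OF M Pt _ x]) (use scal in \<open>simp add: princ_symbol_def\<close>)
  from eventually_nhds_x_imp_x[OF this]
  have e: "(P $ i $ j) \<kappa> x = (if i = j then (P $ i0 $ i0) \<kappa> x else 0)" if "mi_size \<kappa> = ?k" for \<kappa>
    using that by blast
  have "i = j"
  proof (rule ccontr)
    assume "i \<noteq> j"
    then have "(\<Sum>\<kappa>\<in>topdeg K ?k. (P $ i $ j) \<kappa> x * dcpow \<nu> ?z \<kappa>) = 0" for \<nu>
      by (intro sum.neutral) (auto simp: e)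
    then show False using ij' by simp
  qed
  have "(\<Sum>\<kappa>\<in>topdeg K ?k. (P $ i $ j) \<kappa> x * dcpow \<nu> ?z \<kappa>) = (\<Sum>\<kappa>\<in>topdeg K ?k. (P $ i0 $ i0) \<kappa> x * dcpow \<nu> ?z \<kappa>)" for \<nu>
    by (rule sum.cong[OF refl]) (use e in \<open>simp add: if_P[OF \<open>i = j\<close>]\<close>)
  then show ?thesis using ij' x by auto
qed

lemma D_star_tay:
  fixes P :: "'k::{finite,linorder} coeffs ^ 'm::finite ^ 'm"
  assumes M: "open M" and P: "P \<in> mat_over (D_star T M)" and Pt: "P \<in> mat_over (D_tilde T M)"
    and p: "p \<in> core T M" and \<kappa>: "\<exists>i\<in>-T. \<kappa> i \<noteq> 0" and \<delta>: "\<forall>i\<in>T. \<delta> i = 0"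
  shows "coef (taymat p P i j \<kappa>) \<delta> = 0"
proof (rule core_zero_coef[OF M p _ _ \<delta>])
  show "has_ps ((P $ i $ j) \<kappa>) p (taymat p P i j \<kappa>)"
    unfolding taymat_def by (rule ana_has_ps[OF D_tilde_ana[OF M Pt p]])
  show "(P $ i $ j) \<kappa> x = 0" if "x \<in> core T M" for x
    using P \<kappa> that by (auto simp: mat_over_def D_star_def)
qed

text \<open>
  The function \<open>f\<close> is \<open>\<partial>\<^sub>t\<^sup>\<gamma>\<close> of a coefficient of \<open>\<sigma>(Q)\<close>, and \<open>g\<close> is \<open>\<Sum>\<^sub>\<nu> \<gamma>\<^sub>\<nu> \<partial>\<sigma>(P)/\<partial>\<xi>\<^sub>\<nu>\<close> on \<open>N\<close> at a fixed
  covector where it is not identically zero in \<open>x\<close>.  At the points of \<open>N\<close> where \<open>g\<close> does not vanish, the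
  bracket identity gives \<open>f = 0\<close>; hence \<open>f = 0\<close> on all of \<open>N\<close>.  The vanishing of \<open>f\<close> on \<open>N\<close>, and not only
  at \<open>p\<close>, yields the coefficients at all \<open>\<delta>\<close> that agree with \<open>\<gamma>\<close> on \<open>T\<close>.
\<close>

lemma taylor_step:
  fixes P Q :: "'k::{finite,linorder} coeffs ^ 'm::finite ^ 'm"
  assumes M: "open M" and conn: "connected (core T M)"
    and P: "P \<in> mat_over (D_tilde T M)" and Q: "Q \<in> mat_over (D_tilde T M)"
    and comm: "op_commute T M P Q" and Ps: "P \<in> mat_over (D_star T M)"
    and scal: "scalar_symbol T M (princ_symbol T M P)"
    and low: "scalar_symbol T M (mat_sigma (int (mat_ord T M P) - 1) P) \<or> scalar_symbol T M (princ_symbol T M Q)"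
    and nz: "\<exists>x\<in>core T M. \<exists>\<xi> :: 'k pt. (\<chi> i j. \<Sum>\<nu>\<in>T. of_nat (\<gamma> \<nu>) *
          partial_deriv \<nu> (xi_eval T (sigma_bar_star T M P $ i $ j) x) \<xi>) \<noteq> (0 :: complex ^ 'm ^ 'm)"
    and \<gamma>: "\<forall>i\<in>-T. \<gamma> i = 0"
    and H: "\<And>p \<kappa> \<mu>. p \<in> core T M \<Longrightarrow> \<kappa> + \<mu> = \<gamma> \<Longrightarrow> \<kappa> \<noteq> 0 \<Longrightarrow>
      (\<forall>x. mi_size x = mat_ord T M P \<longrightarrow> (\<forall>i \<delta>. (\<forall>i\<in>T. \<delta> i = \<kappa> i) \<longrightarrow> coef (taymat p P i i x) \<delta> = 0)) \<or>
      (\<forall>x. mi_size x = mat_ord T M Q \<longrightarrow> (\<forall>i j \<delta>. (\<forall>i\<in>T. \<delta> i = \<mu> i) \<longrightarrow> coef (taymat p Q i j x) \<delta> = 0))"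
    and p: "p \<in> core T M" and y: "mi_size y = mat_ord T M Q" and \<delta>: "\<forall>i\<in>T. \<delta> i = \<gamma> i"
  shows "coef (taymat p Q i j y) \<delta> = 0"
proof -
  \<comment> \<open>The index \<open>y\<close> is added because it need not be in the support of \<open>Q\<close>.\<close>
  define K where "K = insert y (supp P \<union> supp Q)"
  have K: "finite K" "supp P \<subseteq> K" "supp Q \<subseteq> K" "y \<in> K"
    using finite_supp[OF P] finite_supp[OF Q] by (auto simp: K_def)
  let ?A = "topdeg K (mat_ord T M P)" and ?B = "topdeg K (mat_ord T M Q)"
  obtain x0 z where x0: "x0 \<in> core T M" and
    nz0: "(\<Sum>\<nu>\<in>T. of_nat (\<gamma> \<nu>) * (\<Sum>\<kappa>\<in>?A. (P $ i $ i) \<kappa> x0 * dcpow \<nu> z \<kappa>)) \<noteq> 0"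
    using exists_nonvanishing_derivative[OF M Ps P scal K(1,2) nz, of i] by blast
  define g where "g x = (\<Sum>\<nu>\<in>T. of_nat (\<gamma> \<nu>) * (\<Sum>\<kappa>\<in>?A. (P $ i $ i) \<kappa> x * dcpow \<nu> z \<kappa>))" for x
  define f where "f = op_power partial_deriv T \<gamma> ((Q $ i $ j) y)"
  have psP: "has_ps ((P $ i $ i) \<kappa>) q (taymat q P i i \<kappa>)" if "q \<in> core T M" for q \<kappa>
    unfolding taymat_def by (rule ana_has_ps[OF D_tilde_ana[OF M P that]])
  have psQ: "has_ps ((Q $ i $ j) y) q (taymat q Q i j y)" if "q \<in> core T M" for q
    unfolding taymat_def by (rule ana_has_ps[OF D_tilde_ana[OF M Q that]])
  have ana_g: "ana g q" if "q \<in> core T M" for q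
    unfolding g_def[abs_def]
    by (rule has_ps_ana, rule has_ps_sum, rule has_ps_mult, rule has_ps_const, rule has_ps_sum,
        rule has_ps_mult, rule psP[OF that], rule has_ps_const)
  have ps_f: "has_ps f q (opow pd T \<gamma> (taymat q Q i j y))" if "q \<in> core T M" for q
    unfolding f_def op_power_eq_opow
    by (rule opow_rel[where R = "\<lambda>f F. has_ps f q F"]) (use psQ[OF that] in \<open>auto intro: has_ps_partial_deriv\<close>)
  have \<gamma>T: "(\<lambda>i. if i \<in> T then \<gamma> i else 0) = \<gamma>" using \<gamma> by (auto simp: fun_eq_iff)
  have f_zero: "f q = 0" if q: "q \<in> core T M" and gq: "g q \<noteq> 0" for q
  proof -
    let ?a = "taymat q P i i" and ?b = "taymat q Q i j"
    have "coef (?b y) \<gamma> = 0"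
    proof (rule top_degree_vanishing[where K = ?A and L = ?B and T = T and al = "\<lambda>x. coef (?a x) 0"
          and aj = "\<lambda>\<nu> x. coef (?a x) (unit_mi \<nu>)" and bl = "\<lambda>x. coef (?b x) \<gamma>" and \<gamma> = \<gamma> and w = z and x = y])
      fix \<omega> :: "'k \<Rightarrow> nat"
      have "(\<Sum>\<nu>\<in>T. of_nat (\<gamma> \<nu>) * coef (dsymb \<nu> ?A ?a \<omega>) 0) * coef (symb ?B ?b \<omega>) \<gamma> =
        (\<Sum>\<nu>\<in>-T. coef (dsymb \<nu> ?B ?b \<omega>) \<gamma> * coef (symb ?A ?a \<omega>) (unit_mi \<nu>))"
      proof (rule bracket_coef[OF bracket_identity[OF M P Q comm scal low q K(1-3)] \<gamma>])
        show "coef (?a \<kappa>) 0 = 0" if "\<exists>i\<in>-T. \<kappa> i \<noteq> 0" for \<kappa>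
          by (rule D_star_tay[OF M Ps P q that]) simp
        fix \<kappa> \<mu> assume "\<kappa> + \<mu> = \<gamma>" "\<kappa> \<noteq> 0"
        from H[OF q this] show "(\<forall>x\<in>?A. \<forall>\<delta>. (\<forall>i\<in>T. \<delta> i = \<kappa> i) \<longrightarrow> coef (?a x) \<delta> = 0) \<or>
          (\<forall>x\<in>?B. \<forall>\<delta>. (\<forall>i\<in>T. \<delta> i = \<mu> i) \<longrightarrow> coef (?b x) \<delta> = 0)"
          by blast
      qed
      then show "(\<Sum>\<nu>\<in>T. of_nat (\<gamma> \<nu>) * (\<Sum>x\<in>?A. of_nat (dnpw \<nu> \<omega> x) * coef (?a x) 0)) *
        (\<Sum>x\<in>?B. of_nat (npw \<omega> x) * coef (?b x) \<gamma>) =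
        (\<Sum>\<nu>\<in>-T. (\<Sum>x\<in>?B. of_nat (dnpw \<nu> \<omega> x) * coef (?b x) \<gamma>) * (\<Sum>x\<in>?A. of_nat (npw \<omega> x) * coef (?a x) (unit_mi \<nu>)))"
        by (simp only: symb_def dsymb_def coef_sum coef_of_nat_mult)
    next
      show "coef (?a x) 0 = 0" if "\<exists>i\<in>-T. x i \<noteq> 0" for x
        by (rule D_star_tay[OF M Ps P q that]) simp
      show "coef (?a x) (unit_mi \<nu>) = 0" if "\<exists>i\<in>-T. x i \<noteq> 0" "\<nu> \<notin> T" for x \<nu>
        by (rule D_star_tay[OF M Ps P q that(1)]) (use that(2) in \<open>auto simp: unit_mi_def\<close>)
      show "(\<Sum>\<nu>\<in>T. of_nat (\<gamma> \<nu>) * (\<Sum>x\<in>?A. coef (?a x) 0 * dcpow \<nu> z x)) \<noteq> 0"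
        using gq by (simp add: g_def has_ps_at_center[OF psP[OF q]])
    qed (use K y in auto)
    moreover obtain c where "\<And>\<delta>. coef (opow pd T \<gamma> (?b y)) \<delta> = c \<delta> * coef (?b y) (\<delta> + \<gamma>)"
      using coef_opow_pd[of T \<gamma> "?b y"] unfolding \<gamma>T by blast
    ultimately show "f q = 0" using has_ps_at_center[OF ps_f[OF q]] by simp
  qed
  have f0: "f q = 0" if "q \<in> core T M" for q
  proof (rule analytic_zero_of_mult_zero[OF M conn _ ana_g x0 _ f_zero that])
    show "ana f q" if "q \<in> core T M" for q by (rule has_ps_ana[OF ps_f[OF that]])
    show "g x0 \<noteq> 0" using nz0 by (simp add: g_def)
  qed
  obtain c where c: "\<And>\<delta>. c \<delta> \<noteq> 0" "\<And>\<delta>. coef (opow pd T \<gamma> (taymat p Q i j y)) \<delta> = c \<delta> * coef (taymat p Q i j y) (\<delta> + \<gamma>)"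
    using coef_opow_pd[of T \<gamma> "taymat p Q i j y"] unfolding \<gamma>T by blast
  have "coef (opow pd T \<gamma> (taymat p Q i j y)) (\<delta> - \<gamma>) = 0"
    by (rule core_zero_coef[OF M p ps_f[OF p] f0]) (use \<delta> in auto)
  moreover have "\<delta> - \<gamma> + \<gamma> = \<delta>"
  proof
    fix i show "(\<delta> - \<gamma> + \<gamma>) i = \<delta> i" using \<delta> \<gamma> by (cases "i \<in> T") auto
  qed
  ultimately show ?thesis using c by simp
qed

theorem theorem2p2:
  fixes T :: "'k::{finite,linorder} set"
    and M :: "'k pt set"
    and P Q :: "'k coeffs ^ 'm::finite ^ 'm"
  assumes "open M" and "connected M" and "connected (core T M)"
    and "P \<in> mat_over (D_tilde T M)" and "Q \<in> mat_over (D_tilde T M)"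
    and "op_nonzero T M P" and "op_nonzero T M Q"
    and "op_commute T M P Q"
    and "P \<in> mat_over (D_star T M)"
    and "scalar_symbol T M (princ_symbol T M P)"
    and "\<And>\<gamma> :: 'k \<Rightarrow> nat. (\<forall>\<nu>\<in>- T. \<gamma> \<nu> = 0) \<Longrightarrow> \<gamma> \<noteq> (\<lambda>_. 0) \<Longrightarrow>
      \<exists>x\<in>core T M. \<exists>\<xi> :: 'k pt.
        (\<chi> i j. \<Sum>\<nu>\<in>T. of_nat (\<gamma> \<nu>) *
          partial_deriv \<nu> (xi_eval T (sigma_bar_star T M P $ i $ j) x) \<xi>) \<noteq> (0 :: complex ^ 'm ^ 'm)"
    and "scalar_symbol T M (mat_sigma (int (mat_ord T M P) - 1) P) \<or>
      scalar_symbol T M (princ_symbol T M Q)"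
  shows "xi_commute T M (sigma_star T M P) (sigma_star T M Q) \<and>
    xi_nonzero T M (sigma_bar_star T M Q) \<and>
    (indep_of_t T M (princ_symbol T M P) \<longrightarrow> indep_of_t T M (princ_symbol T M Q))"
proof (intro conjI impI)
  note M = assms(1) and P = assms(4) and Q = assms(5) and comm = assms(8) and nz = assms(11)
  note step = taylor_step[OF M assms(3) P Q comm assms(9,10,12) nz]
  let ?k = "mat_ord T M P" and ?l = "mat_ord T M Q"
  have psQ: "has_ps ((Q $ i $ j) y) p (taymat p Q i j y)" if "p \<in> core T M" for p i j y
    unfolding taymat_def by (rule ana_has_ps[OF D_tilde_ana[OF M Q that]])
  have psP: "has_ps ((P $ i $ j) y) p (taymat p P i j y)" if "p \<in> core T M" for p i j y
    unfolding taymat_def by (rule ana_has_ps[OF D_tilde_ana[OF M P that]])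
  show "xi_commute T M (sigma_star T M P) (sigma_star T M Q)"
    by (rule xi_commute_sigma_star[OF M P Q comm])
  show "xi_nonzero T M (sigma_bar_star T M Q)"
  proof (rule ccontr)
    assume "\<not> ?thesis"
    then have Q0: "(Q $ i $ j) y x = 0" if "x \<in> core T M" "mi_size y = ?l" for i j y x
      using that by (auto simp: xi_nonzero_def sigma_bar_star_def split: if_splits)
    \<comment> \<open>By induction on the \<open>t\<close>-degree \<open>\<gamma>\<close> all Taylor coefficients of \<open>\<sigma>(Q)\<close> vanish.\<close>
    have *: "coef (taymat p Q i j y) \<delta> = 0"
      if "\<forall>i\<in>-T. \<gamma> i = 0" "p \<in> core T M" "mi_size y = ?l" "\<forall>i\<in>T. \<delta> i = \<gamma> i" for \<gamma> p i j y \<delta>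
      using that
    proof (induction "mi_size \<gamma>" arbitrary: \<gamma> p i j y \<delta> rule: less_induct)
      case less
      show ?case
      proof (cases "\<gamma> = (\<lambda>_. 0)")
        case True
        show ?thesis
          by (rule core_zero_coef[OF M less.prems(2) psQ[OF less.prems(2)]]) (use Q0 less.prems True in auto)
      next
        case False
        show ?thesis
        proof (rule step[OF less.prems(1) False less.prems(1) _ less.prems(2-4)])
          fix q \<kappa> \<mu> assume q: "q \<in> core T M" and s: "\<kappa> + \<mu> = \<gamma>" "\<kappa> \<noteq> 0"
          from s(2) obtain i where "\<kappa> i \<noteq> 0" by (auto simp: fun_eq_iff)
          then have "0 < mi_size \<kappa>" unfolding mi_size_def by (intro sum_pos2[of _ i]) auto
          then have lt: "mi_size \<mu> < mi_size \<gamma>"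
            unfolding s(1)[symmetric] by (simp add: mi_size_def sum.distrib)
          have "\<forall>i\<in>-T. \<mu> i = 0" using less.prems(1) unfolding s(1)[symmetric] by simp
          then have "coef (taymat q Q i j x) \<delta> = 0"
            if "mi_size x = ?l" "\<forall>i\<in>T. \<delta> i = \<mu> i" for x i j \<delta>
            using less.hyps[OF lt _ q that] by blast
          then show "(\<forall>x. mi_size x = ?k \<longrightarrow> (\<forall>i \<delta>. (\<forall>i\<in>T. \<delta> i = \<kappa> i) \<longrightarrow> coef (taymat q P i i x) \<delta> = 0)) \<or>
            (\<forall>x. mi_size x = ?l \<longrightarrow> (\<forall>i j \<delta>. (\<forall>i\<in>T. \<delta> i = \<mu> i) \<longrightarrow> coef (taymat q Q i j x) \<delta> = 0))"
            by blast
        qed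
      qed
    qed
    have "near T M (\<lambda>p. (Q $ i $ j) y p = 0)" if "mi_size y = ?l" for i j y
      unfolding near_iff[OF M]
    proof
      fix p assume p: "p \<in> core T M"
      have "taymat p Q i j y = 0"
      proof (rule mfps_eqI)
        fix \<delta> :: "'k \<Rightarrow> nat"
        show "coef (taymat p Q i j y) \<delta> = coef 0 \<delta>"
          using *[of "\<lambda>i. if i \<in> T then \<delta> i else 0" p y \<delta> i j] p that by simp
      qed
      then have "has_ps ((Q $ i $ j) y) p 0" using psQ[OF p, of i j y] by simp
      from has_ps_same[OF this has_ps_zero] show "eventually (\<lambda>q. (Q $ i $ j) y q = 0) (nhds p)" .
    qed
    then show False using ord_attained[OF M Q assms(7)] by blast
  qed
  show "indep_of_t T M (princ_symbol T M Q)" if indep: "indep_of_t T M (princ_symbol T M P)"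
  proof -
    obtain W where W: "open W" "core T M \<subseteq> W" "W \<subseteq> M" and
      eq: "\<And>p q \<zeta>. p \<in> W \<Longrightarrow> q \<in> W \<Longrightarrow> \<forall>i\<in>-T. p $ i = q $ i \<Longrightarrow> princ_symbol T M P p \<zeta> = princ_symbol T M P q \<zeta>"
      using indep unfolding indep_of_t_def by blast
    have projs: "\<forall>i\<in>-T. q $ i = proj T q $ i" for q by (simp add: proj_def)
    have entry: "princ_symbol T M R q \<zeta> $ i $ j = sigma (int (mat_ord T M R)) (R $ i $ j) q \<zeta>"
      for R :: "'k coeffs ^ 'm ^ 'm" and q \<zeta> i j
      by (simp add: princ_symbol_def mat_sigma_def)
    have P0: "coef (taymat p P i j x) \<delta> = 0"
      if p: "p \<in> core T M" and x: "mi_size x = ?k" and \<delta>: "\<exists>i\<in>T. \<delta> i \<noteq> 0" for p i j x \<delta>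
    proof -
      have pW: "p \<in> W" using p W by blast
      have "eventually (\<lambda>q. q \<in> W) (nhds p)" by (rule eventually_nhds_in_open[OF W(1) pW])
      then have "eventually (\<lambda>q. (P $ i $ j) x q = (P $ i $ j) x (proj T q)) (nhds p)"
        using eventually_proj[OF p eventually_nhds_in_open[OF W(1) pW]]
      proof eventually_elim
        case (elim q)
        have "sigma (int ?k) (P $ i $ j) q \<zeta> = sigma (int ?k) (P $ i $ j) (proj T q) \<zeta>" for \<zeta>
          unfolding entry[symmetric] eq[OF elim projs] ..
        then show ?case using sigma_eq_iff[OF finite_entry[OF P, of i j] finite_entry[OF P, of i j], of ?k q "proj T q"] x by blast
      qed
      then have "taymat p P i j x = rho T (taymat p P i j x)"
        by (rule has_ps_unique[OF psP[OF p] has_ps_proj[OF p psP[OF p]]])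
      then have "coef (taymat p P i j x) \<delta> = coef (rho T (taymat p P i j x)) \<delta>" by (rule arg_cong)
      then show ?thesis using \<delta> by (auto simp: coef_rho split: if_splits)
    qed
    have Q1: "coef (taymat p Q i j y) \<delta> = 0"
      if p: "p \<in> core T M" and y: "mi_size y = ?l" and \<delta>: "\<exists>i\<in>T. \<delta> i \<noteq> 0" for p i j y \<delta>
    proof -
      define \<gamma> where "\<gamma> i = (if i \<in> T then \<delta> i else 0)" for i
      have \<gamma>: "\<forall>i\<in>-T. \<gamma> i = 0" "\<gamma> \<noteq> (\<lambda>_. 0)" "\<forall>i\<in>T. \<delta> i = \<gamma> i"
        using \<delta> by (auto simp: \<gamma>_def fun_eq_iff)
      show ?thesis
      proof (rule step[OF \<gamma>(1,2,1) _ p y \<gamma>(3)])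
        fix q \<kappa> \<mu> assume q: "q \<in> core T M" and s: "\<kappa> + \<mu> = \<gamma>" "\<kappa> \<noteq> 0"
        from s(2) obtain i where i: "\<kappa> i \<noteq> 0" by (auto simp: fun_eq_iff)
        have "i \<in> T"
        proof (rule ccontr)
          assume "i \<notin> T"
          then have "(\<kappa> + \<mu>) i = 0" using \<gamma>(1) unfolding s(1) by simp
          then show False using i by simp
        qed
        then have "coef (taymat q P j j x) \<delta> = 0" if "mi_size x = ?k" "\<forall>i\<in>T. \<delta> i = \<kappa> i" for x j \<delta>
          using that i by (intro P0[OF q]) auto
        then show "(\<forall>x. mi_size x = ?k \<longrightarrow> (\<forall>i \<delta>. (\<forall>i\<in>T. \<delta> i = \<kappa> i) \<longrightarrow> coef (taymat q P i i x) \<delta> = 0)) \<or>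
          (\<forall>x. mi_size x = ?l \<longrightarrow> (\<forall>i j \<delta>. (\<forall>i\<in>T. \<delta> i = \<mu> i) \<longrightarrow> coef (taymat q Q i j x) \<delta> = 0))"
          by blast
      qed
    qed
    have "\<exists>r>0. ball p r \<subseteq> M \<and> (\<forall>q\<in>ball p r. \<forall>i j y. mi_size y = ?l \<longrightarrow> (Q $ i $ j) y q = (Q $ i $ j) y (proj T q))"
      if p: "p \<in> core T M" for p
    proof -
      have "eventually (\<lambda>q. (Q $ i $ j) y q = (Q $ i $ j) y (proj T q)) (nhds p)" if "mi_size y = ?l" for i j y
      proof (rule has_ps_same[OF psQ[OF p]])
        have "rho T (taymat p Q i j y) = taymat p Q i j y"
          by (rule mfps_eqI) (use Q1[OF p that] in \<open>auto simp: coef_rho\<close>)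
        then show "has_ps (\<lambda>q. (Q $ i $ j) y (proj T q)) p (taymat p Q i j y)"
          using has_ps_proj[OF p psQ[OF p, of i j y]] by simp
      qed
      then have "eventually (\<lambda>q. \<forall>i\<in>UNIV. \<forall>j\<in>UNIV. \<forall>y\<in>topdeg (supp Q) ?l. (Q $ i $ j) y q = (Q $ i $ j) y (proj T q)) (nhds p)"
        using finite_supp[OF Q] by (intro eventually_ball_finite ballI) auto
      moreover have "eventually (\<lambda>q. q \<in> M) (nhds p)"
        using p by (intro eventually_nhds_in_open[OF M]) (auto simp: core_def)
      ultimately have "eventually (\<lambda>q. q \<in> M \<and> (\<forall>i j y. mi_size y = ?l \<longrightarrow> (Q $ i $ j) y q = (Q $ i $ j) y (proj T q))) (nhds p)"
      proof eventually_elim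
        case (elim q)
        have "(Q $ i $ j) y q = (Q $ i $ j) y (proj T q)" if "mi_size y = ?l" for i j y
        proof (cases "y \<in> supp Q")
          case True
          then show ?thesis using elim(1) that by blast
        next
          case False
          then have "(Q $ i $ j) y = (\<lambda>_. 0)" by (auto simp: supp_def)
          then show ?thesis by simp
        qed
        then show ?case using elim(2) by blast
      qed
      then show ?thesis
        unfolding eventually_nhds_metric by (auto simp: subset_iff dist_commute)
    qed
    then obtain r where r: "\<And>p. p \<in> core T M \<Longrightarrow> r p > 0 \<and> ball p (r p) \<subseteq> M \<and>
        (\<forall>q\<in>ball p (r p). \<forall>i j y. mi_size y = ?l \<longrightarrow> (Q $ i $ j) y q = (Q $ i $ j) y (proj T q))"
      by metis
    \<comment> \<open>Two points of \<open>V\<close> with equal \<open>x\<close> may lie in different balls; they are compared through their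
      common projection to \<open>N\<close>.\<close>
    define V where "V = (\<Union>p\<in>core T M. ball p (r p))"
    have SQ: "princ_symbol T M Q q \<zeta> = princ_symbol T M Q (proj T q) \<zeta>" if "q \<in> V" for q \<zeta>
    proof -
      have q: "\<forall>i j y. mi_size y = ?l \<longrightarrow> (Q $ i $ j) y q = (Q $ i $ j) y (proj T q)"
        using that r by (auto simp: V_def)
      have "princ_symbol T M Q q \<zeta> $ i $ j = princ_symbol T M Q (proj T q) \<zeta> $ i $ j" for i j
        unfolding entry
        using sigma_eq_iff[OF finite_entry[OF Q, of i j] finite_entry[OF Q, of i j], of ?l q "proj T q"] q by blast
      then show ?thesis by (simp add: vec_eq_iff)
    qed
    show ?thesis
      unfolding indep_of_t_def
    proof (intro exI[of _ V] conjI ballI impI allI)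
      show "open V" by (auto simp: V_def)
      show "core T M \<subseteq> V" using r by (force simp: V_def)
      show "V \<subseteq> M" using r by (auto simp: V_def)
      fix p q \<zeta> assume "p \<in> V" "q \<in> V" and same: "\<forall>i\<in>-T. p $ i = q $ i"
      moreover have "proj T p = proj T q" using same by (simp add: proj_def vec_eq_iff)
      ultimately show "princ_symbol T M Q p \<zeta> = princ_symbol T M Q q \<zeta>" using SQ by simp
    qed
  qed
qed

end
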